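(* Assume the standing assumptions below hold and let $g\in H^1(0,T)$ with $g(0)=0$. Let $u=u(x,t;g)$ be the weak solution of the forward problem (P). Then \[ \|u_{xx}\|^2_{L^\infty(0,T;L^2(0,\ell))}\le C_1^2\,\|g'\|^2_{L^2(0,T)},\qquad \|u_{xx}\|^2_{L^2(0,T;L^2(0,\ell))}\le C_2^2\,\|g'\|^2_{L^2(0,T)}, \] \[ \|u_{t}\|^2_{L^2(0,T;L^2(0,\ell))}\le \frac{r_0}{2\rho_0}\,C_2^2\,\|g'\|^2_{L^2(0,T)},\qquad \|u_{xxt}\|^2_{L^2(0,T;L^2(0,\ell))}\le \frac{r_0}{4\kappa_0}\,C_2^2\,\|g'\|^2_{L^2(0,T)}, \] where \[ C_0^2=\frac{4\hat\ell(1+T)}{r_0^2},\quad \hat\ell=\ell+\frac{\ell^3}{3},\quad C_\theta^2=\Big(\frac{2h\cos\theta}{\pi}\Big)^2,\quad C_e^2=e^{T}, \] \[ C_1^2=C_0^2(1+C_\theta^2)C_e^2,\qquad C_2^2=C_0^2(1+C_\theta^2)(1+C_e^2). \]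
   Context: Standing assumptions: $\ell>0$, $T>0$, $\Omega_T=(0,\ell)\times(0,T)$; $h>0$ (tip length) and $\theta$ (half-conic angle) are given, and $c_\theta:=2h\cos\theta/\pi$. The coefficients satisfy $\rho_A,\mu,r,\kappa\in L^\infty(0,\ell)$ with constants $0<\rho_0\le\rho_A(x)\le\rho_1$, $0\le\mu_0\le\mu(x)\le\mu_1$, $0<r_0\le r(x)\le r_1$, $0<\kappa_0\le\kappa(x)\le\kappa_1$ for a.e. $x\in(0,\ell)$. The forward problem (P) for a shear force $g$ is \[ \rho_A(x)u_{tt}+\mu(x)u_t+\big(r(x)u_{xx}+\kappa(x)u_{xxt}\big)_{xx}=0\ \text{in }\Omega_T,\qquad u(x,0)=u_t(x,0)=0, \] \[ u(0,t)=u_x(0,t)=0,\quad \big(r u_{xx}+\kappa u_{xxt}\big)\big|_{x=\ell}=M(t),\quad -\big(r u_{xx}+\kappa u_{xxt}\big)_x\big|_{x=\ell}=g(t),\ t\in[0,T], \] with moment $M(t)=c_\theta\, g(t)$. Let $\mathcal V=\{v\in H^2(0,\ell): v(0)=v'(0)=0\}$. The weak solution of (P) is the (unique) function $u\in L^2(0,T;\mathcal V)$ with $u_t\in L^2(0,T;L^2(0,\ell))$, $u_{xxt}\in L^2(0,T;L^2(0,\ell))$, $u_{tt}\in L^2(0,T;H^{-2}(0,\ell))$, satisfying the zero initial conditions and, for a.e. $t$ and all $v\in\mathcal V$, $\langle\rho_A u_{tt},v\rangle+(\mu u_t,v)+(r u_{xx}+\kappa u_{xxt},v'')=M(t)v'(\ell)+g(t)v(\ell)$.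 *)

theory Defs
  imports "HOL-Analysis.Analysis"
begin

definition L2_on :: "'a::euclidean_space set \<Rightarrow> ('a \<Rightarrow> real) \<Rightarrow> bool" where
  "L2_on A f \<longleftrightarrow> set_borel_measurable lborel A f \<and> set_integrable lborel A (\<lambda>x. (f x)^2)"

definition L2ip :: "real \<Rightarrow> (real \<Rightarrow> real) \<Rightarrow> (real \<Rightarrow> real) \<Rightarrow> real" where
  "L2ip l f g = set_lebesgue_integral lborel {0..l} (\<lambda>x. f x * g x)"

text \<open>Membership in V = {v in H^2(0,l): v(0) = v'(0) = 0}, with second (weak) derivative v2:
  in one dimension this is exactly v(x) = int_0^x (x - s) v2(s) ds with v2 in L^2(0,l).\<close>
definition inV :: "real \<Rightarrow> (real \<Rightarrow> real) \<Rightarrow> (real \<Rightarrow> real) \<Rightarrow> bool" where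
  "inV l v v2 \<longleftrightarrow> L2_on {0..l} v2 \<and>
     (\<forall>x\<in>{0..l}. v x = set_lebesgue_integral lborel {0..x} (\<lambda>s. (x - s) * v2 s))"

text \<open>First derivative of v at l, v'(l) = int_0^l v2.\<close>
definition dV_end :: "real \<Rightarrow> (real \<Rightarrow> real) \<Rightarrow> real" where
  "dV_end l v2 = set_lebesgue_integral lborel {0..l} v2"

definition c_theta :: "real \<Rightarrow> real \<Rightarrow> real" where
  "c_theta h \<theta> = 2 * h * cos \<theta> / pi"

text \<open>Weak solution of (P): u, with u_t = ut, u_xx = uxx, u_xxt = uxxt (all functions of (x,t)).
  Regularity: u, u_xx, u_t, u_xxt in L^2(Omega_T); u(.,t) in V with second derivative uxx(.,t) for a.e. t;
  u_t and u_xxt are the weak time derivatives of u and u_xx with zero initial values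
  (u(t) = int_0^t u_t, u_xx(t) = int_0^t u_xxt);
  the variational identity with <rho_A u_tt, v> = d/dt (rho_A u_t, v) and u_t(0) = 0, in integrated form.\<close>
definition weak_solution ::
  "real \<Rightarrow> real \<Rightarrow> real \<Rightarrow> real \<Rightarrow> (real \<Rightarrow> real) \<Rightarrow> (real \<Rightarrow> real) \<Rightarrow> (real \<Rightarrow> real) \<Rightarrow> (real \<Rightarrow> real)
   \<Rightarrow> (real \<Rightarrow> real) \<Rightarrow> (real \<Rightarrow> real \<Rightarrow> real) \<Rightarrow> (real \<Rightarrow> real \<Rightarrow> real) \<Rightarrow> (real \<Rightarrow> real \<Rightarrow> real)
   \<Rightarrow> (real \<Rightarrow> real \<Rightarrow> real) \<Rightarrow> bool" where
  "weak_solution l T h \<theta> \<rho>A \<mu> r \<kappa> g u ut uxx uxxt \<longleftrightarrow>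
     L2_on ({0..l} \<times> {0..T}) (\<lambda>(x,t). u x t) \<and>
     L2_on ({0..l} \<times> {0..T}) (\<lambda>(x,t). uxx x t) \<and>
     L2_on ({0..l} \<times> {0..T}) (\<lambda>(x,t). ut x t) \<and>
     L2_on ({0..l} \<times> {0..T}) (\<lambda>(x,t). uxxt x t) \<and>
     (AE t in lborel. t \<in> {0..T} \<longrightarrow> inV l (\<lambda>x. u x t) (\<lambda>x. uxx x t)) \<and>
     (AE p in lborel. p \<in> {0..l} \<times> {0..T} \<longrightarrow>
        u (fst p) (snd p) = set_lebesgue_integral lborel {0..snd p} (\<lambda>s. ut (fst p) s)) \<and>
     (AE p in lborel. p \<in> {0..l} \<times> {0..T} \<longrightarrow>
        uxx (fst p) (snd p) = set_lebesgue_integral lborel {0..snd p} (\<lambda>s. uxxt (fst p) s)) \<and>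
     (\<forall>v v2. inV l v v2 \<longrightarrow>
        (AE t in lborel. t \<in> {0..T} \<longrightarrow>
           L2ip l (\<lambda>x. \<rho>A x * ut x t) v =
           set_lebesgue_integral lborel {0..t} (\<lambda>s.
              c_theta h \<theta> * g s * dV_end l v2 + g s * v l
              - L2ip l (\<lambda>x. \<mu> x * ut x s) v
              - L2ip l (\<lambda>x. r x * uxx x s + \<kappa> x * uxxt x s) v2)))"

end

theory Submission
  imports Defs
begin

text \<open>
  Since \<open>u\<^sub>t\<close> is not an admissible test function in the integrated weak form, the energy identity is
  obtained indirectly. Testing with \<open>v'' = 1\<^bsub>[0,q]\<^esub>\<close> for rational \<open>q\<close> turns the weak form into a pointwise equation
  \<open>p(x,t) = \<integral>\<^sub>0\<^sup>t Q(x,s) ds\<close>, where \<open>p\<close> is the twice integrated momentum \<open>\<rho>\<^sub>A u\<^sub>t\<close>, so that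
  \<open>(p(t), u\<^sub>x\<^sub>x\<^sub>t(s)) = (\<rho>\<^sub>A u\<^sub>t(t), u\<^sub>t(s))\<close> is symmetric in \<open>s, t\<close>. With \<open>E = (\<rho>\<^sub>A u\<^sub>t, u\<^sub>t)\<close> this gives
  \<open>E(t) - E(t-\<delta>) = (p(t) - p(t-\<delta>), u\<^sub>x\<^sub>x\<^sub>t(t) + u\<^sub>x\<^sub>x\<^sub>t(t-\<delta>))\<close>; divided by \<open>\<delta>\<close> and integrated in time, the right-hand side
  tends to \<open>\<Phi>(\<tau>) = 2 \<integral>\<^sub>0\<^sup>\<tau> (Q, u\<^sub>x\<^sub>x\<^sub>t) dt\<close> by continuity of translations in \<open>L\<^sup>2\<close>.
  As \<open>E \<ge> 0\<close>, it follows that \<open>\<Phi> \<ge> 0\<close>. Integrating the load term of \<open>\<Phi>\<close> by parts in time and applying Young's inequality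
  yields \<open>y(\<tau>) \<le> A + \<integral>\<^sub>0\<^sup>\<tau> y\<close> for \<open>y = \<parallel>u\<^sub>x\<^sub>x\<parallel>\<^sup>2\<close>, and Gronwall's lemma finishes the proof.
\<close>

text \<open>The weak form holds for each time-independent \<open>v\<close> outside a null set of
  times that depends on \<open>v\<close>; hence the countable family of tests, and the comparison of
  \<open>E\<close> at two times in place of a derivative. The increment identity for
  \<open>E\<close> holds at almost every time only, so increments are integrated: with
  \<open>J\<close> the primitive of \<open>E\<close>, the limit says formally J' = E = \<Phi>.
  Non-negativity of \<Phi> yields the bounds on \<open>uxx\<close> and \<open>uxxt\<close>; an upper
  bound for \<Phi>, summed over a partition, yields the one on \<open>ut\<close>. The coefficients
  depend on x only, so the integration by parts in time is done at fixed x. The load enters as c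
  v'(l) + v(l) = \<integral> (c + l - x) v''(x) dx with c = \<open>c_theta h \<theta>\<close>. The
  square of this weight gives the factors 1 + c^2 and l + l^3/3, the two terms of the integration by
  parts give 1 + T, and Young's inequality scaled to r0 gives 4 / r0^2 and the rate 1 in Gronwall's
  lemma, hence e^T.\<close>

section \<open>Square integrable functions and the Cauchy-Schwarz inequality\<close>

lemma integrable_mult_of_squares:
  fixes f g :: "'a \<Rightarrow> real"
  assumes [measurable]: "f \<in> borel_measurable M" "g \<in> borel_measurable M"
    and "integrable M (\<lambda>x. (f x)\<^sup>2)" "integrable M (\<lambda>x. (g x)\<^sup>2)"
  shows "integrable M (\<lambda>x. f x * g x)"
proof (rule Bochner_Integration.integrable_bound)
  show "integrable M (\<lambda>x. (f x)\<^sup>2 + (g x)\<^sup>2)" using assms by simp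
  have "\<bar>f x * g x\<bar> \<le> (f x)\<^sup>2 + (g x)\<^sup>2" for x
  proof -
    have "0 \<le> (\<bar>f x\<bar> - \<bar>g x\<bar>)\<^sup>2 + \<bar>f x\<bar>\<^sup>2 + \<bar>g x\<bar>\<^sup>2" by simp
    then show ?thesis by (simp add: power2_diff abs_mult)
  qed
  then show "AE x in M. norm (f x * g x) \<le> norm ((f x)\<^sup>2 + (g x)\<^sup>2)" by auto
qed simp

lemma integrable_add_square:
  fixes f g :: "'a \<Rightarrow> real"
  assumes [measurable]: "f \<in> borel_measurable M" "g \<in> borel_measurable M"
    and "integrable M (\<lambda>x. (f x)\<^sup>2)" "integrable M (\<lambda>x. (g x)\<^sup>2)"
  shows "integrable M (\<lambda>x. (f x + g x)\<^sup>2)"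
  unfolding power2_sum
  using integrable_mult_of_squares[OF assms] assms by (auto simp: mult.assoc)

lemma integrable_diff_square:
  fixes f g :: "'a \<Rightarrow> real"
  assumes [measurable]: "f \<in> borel_measurable M" "g \<in> borel_measurable M"
    and "integrable M (\<lambda>x. (f x)\<^sup>2)" "integrable M (\<lambda>x. (g x)\<^sup>2)"
  shows "integrable M (\<lambda>x. (f x - g x)\<^sup>2)"
  using integrable_add_square[of f M "\<lambda>x. - g x"] assms by simp

lemma integrable_of_abs_bound:
  fixes f g :: "'a \<Rightarrow> real"
  assumes "f \<in> borel_measurable M" "integrable M g" "\<And>x. \<bar>f x\<bar> \<le> g x"
  shows "integrable M f"
  by (rule Bochner_Integration.integrable_bound[OF assms(2) assms(1)])
     (use assms(3) in \<open>auto intro: order.trans[OF _ abs_ge_self]\<close>)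

text \<open>The absolute value stays inside the integral so that the bound survives multiplication
  by a bounded weight, as needed for correlations of translates.\<close>

lemma Cauchy_Schwarz_integral_abs:
  fixes f g :: "'a \<Rightarrow> real"
  assumes [measurable]: "f \<in> borel_measurable M" "g \<in> borel_measurable M"
    and f: "integrable M (\<lambda>x. (f x)\<^sup>2)" and g: "integrable M (\<lambda>x. (g x)\<^sup>2)"
  shows "(\<integral>x. \<bar>f x * g x\<bar> \<partial>M) \<le> sqrt (\<integral>x. (f x)\<^sup>2 \<partial>M) * sqrt (\<integral>x. (g x)\<^sup>2 \<partial>M)"
proof -
  let ?I = "\<integral>x. \<bar>f x * g x\<bar> \<partial>M"
  have fg: "integrable M (\<lambda>x. \<bar>f x * g x\<bar>)"
    using integrable_mult_of_squares[OF assms] by simp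
  have eq: "ennreal ?I = (\<integral>\<^sup>+x. ennreal \<bar>f x\<bar> * ennreal \<bar>g x\<bar> \<partial>M)"
    by (subst nn_integral_eq_integral[symmetric, OF fg]) (auto simp: abs_mult ennreal_mult)
  have "ennreal (?I\<^sup>2) = (\<integral>\<^sup>+x. ennreal \<bar>f x\<bar> * ennreal \<bar>g x\<bar> \<partial>M)\<^sup>2"
    unfolding eq[symmetric] by (simp add: ennreal_power)
  also have "\<dots> \<le> (\<integral>\<^sup>+x. (ennreal \<bar>f x\<bar>)\<^sup>2 \<partial>M) * (\<integral>\<^sup>+x. (ennreal \<bar>g x\<bar>)\<^sup>2 \<partial>M)"
    by (rule Cauchy_Schwarz_nn_integral) auto
  also have "(\<integral>\<^sup>+x. (ennreal \<bar>f x\<bar>)\<^sup>2 \<partial>M) = ennreal (\<integral>x. (f x)\<^sup>2 \<partial>M)"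
    by (subst nn_integral_eq_integral[symmetric, OF f]) (auto simp: ennreal_power)
  also have "(\<integral>\<^sup>+x. (ennreal \<bar>g x\<bar>)\<^sup>2 \<partial>M) = ennreal (\<integral>x. (g x)\<^sup>2 \<partial>M)"
    by (subst nn_integral_eq_integral[symmetric, OF g]) (auto simp: ennreal_power)
  finally have "?I\<^sup>2 \<le> (\<integral>x. (f x)\<^sup>2 \<partial>M) * (\<integral>x. (g x)\<^sup>2 \<partial>M)"
    by (simp flip: ennreal_mult)
  then show ?thesis
    using real_le_rsqrt by (simp flip: real_sqrt_mult)
qed

lemma Cauchy_Schwarz_integral:
  fixes f g :: "'a \<Rightarrow> real"
  assumes "f \<in> borel_measurable M" "g \<in> borel_measurable M"
    and "integrable M (\<lambda>x. (f x)\<^sup>2)" "integrable M (\<lambda>x. (g x)\<^sup>2)"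
  shows "(\<integral>x. f x * g x \<partial>M)\<^sup>2 \<le> (\<integral>x. (f x)\<^sup>2 \<partial>M) * (\<integral>x. (g x)\<^sup>2 \<partial>M)"
proof -
  have "\<bar>\<integral>x. f x * g x \<partial>M\<bar> \<le> (\<integral>x. \<bar>f x * g x\<bar> \<partial>M)"
    by (rule integral_abs_bound)
  also note Cauchy_Schwarz_integral_abs[OF assms]
  finally have "\<bar>\<integral>x. f x * g x \<partial>M\<bar>\<^sup>2 \<le> (sqrt (\<integral>x. (f x)\<^sup>2 \<partial>M) * sqrt (\<integral>x. (g x)\<^sup>2 \<partial>M))\<^sup>2"
    by (intro power_mono) auto
  then show ?thesis by (simp add: power_mult_distrib)
qed

section \<open>Continuity of translations\<close>

lemma integrable_lborel_translation:
  fixes f :: "'a::euclidean_space \<Rightarrow> real"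
  assumes "integrable lborel f"
  shows "integrable lborel (\<lambda>x. f (x + a))"
proof -
  have "integrable (distr lborel borel ((+) a)) f" using assms by (simp add: lborel_distr_plus)
  then show ?thesis by (subst (asm) integrable_distr_eq) (use assms in \<open>auto simp: add.commute\<close>)
qed

lemma integral_lborel_translation:
  fixes f :: "'a::euclidean_space \<Rightarrow> real"
  assumes "f \<in> borel_measurable borel"
  shows "(\<integral>x. f (x + a) \<partial>lborel) = (\<integral>x. f x \<partial>lborel)"
proof -
  have "(\<integral>x. f x \<partial>lborel) = (\<integral>x. f x \<partial>distr lborel borel ((+) a))" by (simp add: lborel_distr_plus)
  also have "\<dots> = (\<integral>x. f (x + a) \<partial>lborel)"
    by (subst integral_distr) (use assms in \<open>auto simp: add.commute\<close>)
  finally show ?thesis by simp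
qed

text \<open>Only one direction has to converge: the signed difference of \<open>indicator U\<close>
  and its translate has integral zero, so the L1 distance is twice the integral of the positive part
  of u(x) - u(x + a). For open U this part vanishes eventually at each x, and twice
  \<open>indicator U\<close> dominates it for all shifts.\<close>

lemma translation_L1_open:
  fixes U :: "'a::euclidean_space set" and X :: "nat \<Rightarrow> 'a"
  assumes U: "open U" "emeasure lborel U < \<infinity>" and X: "X \<longlonglongrightarrow> 0"
  shows "(\<lambda>n. \<integral>x. \<bar>indicator U (x + X n) - indicator U x\<bar> \<partial>lborel) \<longlonglongrightarrow> (0::real)"
proof -
  let ?u = "indicator U :: 'a \<Rightarrow> real"
  have [measurable]: "U \<in> sets borel" using U by auto
  have iu: "integrable lborel ?u" using U by (simp add: integrable_indicator_iff)
  have iut: "integrable lborel (\<lambda>x. ?u (x + a))" for a by (rule integrable_lborel_translation[OF iu])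
  have eq: "(\<integral>x. \<bar>?u (x + a) - ?u x\<bar> \<partial>lborel) = (\<integral>x. 2 * max 0 (?u x - ?u (x + a)) \<partial>lborel)" for a
  proof -
    have "(\<integral>x. \<bar>?u (x + a) - ?u x\<bar> \<partial>lborel)
        = (\<integral>x. (?u (x + a) - ?u x) + 2 * max 0 (?u x - ?u (x + a)) \<partial>lborel)"
      by (rule Bochner_Integration.integral_cong) (auto simp: max_def indicator_def)
    also have "\<dots> = (\<integral>x. (?u (x + a) - ?u x) \<partial>lborel) + (\<integral>x. 2 * max 0 (?u x - ?u (x + a)) \<partial>lborel)"
      by (rule Bochner_Integration.integral_add) (use iu iut in auto)
    also have "(\<integral>x. (?u (x + a) - ?u x) \<partial>lborel) = 0"
      using integral_lborel_translation[of ?u a] iu iut by simp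
    finally show ?thesis by simp
  qed
  have "(\<lambda>n. \<integral>x. 2 * max 0 (?u x - ?u (x + X n)) \<partial>lborel) \<longlonglongrightarrow> (\<integral>x. 0 \<partial>(lborel :: 'a measure))"
  proof (rule integral_dominated_convergence[where w="\<lambda>x. 2 * ?u x"])
    show "integrable lborel (\<lambda>x. 2 * ?u x)" using iu by simp
    show "AE x in lborel. (\<lambda>n. 2 * max 0 (?u x - ?u (x + X n))) \<longlonglongrightarrow> 0"
    proof (rule AE_I2)
      fix x
      show "(\<lambda>n. 2 * max 0 (?u x - ?u (x + X n))) \<longlonglongrightarrow> 0"
      proof (cases "x \<in> U")
        case True
        have "(\<lambda>n. x + X n) \<longlonglongrightarrow> x + 0" by (intro tendsto_intros X)
        then have "eventually (\<lambda>n. x + X n \<in> U) sequentially"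
          using U True by (simp add: topological_tendstoD)
        then have "eventually (\<lambda>n. 2 * max 0 (?u x - ?u (x + X n)) = 0) sequentially"
          by eventually_elim auto
        then show ?thesis by (rule tendsto_eventually)
      next
        case False
        then have "max 0 (?u x - ?u (x + X n)) = 0" for n by (simp add: indicator_def)
        then show ?thesis by simp
      qed
    qed
  qed (auto simp: indicator_def)
  then show ?thesis unfolding eq by simp
qed

text \<open>The error between f and h is unchanged by a common translation, so it is paid twice, e/4
  each time, next to e/2 for the translation of h.\<close>

lemma translation_L1_approx:
  fixes f :: "'a::euclidean_space \<Rightarrow> real" and X :: "nat \<Rightarrow> 'a"
  assumes f: "integrable lborel f"
    and approx: "\<And>e. e > 0 \<Longrightarrow> \<exists>h. integrable lborel h \<and> (\<integral>x. \<bar>f x - h x\<bar> \<partial>lborel) \<le> e \<and>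
                    (\<lambda>n. \<integral>x. \<bar>h (x + X n) - h x\<bar> \<partial>lborel) \<longlonglongrightarrow> 0"
  shows "(\<lambda>n. \<integral>x. \<bar>f (x + X n) - f x\<bar> \<partial>lborel) \<longlonglongrightarrow> 0"
proof (rule LIMSEQ_I)
  fix e :: real assume "e > 0"
  then obtain h where h: "integrable lborel h" "(\<integral>x. \<bar>f x - h x\<bar> \<partial>lborel) \<le> e / 4"
    and lim: "(\<lambda>n. \<integral>x. \<bar>h (x + X n) - h x\<bar> \<partial>lborel) \<longlonglongrightarrow> 0"
    using approx[of "e / 4"] by auto
  obtain N where N: "\<And>n. n \<ge> N \<Longrightarrow> norm ((\<integral>x. \<bar>h (x + X n) - h x\<bar> \<partial>lborel) - 0) < e / 2"
    using LIMSEQ_D[OF lim, of "e / 2"] \<open>e > 0\<close> by auto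
  have "norm ((\<integral>x. \<bar>f (x + X n) - f x\<bar> \<partial>lborel) - 0) < e" if "n \<ge> N" for n
  proof -
    note i = f h(1) integrable_lborel_translation[OF f, of "X n"]
      integrable_lborel_translation[OF h(1), of "X n"]
    have "(\<integral>x. \<bar>f (x + X n) - f x\<bar> \<partial>lborel) \<le> (\<integral>x. \<bar>f (x + X n) - h (x + X n)\<bar>
         + \<bar>h (x + X n) - h x\<bar> + \<bar>f x - h x\<bar> \<partial>lborel)"
      by (rule integral_mono) (use i in auto)
    also have "\<dots> = (\<integral>x. \<bar>f (x + X n) - h (x + X n)\<bar> \<partial>lborel)
         + (\<integral>x. \<bar>h (x + X n) - h x\<bar> \<partial>lborel) + (\<integral>x. \<bar>f x - h x\<bar> \<partial>lborel)"
      using i by simp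
    also have "(\<integral>x. \<bar>f (x + X n) - h (x + X n)\<bar> \<partial>lborel) = (\<integral>x. \<bar>f x - h x\<bar> \<partial>lborel)"
      by (rule integral_lborel_translation) (use f h in auto)
    finally show ?thesis using N[OF that] h(2) by simp
  qed
  then show "\<exists>N. \<forall>n\<ge>N. norm ((\<integral>x. \<bar>f (x + X n) - f x\<bar> \<partial>lborel) - 0) < e" by blast
qed

text \<open>Outer regularity supplies an open U around A with U - A of measure below e; its
  indicator serves as the approximant.\<close>

lemma translation_L1_indicator:
  fixes A :: "'a::euclidean_space set" and X :: "nat \<Rightarrow> 'a"
  assumes A: "A \<in> sets lborel" "emeasure lborel A < \<infinity>" and X: "X \<longlonglongrightarrow> 0"
  shows "(\<lambda>n. \<integral>x. \<bar>indicator A (x + X n) - indicator A x\<bar> \<partial>lborel) \<longlonglongrightarrow> (0::real)"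
proof (rule translation_L1_approx)
  show "integrable lborel (indicator A :: 'a \<Rightarrow> real)" using A by (simp add: integrable_indicator_iff)
  fix e :: real assume "e > 0"
  have "A \<in> sets lebesgue" using A by auto
  from sets_lebesgue_outer_open[OF this \<open>e > 0\<close>] obtain U where
    U: "open U" "A \<subseteq> U" "U - A \<in> lmeasurable" "emeasure lebesgue (U - A) < ennreal e"
    by metis
  have [measurable]: "U \<in> sets borel" "A \<in> sets borel" using U A by auto
  have d: "emeasure lborel (U - A) < ennreal e" using U(4) by simp
  have fin: "emeasure lborel U < \<infinity>"
  proof -
    have "emeasure lborel U \<le> emeasure lborel A + emeasure lborel (U - A)"
      by (metis A(1) U(2) Diff_partition \<open>U \<in> sets borel\<close> emeasure_subadditive sets.Diff sets_lborel)
    also have "\<dots> < \<infinity>" using A(2) d by (auto simp: ennreal_add_eq_top less_top intro: order.strict_trans)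
    finally show ?thesis .
  qed
  have "(\<integral>x. \<bar>indicator A x - indicator U x :: real\<bar> \<partial>lborel) = (\<integral>x. indicator (U - A) x \<partial>lborel)"
    by (rule Bochner_Integration.integral_cong) (use U in \<open>auto simp: indicator_def\<close>)
  also have "\<dots> \<le> e"
    using d \<open>e > 0\<close> by (simp add: measure_def enn2real_leI)
  finally show "\<exists>h. integrable lborel h \<and> (\<integral>x. \<bar>indicator A x - h x\<bar> \<partial>lborel) \<le> e \<and>
                    (\<lambda>n. \<integral>x. \<bar>h (x + X n) - h x\<bar> \<partial>lborel) \<longlonglongrightarrow> (0::real)"
    using translation_L1_open[OF U(1) fin X] fin
    by (intro exI[of _ "indicator U"]) (simp add: integrable_indicator_iff)
qed

lemma translation_L1:
  fixes f :: "'a::euclidean_space \<Rightarrow> real" and X :: "nat \<Rightarrow> 'a"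
  assumes "integrable lborel f" and X: "X \<longlonglongrightarrow> 0"
  shows "(\<lambda>n. \<integral>x. \<bar>f (x + X n) - f x\<bar> \<partial>lborel) \<longlonglongrightarrow> 0"
  using assms(1)
proof (induct rule: integrable_induct)
  case (base A c)
  have "(\<lambda>n. \<bar>c\<bar> * (\<integral>x. \<bar>indicator A (x + X n) - indicator A x\<bar> \<partial>lborel)) \<longlonglongrightarrow> \<bar>c\<bar> * 0"
    by (intro tendsto_mult tendsto_const translation_L1_indicator X base)
  moreover have "\<bar>indicator A (x + a) *\<^sub>R c - indicator A x *\<^sub>R c\<bar>
     = \<bar>c\<bar> * \<bar>indicator A (x + a) - indicator A x\<bar>" for x a
    by (auto simp: indicator_def)
  ultimately show ?case by simp
next
  case (add f g)
  note lim = tendsto_add[OF add(2) add(4)]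
  show ?case
  proof (rule tendsto_sandwich[OF _ _ tendsto_const lim[simplified]])
    show "\<forall>\<^sub>F n in sequentially. (\<integral>x. \<bar>f (x + X n) + g (x + X n) - (f x + g x)\<bar> \<partial>lborel)
        \<le> (\<integral>x. \<bar>f (x + X n) - f x\<bar> \<partial>lborel) + (\<integral>x. \<bar>g (x + X n) - g x\<bar> \<partial>lborel)"
    proof (rule always_eventually, rule allI)
      fix n
      note i = add(1,3) integrable_lborel_translation[OF add(1), of "X n"]
        integrable_lborel_translation[OF add(3), of "X n"]
      have "(\<integral>x. \<bar>f (x + X n) + g (x + X n) - (f x + g x)\<bar> \<partial>lborel)
         \<le> (\<integral>x. \<bar>f (x + X n) - f x\<bar> + \<bar>g (x + X n) - g x\<bar> \<partial>lborel)"
        by (rule integral_mono) (use i in auto)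
      then show "(\<integral>x. \<bar>f (x + X n) + g (x + X n) - (f x + g x)\<bar> \<partial>lborel)
        \<le> (\<integral>x. \<bar>f (x + X n) - f x\<bar> \<partial>lborel) + (\<integral>x. \<bar>g (x + X n) - g x\<bar> \<partial>lborel)"
        using i by simp
    qed
  qed auto
next
  case (lim f s)
  show ?case
  proof (rule translation_L1_approx[OF lim(5)])
    fix e :: real assume "e > 0"
    have "(\<lambda>i. \<integral>x. \<bar>f x - s i x\<bar> \<partial>lborel) \<longlonglongrightarrow> (\<integral>x. 0 \<partial>(lborel :: 'a measure))"
    \<comment> \<open>The approximants satisfy |s i x| \<le> 2 |f x|, hence the factor 3.\<close>
    proof (rule integral_dominated_convergence[where w="\<lambda>x. 3 * \<bar>f x\<bar>"])
      show "AE x in lborel. (\<lambda>i. \<bar>f x - s i x\<bar>) \<longlonglongrightarrow> 0"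
      proof (rule AE_I2)
        fix x
        have "(\<lambda>i. \<bar>f x - s i x\<bar>) \<longlonglongrightarrow> \<bar>f x - f x\<bar>" by (intro tendsto_intros lim(3)) simp
        then show "(\<lambda>i. \<bar>f x - s i x\<bar>) \<longlonglongrightarrow> 0" by simp
      qed
      show "AE x in lborel. norm \<bar>f x - s i x\<bar> \<le> 3 * \<bar>f x\<bar>" for i
        using lim(4)[of _ i] by (intro AE_I2) (smt (verit) real_norm_def space_lborel UNIV_I space_borel)
    qed (use lim in auto)
    from LIMSEQ_D[OF this \<open>e > 0\<close>] obtain i
      where "norm ((\<integral>x. \<bar>f x - s i x\<bar> \<partial>lborel) - (\<integral>x. 0 \<partial>(lborel :: 'a measure))) < e" by auto
    then show "\<exists>h. integrable lborel h \<and> (\<integral>x. \<bar>f x - h x\<bar> \<partial>lborel) \<le> e \<and>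
                    (\<lambda>n. \<integral>x. \<bar>h (x + X n) - h x\<bar> \<partial>lborel) \<longlonglongrightarrow> 0"
      using lim(1,2) by (intro exI[of _ "s i"]) auto
  qed
qed

text \<open>Reduction to L1 by truncation: for a bounded function the squared difference is at most
  a constant times the absolute difference.\<close>

lemma translation_L2:
  fixes f :: "'a::euclidean_space \<Rightarrow> real" and X :: "nat \<Rightarrow> 'a"
  assumes [measurable]: "f \<in> borel_measurable borel" and f: "integrable lborel (\<lambda>x. (f x)\<^sup>2)"
    and X: "X \<longlonglongrightarrow> 0"
  shows "(\<lambda>n. \<integral>x. (f (x + X n) - f x)\<^sup>2 \<partial>lborel) \<longlonglongrightarrow> 0"
proof (rule LIMSEQ_I)
  fix e :: real assume "e > 0"
  \<comment> \<open>The lower cutoff gives |h| \<le> (k + 1) f^2, which makes the truncation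
    integrable; the upper one bounds it by k + 1.\<close>
  define h where "h k x = (if 1 / real (Suc k) \<le> \<bar>f x\<bar> \<and> \<bar>f x\<bar> \<le> real (Suc k) then f x else 0)" for k x
  have [measurable]: "h k \<in> borel_measurable borel" for k unfolding h_def by measurable
  have "(\<lambda>k. \<integral>x. (f x - h k x)\<^sup>2 \<partial>lborel) \<longlonglongrightarrow> (\<integral>x. 0 \<partial>(lborel :: 'a measure))"
  proof (rule integral_dominated_convergence[OF _ _ f])
    show "AE x in lborel. (\<lambda>k. (f x - h k x)\<^sup>2) \<longlonglongrightarrow> 0"
    proof (rule AE_I2)
      fix x
      show "(\<lambda>k. (f x - h k x)\<^sup>2) \<longlonglongrightarrow> 0"
      proof (cases "f x = 0")
        case True
        then show ?thesis by (simp add: h_def)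
      next
        case False
        obtain k1 where k1: "1 / \<bar>f x\<bar> < real k1" using reals_Archimedean2 by blast
        obtain k2 where k2: "\<bar>f x\<bar> < real k2" using reals_Archimedean2 by blast
        have "eventually (\<lambda>k. (f x - h k x)\<^sup>2 = 0) sequentially"
          using eventually_ge_at_top[of k1] eventually_ge_at_top[of k2]
        proof eventually_elim
          case (elim k)
          have "1 / \<bar>f x\<bar> \<le> real (Suc k)" using k1 elim(1) by linarith
          then have "1 / real (Suc k) \<le> \<bar>f x\<bar>" using False by (simp add: field_simps)
          moreover have "\<bar>f x\<bar> \<le> real (Suc k)" using k2 elim(2) by linarith
          ultimately show ?case by (simp add: h_def)
        qed
        then show ?thesis by (rule tendsto_eventually)
      qed
    qed
  qed (auto simp: h_def)
  \<comment> \<open>The truncation error is paid with weight 3 at x + X n and again with weight 3 at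
    x, which makes e/2; the other e/2 is left for the translation of the truncated function.\<close>
  from LIMSEQ_D[OF this, of "e / 12"] \<open>e > 0\<close> obtain k
    where "norm ((\<integral>x. (f x - h k x)\<^sup>2 \<partial>lborel) - (\<integral>x. 0 \<partial>(lborel :: 'a measure))) < e / 12"
    by auto
  then have k: "(\<integral>x. (f x - h k x)\<^sup>2 \<partial>lborel) < e / 12" by simp
  define H where "H = h k"
  have [measurable]: "H \<in> borel_measurable borel" by (simp add: H_def)
  have Hb: "\<bar>H x\<bar> \<le> real (Suc k)" for x by (auto simp: H_def h_def)
  have HB: "\<bar>H x\<bar> \<le> real (Suc k) * (f x)\<^sup>2" for x
  proof (cases "1 / real (Suc k) \<le> \<bar>f x\<bar>")
    case True
    then have "1 \<le> real (Suc k) * \<bar>f x\<bar>" by (simp add: field_simps)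
    then have "\<bar>f x\<bar> * 1 \<le> \<bar>f x\<bar> * (real (Suc k) * \<bar>f x\<bar>)" by (rule mult_left_mono) simp
    then have "\<bar>f x\<bar> \<le> real (Suc k) * (f x)\<^sup>2" by (simp add: power2_eq_square mult_ac del: of_nat_Suc)
    then show ?thesis unfolding H_def h_def by (simp del: of_nat_Suc)
  qed (simp add: H_def h_def)
  have H: "integrable lborel H"
    by (rule integrable_of_abs_bound[OF _ _ HB]) (use f in simp_all)
  have H2: "integrable lborel (\<lambda>x. (H x)\<^sup>2)"
    by (rule Bochner_Integration.integrable_bound[OF f]) (auto simp: H_def h_def)
  have d: "integrable lborel (\<lambda>x. (f x - H x)\<^sup>2)"
    by (rule integrable_diff_square) (use f H2 in auto)
  have dt: "integrable lborel (\<lambda>x. (f (x + a) - H (x + a))\<^sup>2)" for a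
    using integrable_lborel_translation[OF d] .
  have "e / (12 * real (Suc k)) > 0" using \<open>e > 0\<close> by simp
  from LIMSEQ_D[OF translation_L1[OF H X] this] obtain N where
    N: "\<And>n. n \<ge> N \<Longrightarrow> norm ((\<integral>x. \<bar>H (x + X n) - H x\<bar> \<partial>lborel) - 0) < e / (12 * real (Suc k))"
    by blast
  have "norm ((\<integral>x. (f (x + X n) - f x)\<^sup>2 \<partial>lborel) - 0) < e" if "n \<ge> N" for n
  proof -
    have iH: "integrable lborel (\<lambda>x. \<bar>H (x + X n) - H x\<bar>)"
      using H integrable_lborel_translation[OF H, of "X n"] by auto
    have pt: "(f (x + X n) - f x)\<^sup>2 \<le> 3 * (f (x + X n) - H (x + X n))\<^sup>2
        + 6 * real (Suc k) * \<bar>H (x + X n) - H x\<bar> + 3 * (f x - H x)\<^sup>2" for x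
    proof -
      have sq: "(a + b - c)\<^sup>2 \<le> 3 * a\<^sup>2 + 3 * b\<^sup>2 + 3 * c\<^sup>2" for a b c :: real
      proof -
        have "0 \<le> (a - b)\<^sup>2 + (a + c)\<^sup>2 + (b + c)\<^sup>2" by simp
        then show ?thesis by (simp add: power2_eq_square algebra_simps)
      qed
      have "\<bar>H (x + X n) - H x\<bar> \<le> 2 * real (Suc k)" 
        using abs_triangle_ineq4[of "H (x + X n)" "H x"] Hb[of x] Hb[of "x + X n"] by simp
      then have "\<bar>H (x + X n) - H x\<bar> * \<bar>H (x + X n) - H x\<bar> \<le> (2 * real (Suc k)) * \<bar>H (x + X n) - H x\<bar>"
        by (rule mult_right_mono) simp
      then have "(H (x + X n) - H x)\<^sup>2 \<le> 2 * real (Suc k) * \<bar>H (x + X n) - H x\<bar>"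
        by (simp add: power2_eq_square flip: abs_mult)
      then show ?thesis
        using sq[of "f (x + X n) - H (x + X n)" "H (x + X n) - H x" "f x - H x"]
        by (simp add: algebra_simps)
    qed
    have "(\<integral>x. (f (x + X n) - f x)\<^sup>2 \<partial>lborel) \<le> (\<integral>x. 3 * (f (x + X n) - H (x + X n))\<^sup>2
        + 6 * real (Suc k) * \<bar>H (x + X n) - H x\<bar> + 3 * (f x - H x)\<^sup>2 \<partial>lborel)"
    proof (rule integral_mono[OF _ _ pt])
      show "integrable lborel (\<lambda>x. (f (x + X n) - f x)\<^sup>2)"
        by (rule integrable_diff_square) (use f integrable_lborel_translation[OF f] in auto)
    qed (use d dt iH in auto)
    also have "\<dots> = 3 * (\<integral>x. (f (x + X n) - H (x + X n))\<^sup>2 \<partial>lborel)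
        + 6 * real (Suc k) * (\<integral>x. \<bar>H (x + X n) - H x\<bar> \<partial>lborel) + 3 * (\<integral>x. (f x - H x)\<^sup>2 \<partial>lborel)"
      using d dt iH by simp
    also have "(\<integral>x. (f (x + X n) - H (x + X n))\<^sup>2 \<partial>lborel) = (\<integral>x. (f x - H x)\<^sup>2 \<partial>lborel)"
      by (rule integral_lborel_translation) auto
    finally have "(\<integral>x. (f (x + X n) - f x)\<^sup>2 \<partial>lborel)
       \<le> 6 * (\<integral>x. (f x - H x)\<^sup>2 \<partial>lborel) + 6 * real (Suc k) * (\<integral>x. \<bar>H (x + X n) - H x\<bar> \<partial>lborel)"
      by simp
    moreover have "6 * real (Suc k) * (\<integral>x. \<bar>H (x + X n) - H x\<bar> \<partial>lborel) < e / 2"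
      using N[OF that] by (simp add: field_simps)
    ultimately show ?thesis using k by (simp add: H_def)
  qed
  then show "\<exists>N. \<forall>n\<ge>N. norm ((\<integral>x. (f (x + X n) - f x)\<^sup>2 \<partial>lborel) - 0) < e" by blast
qed

text \<open>A threshold valid for all small shifts at once is needed, because the shift later runs
  through [0, \<delta>]. The limit at 0 is silent about a = 0 itself, where the integral is
  zero.\<close>

lemma translation_L2_uniform:
  fixes f :: "'a::euclidean_space \<Rightarrow> real"
  assumes "f \<in> borel_measurable borel" "integrable lborel (\<lambda>x. (f x)\<^sup>2)" "e > 0"
  obtains d where "d > 0" "\<And>a. norm a < d \<Longrightarrow> (\<integral>x. (f (x + a) - f x)\<^sup>2 \<partial>lborel) < e"
proof -
  have "((\<lambda>a. \<integral>x. (f (x + a) - f x)\<^sup>2 \<partial>lborel) \<longlongrightarrow> 0) (at 0)"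
    unfolding tendsto_at_iff_sequentially comp_def using translation_L2[OF assms(1,2)] by blast
  then obtain d where "d > 0" "\<And>a. a \<noteq> 0 \<Longrightarrow> norm a < d \<Longrightarrow> \<bar>\<integral>x. (f (x + a) - f x)\<^sup>2 \<partial>lborel\<bar> < e"
    using assms(3) unfolding LIM_def by (auto simp: dist_norm)
  moreover have "(\<integral>x. (f (x + 0) - f x)\<^sup>2 \<partial>lborel) < e" using assms(3) by simp
  ultimately show ?thesis by (intro that[of d]) (metis abs_less_iff)+
qed

text \<open>The point is that \<open>d\<close> does not depend on the weight \<phi>: with \<phi> the
  indicator of the times up to \<tau>, the resulting estimate is uniform in \<tau>, as the summation
  over a partition requires. The difference of products splits into (F(x+a) - F(x)) H(x+b) + F(x)
  (H(x+b) - H(x)).\<close>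

lemma translation_correlation_uniform:
  fixes F H :: "'a::euclidean_space \<Rightarrow> real"
  assumes [measurable]: "F \<in> borel_measurable borel" "H \<in> borel_measurable borel"
    and F: "integrable lborel (\<lambda>x. (F x)\<^sup>2)" and H: "integrable lborel (\<lambda>x. (H x)\<^sup>2)" and e: "e > 0"
  obtains d where "d > 0"
    "\<And>a b \<phi>. norm a < d \<Longrightarrow> norm b < d \<Longrightarrow> \<phi> \<in> borel_measurable borel \<Longrightarrow> (\<And>x. \<bar>\<phi> x\<bar> \<le> 1) \<Longrightarrow>
       \<bar>(\<integral>x. \<phi> x * (F (x + a) * H (x + b)) \<partial>lborel) - (\<integral>x. \<phi> x * (F x * H x) \<partial>lborel)\<bar> \<le> e"
proof -
  define nF where "nF = sqrt (\<integral>x. (F x)\<^sup>2 \<partial>lborel)"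
  define nH where "nH = sqrt (\<integral>x. (H x)\<^sup>2 \<partial>lborel)"
  have nn: "nF \<ge> 0" "nH \<ge> 0" by (auto simp: nF_def nH_def)
  \<comment> \<open>The two error terms are at most \<eta> nH and nF \<eta>; the summand 1 covers
    the case that both norms vanish.\<close>
  define \<eta> where "\<eta> = e / (nF + nH + 1)"
  have \<eta>: "\<eta> > 0" using e nn by (auto simp: \<eta>_def)
  obtain d1 where d1: "d1 > 0" "\<And>a. norm a < d1 \<Longrightarrow> (\<integral>x. (F (x + a) - F x)\<^sup>2 \<partial>lborel) < \<eta>\<^sup>2"
    using translation_L2_uniform[of F "\<eta>\<^sup>2"] F \<eta> by auto
  obtain d2 where d2: "d2 > 0" "\<And>a. norm a < d2 \<Longrightarrow> (\<integral>x. (H (x + a) - H x)\<^sup>2 \<partial>lborel) < \<eta>\<^sup>2"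
    using translation_L2_uniform[of H "\<eta>\<^sup>2"] H \<eta> by auto
  show ?thesis
  proof (rule that[of "min d1 d2"])
    show "min d1 d2 > 0" using d1 d2 by auto
    fix a b :: 'a and \<phi> :: "'a \<Rightarrow> real"
    assume ab: "norm a < min d1 d2" "norm b < min d1 d2"
      and [measurable]: "\<phi> \<in> borel_measurable borel" and \<phi>: "\<And>x. \<bar>\<phi> x\<bar> \<le> 1"
    have Fa: "integrable lborel (\<lambda>x. (F (x + a))\<^sup>2)" by (rule integrable_lborel_translation[OF F])
    have Hb: "integrable lborel (\<lambda>x. (H (x + b))\<^sup>2)" by (rule integrable_lborel_translation[OF H])
    have dF: "integrable lborel (\<lambda>x. (F (x + a) - F x)\<^sup>2)"
      by (rule integrable_diff_square) (use F Fa in auto)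
    have dH: "integrable lborel (\<lambda>x. (H (x + b) - H x)\<^sup>2)"
      by (rule integrable_diff_square) (use H Hb in auto)
    have p1: "integrable lborel (\<lambda>x. \<bar>(F (x + a) - F x) * H (x + b)\<bar>)"
      by (intro integrable_abs integrable_mult_of_squares dF Hb) auto
    have p2: "integrable lborel (\<lambda>x. \<bar>F x * (H (x + b) - H x)\<bar>)"
      by (intro integrable_abs integrable_mult_of_squares dH F) auto
    have \<phi>m: "integrable lborel (\<lambda>x. \<phi> x * f x)" if "integrable lborel f" for f
      using that \<phi> by (intro Bochner_Integration.integrable_bound[OF that]) (auto simp: abs_mult mult_left_le_one_le)
    have q1: "integrable lborel (\<lambda>x. \<phi> x * (F (x + a) * H (x + b)))"
      by (intro \<phi>m integrable_mult_of_squares Fa Hb) auto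
    have q2: "integrable lborel (\<lambda>x. \<phi> x * (F x * H x))"
      by (intro \<phi>m integrable_mult_of_squares F H) auto
    have "\<bar>(\<integral>x. \<phi> x * (F (x + a) * H (x + b)) \<partial>lborel) - (\<integral>x. \<phi> x * (F x * H x) \<partial>lborel)\<bar>
        = \<bar>\<integral>x. \<phi> x * (F (x + a) * H (x + b)) - \<phi> x * (F x * H x) \<partial>lborel\<bar>"
      using q1 q2 by simp
    also have "\<dots> \<le> (\<integral>x. \<bar>\<phi> x * (F (x + a) * H (x + b)) - \<phi> x * (F x * H x)\<bar> \<partial>lborel)"
      by (rule integral_abs_bound)
    also have "\<dots> \<le> (\<integral>x. \<bar>(F (x + a) - F x) * H (x + b)\<bar> + \<bar>F x * (H (x + b) - H x)\<bar> \<partial>lborel)"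
    proof (rule integral_mono)
      show "integrable lborel (\<lambda>x. \<bar>\<phi> x * (F (x + a) * H (x + b)) - \<phi> x * (F x * H x)\<bar>)"
        using q1 q2 by auto
      fix x
      have "\<phi> x * (F (x + a) * H (x + b)) - \<phi> x * (F x * H x)
         = \<phi> x * ((F (x + a) - F x) * H (x + b) + F x * (H (x + b) - H x))"
        by (simp add: algebra_simps)
      also have "\<bar>\<dots>\<bar> \<le> \<bar>(F (x + a) - F x) * H (x + b) + F x * (H (x + b) - H x)\<bar>"
        unfolding abs_mult[of "\<phi> x"] by (rule mult_left_le_one_le) (use \<phi> in auto)
      finally show "\<bar>\<phi> x * (F (x + a) * H (x + b)) - \<phi> x * (F x * H x)\<bar>
         \<le> \<bar>(F (x + a) - F x) * H (x + b)\<bar> + \<bar>F x * (H (x + b) - H x)\<bar>" by linarith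
    qed (use p1 p2 in auto)
    also have "\<dots> = (\<integral>x. \<bar>(F (x + a) - F x) * H (x + b)\<bar> \<partial>lborel) + (\<integral>x. \<bar>F x * (H (x + b) - H x)\<bar> \<partial>lborel)"
      using p1 p2 by simp
    also have "(\<integral>x. \<bar>(F (x + a) - F x) * H (x + b)\<bar> \<partial>lborel) \<le> \<eta> * nH"
    proof -
      have "(\<integral>x. \<bar>(F (x + a) - F x) * H (x + b)\<bar> \<partial>lborel)
         \<le> sqrt (\<integral>x. (F (x + a) - F x)\<^sup>2 \<partial>lborel) * sqrt (\<integral>x. (H (x + b))\<^sup>2 \<partial>lborel)"
        by (rule Cauchy_Schwarz_integral_abs) (use dF Hb in auto)
      also have "(\<integral>x. (H (x + b))\<^sup>2 \<partial>lborel) = (\<integral>x. (H x)\<^sup>2 \<partial>lborel)"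
        by (rule integral_lborel_translation) auto
      also have "sqrt (\<integral>x. (F (x + a) - F x)\<^sup>2 \<partial>lborel) \<le> \<eta>"
        using d1(2)[of a] ab \<eta> by (intro real_le_lsqrt) auto
      finally show ?thesis using nn(2) by (simp add: nH_def mult_right_mono)
    qed
    also have "(\<integral>x. \<bar>F x * (H (x + b) - H x)\<bar> \<partial>lborel) \<le> nF * \<eta>"
    proof -
      have "(\<integral>x. \<bar>F x * (H (x + b) - H x)\<bar> \<partial>lborel)
         \<le> nF * sqrt (\<integral>x. (H (x + b) - H x)\<^sup>2 \<partial>lborel)"
        unfolding nF_def by (rule Cauchy_Schwarz_integral_abs) (use dH F in auto)
      also have "\<dots> \<le> nF * \<eta>"
        using d2(2)[of b] ab \<eta> nn by (intro mult_left_mono real_le_lsqrt) auto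
      finally show ?thesis .
    qed
    also have "\<eta> * nH + nF * \<eta> \<le> e"
    proof -
      have "\<eta> * nH + nF * \<eta> = e * ((nF + nH) / (nF + nH + 1))" by (simp add: \<eta>_def algebra_simps add_divide_distrib)
      also have "\<dots> \<le> e * 1" using e nn by (intro mult_left_mono) (auto simp: field_simps)
      finally show ?thesis by simp
    qed
    finally show "\<bar>(\<integral>x. \<phi> x * (F (x + a) * H (x + b)) \<partial>lborel) - (\<integral>x. \<phi> x * (F x * H x) \<partial>lborel)\<bar> \<le> e"
      by simp
  qed
qed

section \<open>Iterated integrals and primitives on the line\<close>

lemma integrable_indicator_Icc [simp]: "integrable lborel (indicator {a..b::real} :: real \<Rightarrow> real)"
  by (simp add: integrable_indicator_iff emeasure_lborel_Icc_eq)

lemma integrable_pair_mult: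
  fixes a b :: "real \<Rightarrow> real"
  assumes a: "integrable lborel a" and b: "integrable lborel b"
  shows "integrable (lborel \<Otimes>\<^sub>M lborel) (\<lambda>(x, y). a x * b y)"
proof (rule lborel_pair.Fubini_integrable)
  have [measurable]: "a \<in> borel_measurable borel" "b \<in> borel_measurable borel" using a b by auto
  show "(\<lambda>(x, y). a x * b y) \<in> borel_measurable (lborel \<Otimes>\<^sub>M lborel)" by measurable
  show "integrable lborel (\<lambda>x. \<integral>y. norm (case (x, y) of (x, y) \<Rightarrow> a x * b y) \<partial>lborel)"
    using a b by (simp add: abs_mult)
  show "AE x in lborel. integrable lborel (\<lambda>y. case (x, y) of (x, y) \<Rightarrow> a x * b y)"
    using b by simp
qed

lemma integrable_pair_kernel:
  fixes a b :: "real \<Rightarrow> real" and k :: "real \<Rightarrow> real \<Rightarrow> real"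
  assumes a: "integrable lborel a" and b: "integrable lborel b"
    and [measurable]: "case_prod k \<in> borel_measurable (borel \<Otimes>\<^sub>M borel)" and k: "\<And>x y. \<bar>k x y\<bar> \<le> C"
  shows "integrable (lborel \<Otimes>\<^sub>M lborel) (\<lambda>(x, y). a x * (k x y * b y))"
proof (rule Bochner_Integration.integrable_bound)
  have [measurable]: "a \<in> borel_measurable borel" "b \<in> borel_measurable borel" using a b by auto
  show "integrable (lborel \<Otimes>\<^sub>M lborel) (\<lambda>z. C * (case z of (x, y) \<Rightarrow> a x * b y))"
    using integrable_pair_mult[OF a b] by simp
  show "(\<lambda>(x, y). a x * (k x y * b y)) \<in> borel_measurable (lborel \<Otimes>\<^sub>M lborel)" by measurable
  have "norm (a x * (k x y * b y)) \<le> norm (C * (a x * b y))" for x y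
  proof -
    have "\<bar>a x * b y\<bar> * \<bar>k x y\<bar> \<le> \<bar>a x * b y\<bar> * \<bar>C\<bar>"
      using k[of x y] by (intro mult_left_mono) auto
    then show ?thesis by (simp add: abs_mult mult_ac)
  qed
  then show "AE z in lborel \<Otimes>\<^sub>M lborel. norm (case z of (x, y) \<Rightarrow> a x * (k x y * b y))
      \<le> norm (C * (case z of (x, y) \<Rightarrow> a x * b y))" by (intro AE_I2) auto
qed

text \<open>Fubini's theorem read as a statement about transposed kernels; it is the source of the
  symmetry of the energy pairing.\<close>

lemma integral_kernel_adjoint:
  fixes a b :: "real \<Rightarrow> real" and k :: "real \<Rightarrow> real \<Rightarrow> real"
  assumes "integrable lborel a" "integrable lborel b"
    "case_prod k \<in> borel_measurable (borel \<Otimes>\<^sub>M borel)" "\<And>x y. \<bar>k x y\<bar> \<le> C"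
  shows "(\<integral>x. a x * (\<integral>y. k x y * b y \<partial>lborel) \<partial>lborel) = (\<integral>y. (\<integral>x. k x y * a x \<partial>lborel) * b y \<partial>lborel)"
proof -
  have "(\<integral>x. a x * (\<integral>y. k x y * b y \<partial>lborel) \<partial>lborel) = (\<integral>x. (\<integral>y. a x * (k x y * b y) \<partial>lborel) \<partial>lborel)"
    by simp
  also have "\<dots> = (\<integral>y. (\<integral>x. a x * (k x y * b y) \<partial>lborel) \<partial>lborel)"
    by (rule lborel_pair.Fubini_integral[symmetric, OF integrable_pair_kernel[OF assms]])
  also have "\<dots> = (\<integral>y. (\<integral>x. (k x y * a x) * b y \<partial>lborel) \<partial>lborel)"
    by (simp add: mult_ac)
  finally show ?thesis by simp
qed

lemma integrable_indicator_times:
  fixes f :: "real \<Rightarrow> real"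
  assumes "integrable lborel f" "A \<in> sets borel"
  shows "integrable lborel (\<lambda>x. indicator A x * f x)"
  using integrable_real_mult_indicator[of A lborel f] assms by (simp add: mult.commute)

lemma abs_integral_indicator_le:
  fixes f :: "real \<Rightarrow> real"
  assumes "integrable lborel f" "A \<in> sets borel"
  shows "\<bar>\<integral>x. indicator A x * f x \<partial>lborel\<bar> \<le> (\<integral>x. \<bar>f x\<bar> \<partial>lborel)"
proof -
  have "\<bar>\<integral>x. indicator A x * f x \<partial>lborel\<bar> \<le> (\<integral>x. \<bar>indicator A x * f x\<bar> \<partial>lborel)"
    by (rule integral_abs_bound)
  also have "\<dots> \<le> (\<integral>x. \<bar>f x\<bar> \<partial>lborel)"
    by (rule integral_mono)
      (use assms integrable_indicator_times[OF assms] in \<open>auto simp: indicator_def split: if_splits\<close>)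
  finally show ?thesis .
qed

text \<open>The endpoint \<open>h x\<close> makes the integration set depend on x; writing the
  indicator as a conditional turns this into joint measurability in x and s.\<close>

lemma borel_measurable_primitive [measurable]:
  fixes f :: "'a \<Rightarrow> real \<Rightarrow> real"
  assumes [measurable]: "case_prod f \<in> borel_measurable (M \<Otimes>\<^sub>M borel)" "h \<in> borel_measurable M"
  shows "(\<lambda>x. \<integral>s. indicator {0..h x} s * f x s \<partial>lborel) \<in> borel_measurable M"
proof -
  have "(\<lambda>x. \<integral>s. (if 0 \<le> s \<and> s \<le> h x then 1 else 0) * f x s \<partial>lborel) \<in> borel_measurable M"
    by measurable
  moreover have "indicator {0..h x} s = (if 0 \<le> s \<and> s \<le> h x then 1 else 0 :: real)" for x s
    by (simp add: indicator_def)
  ultimately show ?thesis by simp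
qed

lemma continuous_on_primitive:
  fixes f :: "real \<Rightarrow> real"
  assumes f: "integrable lborel f"
  shows "continuous_on A (\<lambda>t. \<integral>s. indicator {0..t} s * f s \<partial>lborel)"
proof -
  have [measurable]: "f \<in> borel_measurable borel" using f by auto
  have "isCont (\<lambda>t. \<integral>s. indicator {0..t} s * f s \<partial>lborel) t" for t
    unfolding continuous_at_sequentially comp_def
  proof (intro allI impI)
    fix X assume X: "X \<longlonglongrightarrow> t"
    show "(\<lambda>n. \<integral>s. indicator {0..X n} s * f s \<partial>lborel) \<longlonglongrightarrow> (\<integral>s. indicator {0..t} s * f s \<partial>lborel)"
    proof (rule integral_dominated_convergence[where w="\<lambda>s. \<bar>f s\<bar>"])
      show "AE s in lborel. (\<lambda>n. indicator {0..X n} s * f s) \<longlonglongrightarrow> indicator {0..t} s * f s"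
        \<comment> \<open>At s = t the indicators may oscillate, since \<open>X\<close> can approach
          t from both sides; at every other s they are eventually constant.\<close>
        using AE_lborel_singleton[of t]
      proof eventually_elim
        case (elim s)
        have "eventually (\<lambda>n. indicator {0..X n} s * f s = indicator {0..t} s * f s) sequentially"
        proof (cases "s < t")
          case True
          from order_tendstoD(1)[OF X this] show ?thesis
            by eventually_elim (use True in \<open>auto simp: indicator_def\<close>)
        next
          case False
          then have "t < s" using elim by auto
          from order_tendstoD(2)[OF X this] show ?thesis
            by eventually_elim (use \<open>t < s\<close> in \<open>auto simp: indicator_def\<close>)
        qed
        then show ?case by (rule tendsto_eventually)
      qed
    qed (use f in \<open>auto simp: indicator_def\<close>)
  qed
  then show ?thesis by (simp add: continuous_at_imp_continuous_on)
qed

section \<open>Recovering a function from the zeros of its primitive\<close>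

text \<open>If the positive and the negative part of F define the same measure, then F vanishes
  almost everywhere. \<open>ennreal\<close> sends negative values to 0 and so extracts both parts.
  Rays {x<..} suffice to compare the measures, and the integral of F over a ray is a difference of
  two values of the primitive of f.\<close>

lemma AE_eq_0_if_primitive_eq_0:
  fixes f :: "real \<Rightarrow> real"
  assumes f: "integrable lborel f" and T: "T \<ge> 0"
    and z: "\<And>t. t \<in> {0..T} \<Longrightarrow> (\<integral>s. indicator {0..t} s * f s \<partial>lborel) = 0"
  shows "AE t in lborel. t \<in> {0..T} \<longrightarrow> f t = 0"
proof -
  define F where "F t = indicator {0..T} t * f t" for t
  have F: "integrable lborel F" unfolding F_def by (rule integrable_indicator_times[OF f]) auto
  have [measurable]: "F \<in> borel_measurable borel" using F by auto
  have zero: "(\<integral>s. indicator {x<..} s * F s \<partial>lborel) = 0" for x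
  proof -
    have "(\<integral>s. indicator {x<..} s * F s \<partial>lborel)
        = (\<integral>s. indicator {0..T} s * f s - indicator {0..min x T} s * f s \<partial>lborel)"
      by (rule Bochner_Integration.integral_cong) (auto simp: F_def indicator_def)
    also have "\<dots> = (\<integral>s. indicator {0..T} s * f s \<partial>lborel) - (\<integral>s. indicator {0..min x T} s * f s \<partial>lborel)"
      by (rule Bochner_Integration.integral_diff) (auto intro!: integrable_indicator_times f)
    also have "\<dots> = 0"
    proof (cases "x \<ge> 0")
      case True
      then show ?thesis using z T by auto
    next
      case False
      then have "indicator {0..min x T} s = (0::real)" for s by (auto simp: indicator_def)
      then show ?thesis using z T by auto
    qed
    finally show ?thesis .
  qed
  have pos: "emeasure (density lborel (\<lambda>s. ennreal (G s))) {x<..} = ennreal (\<integral>s. indicator {x<..} s * max 0 (G s) \<partial>lborel)"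
    if G: "integrable lborel G" for G :: "real \<Rightarrow> real" and x
  proof -
    have [measurable]: "G \<in> borel_measurable borel" using G by auto
    have "emeasure (density lborel (\<lambda>s. ennreal (G s))) {x<..} = (\<integral>\<^sup>+s. ennreal (indicator {x<..} s * max 0 (G s)) \<partial>lborel)"
      by (subst emeasure_density) (auto intro!: nn_integral_cong simp: indicator_def max_def ennreal_neg)
    also have "\<dots> = ennreal (\<integral>s. indicator {x<..} s * max 0 (G s) \<partial>lborel)"
      by (intro nn_integral_eq_integral integrable_indicator_times integrable_max) (use G in auto)
    finally show ?thesis .
  qed
  have "density lborel (\<lambda>s. ennreal (F s)) = density lborel (\<lambda>s. ennreal (- F s))"
  proof (rule measure_eqI_lessThan)
    fix x
    have mF: "integrable lborel (\<lambda>s. - F s)" using F by simp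
    show "emeasure (density lborel (\<lambda>s. ennreal (F s))) {x<..} < \<infinity>" using pos[OF F] by simp
    have "(\<integral>s. indicator {x<..} s * max 0 (F s) \<partial>lborel)
        = (\<integral>s. indicator {x<..} s * F s + indicator {x<..} s * max 0 (- F s) \<partial>lborel)"
      by (rule Bochner_Integration.integral_cong) (auto simp: indicator_def max_def)
    also have "\<dots> = (\<integral>s. indicator {x<..} s * F s \<partial>lborel) + (\<integral>s. indicator {x<..} s * max 0 (- F s) \<partial>lborel)"
      by (intro Bochner_Integration.integral_add integrable_indicator_times integrable_max) (use F in auto)
    finally show "emeasure (density lborel (\<lambda>s. ennreal (F s))) {x<..} = emeasure (density lborel (\<lambda>s. ennreal (- F s))) {x<..}"
      unfolding pos[OF F] pos[OF mF] zero by simp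
  qed auto
  then have "AE s in lborel. ennreal (F s) = ennreal (- F s)"
    by (intro sigma_finite_measure.density_unique[OF sigma_finite_lborel]) auto
  then show ?thesis
    by eventually_elim (auto simp: F_def indicator_def ennreal_eq_0_iff split: if_splits,
        metis ennreal_eq_0_iff ennreal_neg le_cases neg_le_0_iff_le order_antisym)
qed

lemma dense_in_IccI:
  fixes D :: "real set"
  assumes T: "0 < T" and "\<And>a b. 0 \<le> a \<Longrightarrow> a < b \<Longrightarrow> b \<le> T \<Longrightarrow> \<exists>t\<in>D. a < t \<and> t < b"
  shows "{0..T} \<subseteq> closure D"
proof
  fix x assume x: "x \<in> {0..T}"
  show "x \<in> closure D"
    unfolding closure_approachable
  proof (intro allI impI)
    fix e :: real assume "e > 0"
    then have "0 \<le> max 0 (x - e)" "max 0 (x - e) < min T (x + e)" "min T (x + e) \<le> T" using x T by auto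
    from assms(2)[OF this] obtain t where "t \<in> D" "max 0 (x - e) < t" "t < min T (x + e)" by auto
    then show "\<exists>y\<in>D. dist y x < e" by (intro bexI[of _ t]) (auto simp: dist_real_def)
  qed
qed

text \<open>An open interval without good points would be a null set of positive length.\<close>

lemma AE_dense_in_Icc:
  assumes T: "0 < T" and P: "AE t in lborel. t \<in> {0..T} \<longrightarrow> P t"
  shows "{0..T} \<subseteq> closure {t \<in> {0..T::real}. P t}"
proof (rule dense_in_IccI[OF T])
  fix a b :: real assume ab: "0 \<le> a" "a < b" "b \<le> T"
  show "\<exists>t\<in>{t \<in> {0..T}. P t}. a < t \<and> t < b"
  proof (rule ccontr)
    assume "\<not> ?thesis"
    then have "AE t in lborel. t \<notin> {a<..<b}" using P ab by (auto elim!: eventually_mono)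
    then have "{a<..<b} \<in> null_sets lborel" using AE_iff_null_sets[of "{a<..<b}" lborel] by auto
    then show False using ab by (simp add: null_sets_def)
  qed
qed

text \<open>Primitives are continuous, so zeros on a dense set suffice. The dense set consists of
  almost all times in \<open>ut_eq_w\<close>, and of the rational points of [0, l] when the equation
  of motion is derived.\<close>

lemma AE_eq_0_if_primitive_eq_0_dense:
  fixes f :: "real \<Rightarrow> real"
  assumes f: "integrable lborel f" and T: "T \<ge> 0" and D: "{0..T} \<subseteq> closure D"
    and z: "\<And>t. t \<in> D \<Longrightarrow> (\<integral>s. indicator {0..t} s * f s \<partial>lborel) = 0"
  shows "AE t in lborel. t \<in> {0..T} \<longrightarrow> f t = 0"
proof (rule AE_eq_0_if_primitive_eq_0[OF f T])
  fix t assume "t \<in> {0..T}"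
  then show "(\<integral>s. indicator {0..t} s * f s \<partial>lborel) = 0"
    using continuous_constant_on_closure[OF continuous_on_primitive[OF f] z] D by blast
qed

section \<open>Integration by parts and Gronwall's lemma for primitives of integrable
  functions\<close>

text \<open>The product is a double integral over the square with side [0, \<tau>]. Split along the
  diagonal, it becomes a sum over two triangles, and each is integrated in its own order.\<close>

lemma primitive_mult:
  fixes a b :: "real \<Rightarrow> real"
  assumes a: "integrable lborel a" and b: "integrable lborel b"
  defines "A \<equiv> \<lambda>t. \<integral>s. indicator {0..t} s * a s \<partial>lborel"
    and "B \<equiv> \<lambda>t. \<integral>s. indicator {0..t} s * b s \<partial>lborel"
  shows "A \<tau> * B \<tau> = (\<integral>t. indicator {0..\<tau>} t * (A t * b t) \<partial>lborel) + (\<integral>t. indicator {0..\<tau>} t * (a t * B t) \<partial>lborel)"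
proof -
  have [measurable]: "a \<in> borel_measurable borel" "b \<in> borel_measurable borel" using a b by auto
  define k1 where "k1 s t = (if 0 \<le> s \<and> s \<le> t \<and> t \<le> \<tau> then 1 else 0 :: real)" for s t
  define k2 where "k2 s t = (if 0 \<le> t \<and> t < s \<and> s \<le> \<tau> then 1 else 0 :: real)" for s t
  have k1: "case_prod k1 \<in> borel_measurable (borel \<Otimes>\<^sub>M borel)" "\<And>s t. \<bar>k1 s t\<bar> \<le> 1"
    unfolding k1_def by auto
  have k2: "case_prod k2 \<in> borel_measurable (borel \<Otimes>\<^sub>M borel)" "\<And>s t. \<bar>k2 s t\<bar> \<le> 1"
    unfolding k2_def by auto
  note i1 = integrable_pair_kernel[OF a b k1]
  note i2 = integrable_pair_kernel[OF a b k2]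
  have "A \<tau> * B \<tau> = (\<integral>s. (\<integral>t. indicator {0..\<tau>} s * a s * (indicator {0..\<tau>} t * b t) \<partial>lborel) \<partial>lborel)"
    by (simp add: A_def B_def)
  also have "\<dots> = (\<integral>s. (\<integral>t. a s * (k1 s t * b t) + a s * (k2 s t * b t) \<partial>lborel) \<partial>lborel)"
    by (intro Bochner_Integration.integral_cong refl) (auto simp: k1_def k2_def indicator_def)
  also have "\<dots> = (\<integral>z. (case z of (s, t) \<Rightarrow> a s * (k1 s t * b t)) + (case z of (s, t) \<Rightarrow> a s * (k2 s t * b t)) \<partial>(lborel \<Otimes>\<^sub>M lborel))"
    by (subst lborel_pair.integral_fst) (use i1 i2 in \<open>auto simp: case_prod_unfold\<close>)
  also have "\<dots> = (\<integral>z. (case z of (s, t) \<Rightarrow> a s * (k1 s t * b t)) \<partial>(lborel \<Otimes>\<^sub>M lborel)) + (\<integral>z. (case z of (s, t) \<Rightarrow> a s * (k2 s t * b t)) \<partial>(lborel \<Otimes>\<^sub>M lborel))"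
    by (rule Bochner_Integration.integral_add[OF i1 i2])
  also have "(\<integral>z. (case z of (s, t) \<Rightarrow> a s * (k1 s t * b t)) \<partial>(lborel \<Otimes>\<^sub>M lborel)) = (\<integral>t. (\<integral>s. a s * (k1 s t * b t) \<partial>lborel) \<partial>lborel)"
    by (rule lborel_pair.integral_snd[OF i1, symmetric])
  also have "\<dots> = (\<integral>t. indicator {0..\<tau>} t * (A t * b t) \<partial>lborel)"
  proof (rule Bochner_Integration.integral_cong[OF refl])
    fix t
    have "(\<integral>s. a s * (k1 s t * b t) \<partial>lborel) = (\<integral>s. (indicator {0..\<tau>} t * b t) * (indicator {0..t} s * a s) \<partial>lborel)"
      by (rule Bochner_Integration.integral_cong) (auto simp: k1_def indicator_def)
    also have "\<dots> = (indicator {0..\<tau>} t * b t) * A t" unfolding A_def by (rule integral_mult_right_zero)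
    finally show "(\<integral>s. a s * (k1 s t * b t) \<partial>lborel) = indicator {0..\<tau>} t * (A t * b t)" by simp
  qed
  also have "(\<integral>z. (case z of (s, t) \<Rightarrow> a s * (k2 s t * b t)) \<partial>(lborel \<Otimes>\<^sub>M lborel)) = (\<integral>s. (\<integral>t. a s * (k2 s t * b t) \<partial>lborel) \<partial>lborel)"
    by (rule lborel_pair.integral_fst[OF i2, symmetric])
  also have "\<dots> = (\<integral>t. indicator {0..\<tau>} t * (a t * B t) \<partial>lborel)"
  proof (rule Bochner_Integration.integral_cong[OF refl])
    fix s
    have "(\<integral>t. a s * (k2 s t * b t) \<partial>lborel) = (\<integral>t. (indicator {0..\<tau>} s * a s) * (indicator {0..s} t * b t) \<partial>lborel)"
    proof (rule integral_cong_AE)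
      show "AE t in lborel. a s * (k2 s t * b t) = (indicator {0..\<tau>} s * a s) * (indicator {0..s} t * b t)"
        \<comment> \<open>\<open>k2\<close> leaves out the diagonal, which \<open>k1\<close> already
          counts, whereas \<open>B s\<close> includes t = s; the two differ at one point
          only.\<close>
        using AE_lborel_singleton[of s] by eventually_elim (auto simp: k2_def indicator_def)
    qed (use k2 in measurable)
    also have "\<dots> = (indicator {0..\<tau>} s * a s) * B s" unfolding B_def by (rule integral_mult_right_zero)
    finally show "(\<integral>t. a s * (k2 s t * b t) \<partial>lborel) = indicator {0..\<tau>} s * (a s * B s)" by simp
  qed
  finally show ?thesis .
qed

lemma integral_exp_neg_Icc:
  assumes "0 \<le> t"
  shows "(\<integral>s. indicator {0..t} s * exp (- s) \<partial>lborel) = 1 - exp (- t :: real)"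
proof -
  have "(\<integral>s. exp (- s) * indicator {0..t} s \<partial>lborel) = (- exp (- t)) - (- exp (- 0 :: real))"
    by (rule integral_FTC_Icc_real[OF assms]) (auto intro!: derivative_eq_intros)
  then show ?thesis by (simp add: mult.commute)
qed

text \<open>The integrating factor exp(-t) is applied through \<open>primitive_mult\<close> instead
  of differentiation: exp(-\<tau>) Y(\<tau>) is the integral over [0, \<tau>] of exp(-t) (y(t) -
  Y(t)), and y - Y \<le> A there by hypothesis.\<close>

lemma Gronwall_primitive:
  fixes y :: "real \<Rightarrow> real"
  assumes y: "integrable lborel y"
    and le: "\<And>t. t \<in> {0..T} \<Longrightarrow> y t \<le> A + (\<integral>s. indicator {0..t} s * y s \<partial>lborel)"
    and \<tau>: "\<tau> \<in> {0..T}"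
  shows "(\<integral>s. indicator {0..\<tau>} s * y s \<partial>lborel) \<le> A * (exp \<tau> - 1)"
proof -
  define Y where "Y t = (\<integral>s. indicator {0..t} s * y s \<partial>lborel)" for t
  have [measurable]: "y \<in> borel_measurable borel" using y by auto
  have [measurable]: "Y \<in> borel_measurable borel" unfolding Y_def by measurable
  define e where "e s = indicator {0..\<tau>} s * exp (- s :: real)" for s
  have [measurable]: "e \<in> borel_measurable borel" unfolding e_def by measurable
  have e1: "\<bar>e s\<bar> \<le> indicator {0..\<tau>} s" for s by (auto simp: e_def indicator_def)
  have e: "integrable lborel e"
    by (rule integrable_of_abs_bound[OF _ _ e1]) auto
  have E: "(\<integral>s. indicator {0..t} s * e s \<partial>lborel) = 1 - exp (- t)" if "t \<in> {0..\<tau>}" for t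
  proof -
    have "(\<integral>s. indicator {0..t} s * e s \<partial>lborel) = (\<integral>s. indicator {0..t} s * exp (- s) \<partial>lborel)"
      by (rule Bochner_Integration.integral_cong) (use that in \<open>auto simp: e_def indicator_def\<close>)
    then show ?thesis using integral_exp_neg_Icc that by auto
  qed
  have iy: "integrable lborel (\<lambda>t. indicator {0..\<tau>} t * y t)"
    by (rule integrable_indicator_times[OF y]) auto
  have iey: "integrable lborel (\<lambda>t. e t * y t)"
  proof (rule integrable_of_abs_bound[where g="\<lambda>t. \<bar>y t\<bar>"])
    fix t
    have "\<bar>e t\<bar> * \<bar>y t\<bar> \<le> 1 * \<bar>y t\<bar>" by (rule mult_right_mono) (auto simp: e_def indicator_def)
    then show "\<bar>e t * y t\<bar> \<le> \<bar>y t\<bar>" by (simp add: abs_mult)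
  qed (use y in auto)
  have ieY: "integrable lborel (\<lambda>t. e t * Y t)"
  proof (rule integrable_of_abs_bound[where g="\<lambda>t. indicator {0..\<tau>} t * (\<integral>s. \<bar>y s\<bar> \<partial>lborel)"])
    fix t
    show "\<bar>e t * Y t\<bar> \<le> indicator {0..\<tau>} t * (\<integral>s. \<bar>y s\<bar> \<partial>lborel)"
      unfolding abs_mult Y_def by (intro mult_mono e1 abs_integral_indicator_le y) auto
  qed auto
  have "(1 - exp (- \<tau>)) * Y \<tau> = (\<integral>t. indicator {0..\<tau>} t * ((\<integral>s. indicator {0..t} s * e s \<partial>lborel) * y t) \<partial>lborel)
      + (\<integral>t. indicator {0..\<tau>} t * (e t * Y t) \<partial>lborel)"
    using primitive_mult[OF e y, of \<tau>] E[of \<tau>] \<tau> by (simp add: Y_def)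
  also have "(\<integral>t. indicator {0..\<tau>} t * ((\<integral>s. indicator {0..t} s * e s \<partial>lborel) * y t) \<partial>lborel)
      = (\<integral>t. indicator {0..\<tau>} t * y t - e t * y t \<partial>lborel)"
  proof (rule Bochner_Integration.integral_cong[OF refl])
    fix t
    show "indicator {0..\<tau>} t * ((\<integral>s. indicator {0..t} s * e s \<partial>lborel) * y t) = indicator {0..\<tau>} t * y t - e t * y t"
    proof (cases "t \<in> {0..\<tau>}")
      case True
      then show ?thesis unfolding E[OF True] by (simp add: e_def algebra_simps)
    qed (simp add: e_def)
  qed
  also have "\<dots> = Y \<tau> - (\<integral>t. e t * y t \<partial>lborel)"
    using iy iey by (simp add: Y_def)
  also have "(\<integral>t. indicator {0..\<tau>} t * (e t * Y t) \<partial>lborel) = (\<integral>t. e t * Y t \<partial>lborel)"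
    by (rule Bochner_Integration.integral_cong) (auto simp: e_def indicator_def)
  finally have "exp (- \<tau>) * Y \<tau> = (\<integral>t. e t * y t \<partial>lborel) - (\<integral>t. e t * Y t \<partial>lborel)"
    by (simp add: algebra_simps)
  also have "\<dots> = (\<integral>t. e t * y t - e t * Y t \<partial>lborel)" using iey ieY by simp
  also have "\<dots> \<le> (\<integral>t. e t * A \<partial>lborel)"
  proof (rule integral_mono)
    fix t
    show "e t * y t - e t * Y t \<le> e t * A"
    proof (cases "t \<in> {0..\<tau>}")
      case True
      then have "e t * (y t - Y t) \<le> e t * A"
        using le[of t] \<tau> by (intro mult_left_mono) (auto simp: e_def Y_def)
      then show ?thesis by (simp add: algebra_simps)
    qed (simp add: e_def)
  qed (use iey ieY e in auto)
  also have "\<dots> = (1 - exp (- \<tau>)) * A"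
    using integral_exp_neg_Icc[of \<tau>] \<tau> by (simp add: e_def)
  finally have "exp \<tau> * (exp (- \<tau>) * Y \<tau>) \<le> exp \<tau> * ((1 - exp (- \<tau>)) * A)"
    by (rule mult_left_mono) simp
  moreover have "exp \<tau> * (exp (- \<tau>) * Y \<tau>) = Y \<tau>" by (simp add: exp_minus)
  moreover have "exp \<tau> * ((1 - exp (- \<tau>)) * A) = A * (exp \<tau> - 1)" by (simp add: exp_minus field_simps)
  ultimately show ?thesis unfolding Y_def by argo
qed

section \<open>The energy identity\<close>

text \<open>The beam in normalised form: \<open>d\<close> stands for g' extended by zero and
  \<open>c\<close> for the moment coefficient. Bounds hold at every point and every section of
  \<open>W\<close> is square integrable, so that the estimates carry no exceptional null
  sets.\<close>

locale beam =
  fixes l T c r0 \<kappa>0 M :: real and \<rho> \<mu> r \<kappa> d :: "real \<Rightarrow> real" and W :: "real \<Rightarrow> real \<Rightarrow> real"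
  assumes l_pos: "l > 0" and T_pos: "T > 0" and r0_pos: "r0 > 0" and \<kappa>0_pos: "\<kappa>0 > 0"
    and coeff_measurable [measurable]: "\<rho> \<in> borel_measurable borel" "\<mu> \<in> borel_measurable borel"
      "r \<in> borel_measurable borel" "\<kappa> \<in> borel_measurable borel"
    and \<rho>_bounds: "\<And>x. 0 \<le> \<rho> x" "\<And>x. \<rho> x \<le> M"
    and \<mu>_bounds: "\<And>x. 0 \<le> \<mu> x" "\<And>x. \<mu> x \<le> M"
    and r_bounds: "\<And>x. r0 \<le> r x" "\<And>x. r x \<le> M"
    and \<kappa>_bounds: "\<And>x. \<kappa>0 \<le> \<kappa> x" "\<And>x. \<kappa> x \<le> M"
    and d_measurable [measurable]: "d \<in> borel_measurable borel"
    and d_square: "integrable lborel (\<lambda>t. (d t)\<^sup>2)"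
    and d_support: "\<And>t. t \<notin> {0..T} \<Longrightarrow> d t = 0"
    and W_measurable [measurable]: "case_prod W \<in> borel_measurable (borel \<Otimes>\<^sub>M borel)"
    and W_support: "\<And>x t. x \<notin> {0..l} \<or> t \<notin> {0..T} \<Longrightarrow> W x t = 0"
    and W_square: "integrable (lborel \<Otimes>\<^sub>M lborel) (\<lambda>(x, t). (W x t)\<^sup>2)"
    and W_square_time: "\<And>x. integrable lborel (\<lambda>t. (W x t)\<^sup>2)"
    and W_square_space: "\<And>t. integrable lborel (\<lambda>x. (W x t)\<^sup>2)"
begin

text \<open>\<open>W\<close> plays the role of \<open>u\<^sub>x\<^sub>x\<^sub>t\<close>. Every function is recovered from it:
  \<open>w = u\<^sub>t\<close> and \<open>U = u\<^sub>x\<^sub>x\<close>, while \<open>moment \<beta>\<close> is the twice integrated load \<open>\<beta> w\<close>, so that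
  \<open>(moment \<rho>, W) = (\<rho> w, w)\<close>. \<open>Q\<close> is the time derivative of \<open>moment \<rho>\<close>
  prescribed by the equation of motion.\<close>

definition k :: "real \<Rightarrow> real \<Rightarrow> real" where
  "k y x = indicator {0..l} y * indicator {0..l} x * max 0 (y - x)"

text \<open>The kernel \<open>k x s\<close>, which is max 0 (x - s) on [0, l], is the Green kernel
  of v'' with v(0) = v'(0) = 0, the same double integration as in \<open>inV\<close>.\<close>

definition w :: "real \<Rightarrow> real \<Rightarrow> real" where
  "w x t = (\<integral>s. k x s * W s t \<partial>lborel)"

text \<open>With the kernel transposed, the conditions sit at the free end: p =
  \<open>moment \<beta>\<close> satisfies p'' = \<beta> w with p(l) = p'(l) = 0, like the bending
  moment of a cantilever under the load \<beta> w.\<close>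

definition moment :: "(real \<Rightarrow> real) \<Rightarrow> real \<Rightarrow> real \<Rightarrow> real" where
  "moment \<beta> x t = (\<integral>y. k y x * (\<beta> y * w y t) \<partial>lborel)"

definition U :: "real \<Rightarrow> real \<Rightarrow> real" where
  "U x t = (\<integral>s. indicator {0..t} s * W x s \<partial>lborel)"

definition D :: "real \<Rightarrow> real" where
  "D t = (\<integral>s. indicator {0..t} s * d s \<partial>lborel)"

text \<open>Here \<open>D\<close> is g. The weight c + l - x represents the load, as v'(l) =
  \<integral> v'' and v(l) = \<integral> (l - x) v''. Every other term of the weak form is likewise
  written as a pairing with v'', which leaves an identity between functions of x and t.\<close>

definition Q :: "real \<Rightarrow> real \<Rightarrow> real" where
  "Q x t = indicator {0..l} x * indicator {0..T} t *
     (D t * (c + l - x) - moment \<mu> x t - r x * U x t - \<kappa> x * W x t)"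

definition P :: "real \<Rightarrow> real \<Rightarrow> real" where
  "P x t = (\<integral>s. indicator {0..t} s * Q x s \<partial>lborel)"

section \<open>Measurability and square integrability of the derived fields\<close>

lemma k_measurable [measurable]: "case_prod k \<in> borel_measurable (borel \<Otimes>\<^sub>M borel)"
  unfolding k_def by measurable

lemma abs_k_le: "\<bar>k y x\<bar> \<le> l"
  and abs_k_le_indicator: "\<bar>k y x\<bar> \<le> l * indicator {0..l} x"
  using l_pos by (auto simp: k_def indicator_def)

lemma M_nonneg: "0 \<le> M" using \<rho>_bounds[of 0] by linarith

lemma w_measurable [measurable]: "case_prod w \<in> borel_measurable (borel \<Otimes>\<^sub>M borel)"
  unfolding w_def by measurable

lemma moment_measurable [measurable]:
  assumes [measurable]: "\<beta> \<in> borel_measurable borel"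
  shows "case_prod (moment \<beta>) \<in> borel_measurable (borel \<Otimes>\<^sub>M borel)"
  unfolding moment_def by measurable

lemma U_measurable [measurable]: "case_prod U \<in> borel_measurable (borel \<Otimes>\<^sub>M borel)"
  unfolding U_def by measurable

lemma D_measurable [measurable]: "D \<in> borel_measurable borel"
  unfolding D_def by measurable

lemma Q_measurable [measurable]: "case_prod Q \<in> borel_measurable (borel \<Otimes>\<^sub>M borel)"
  unfolding Q_def by measurable

lemma P_measurable [measurable]: "case_prod P \<in> borel_measurable (borel \<Otimes>\<^sub>M borel)"
  unfolding P_def by measurable

lemma d_integrable: "integrable lborel d"
proof (rule integrable_of_abs_bound)
  show "integrable lborel (\<lambda>t. indicator {0..T} t + (d t)\<^sup>2)" using d_square by simp
  fix t
  have "\<bar>d t\<bar> \<le> 1 + (d t)\<^sup>2" using zero_le_power2[of "\<bar>d t\<bar> - 1"] by (simp add: power2_diff)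
  then show "\<bar>d t\<bar> \<le> indicator {0..T} t + (d t)\<^sup>2"
    using d_support[of t] by (cases "t \<in> {0..T}") auto
qed simp

lemma W_integrable_time: "integrable lborel (W x)"
proof (rule integrable_of_abs_bound)
  show "integrable lborel (\<lambda>t. indicator {0..T} t + (W x t)\<^sup>2)" using W_square_time by simp
  fix t
  have "\<bar>W x t\<bar> \<le> 1 + (W x t)\<^sup>2" using zero_le_power2[of "\<bar>W x t\<bar> - 1"] by (simp add: power2_diff)
  then show "\<bar>W x t\<bar> \<le> indicator {0..T} t + (W x t)\<^sup>2"
    using W_support[of x t] by (cases "t \<in> {0..T}") auto
qed measurable

lemma W_integrable_space: "integrable lborel (\<lambda>x. W x t)"
proof (rule integrable_of_abs_bound)
  show "integrable lborel (\<lambda>x. indicator {0..l} x + (W x t)\<^sup>2)" using W_square_space by simp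
  fix x
  have "\<bar>W x t\<bar> \<le> 1 + (W x t)\<^sup>2" using zero_le_power2[of "\<bar>W x t\<bar> - 1"] by (simp add: power2_diff)
  then show "\<bar>W x t\<bar> \<le> indicator {0..l} x + (W x t)\<^sup>2"
    using W_support[of x t] by (cases "x \<in> {0..l}") auto
qed measurable

definition N :: "real \<Rightarrow> real" where "N t = (\<integral>x. (W x t)\<^sup>2 \<partial>lborel)"

text \<open>A bound for |w x t| that is uniform in x: Cauchy-Schwarz with |k| \<le> l on an interval
  of length l produces l^2 times l.\<close>

definition S :: "real \<Rightarrow> real" where "S t = sqrt (l ^ 3 * N t)"

lemma N_nonneg: "0 \<le> N t" by (simp add: N_def)

lemma S_nonneg: "0 \<le> S t" using N_nonneg l_pos by (simp add: S_def)

lemma S_square: "(S t)\<^sup>2 = l ^ 3 * N t" using N_nonneg l_pos by (simp add: S_def)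

lemma N_integrable: "integrable lborel N"
  unfolding N_def by (rule lborel_pair.integrable_snd) (use W_square in simp)

lemma N_measurable [measurable]: "N \<in> borel_measurable borel" using N_integrable by auto

lemma S_measurable [measurable]: "S \<in> borel_measurable borel" unfolding S_def by measurable

lemma w_eq_0: "x \<notin> {0..l} \<or> t \<notin> {0..T} \<Longrightarrow> w x t = 0"
  using W_support by (auto simp: w_def k_def)

lemma moment_eq_0: "x \<notin> {0..l} \<or> t \<notin> {0..T} \<Longrightarrow> moment \<beta> x t = 0"
  using w_eq_0 by (auto simp: moment_def k_def)

lemma Q_eq_0: "x \<notin> {0..l} \<or> t \<notin> {0..T} \<Longrightarrow> Q x t = 0"
  by (auto simp: Q_def)

lemma abs_w_le: "\<bar>w x t\<bar> \<le> indicator {0..l} x * S t"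
proof (cases "x \<in> {0..l}")
  case True
  have kb: "\<bar>(k x s)\<^sup>2\<bar> \<le> l\<^sup>2 * indicator {0..l} s" for s
    using power_mono[OF abs_k_le_indicator[of x s] abs_ge_zero, of 2]
    by (cases "s \<in> {0..l}") (auto simp: power_mult_distrib)
  have k2: "integrable lborel (\<lambda>s. (k x s)\<^sup>2)"
    by (rule integrable_of_abs_bound[OF _ _ kb]) auto
  have "(w x t)\<^sup>2 \<le> (\<integral>s. (k x s)\<^sup>2 \<partial>lborel) * (\<integral>s. (W s t)\<^sup>2 \<partial>lborel)"
    unfolding w_def by (rule Cauchy_Schwarz_integral) (use k2 W_square_space in auto)
  also have "\<dots> \<le> l ^ 3 * N t"
    unfolding N_def
  proof (rule mult_right_mono)
    have "(\<integral>s. (k x s)\<^sup>2 \<partial>lborel) \<le> (\<integral>s. l\<^sup>2 * indicator {0..l} s \<partial>lborel)"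
      by (rule integral_mono[OF k2]) (use kb in auto)
    also have "\<dots> = l ^ 3" using l_pos by (simp add: power3_eq_cube power2_eq_square)
    finally show "(\<integral>s. (k x s)\<^sup>2 \<partial>lborel) \<le> l ^ 3" .
  qed simp
  finally show ?thesis using True by (simp add: S_def real_le_rsqrt)
qed (simp add: w_eq_0 S_nonneg)

lemma abs_coeff_w_le:
  assumes "\<And>x. 0 \<le> \<beta> x" "\<And>x. \<beta> x \<le> M"
  shows "\<bar>\<beta> x * w x t\<bar> \<le> M * S t * indicator {0..l} x"
proof -
  have "\<bar>\<beta> x\<bar> * \<bar>w x t\<bar> \<le> M * (indicator {0..l} x * S t)"
    by (rule mult_mono) (use assms abs_w_le M_nonneg in auto)
  then show ?thesis by (simp add: abs_mult mult_ac)
qed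

lemma coeff_w_integrable:
  assumes [measurable]: "\<beta> \<in> borel_measurable borel" and "\<And>x. 0 \<le> \<beta> x" "\<And>x. \<beta> x \<le> M"
  shows "integrable lborel (\<lambda>x. \<beta> x * w x t)"
  by (rule integrable_of_abs_bound[OF _ _ abs_coeff_w_le]) (use assms in auto)

lemma abs_moment_le:
  assumes [measurable]: "\<beta> \<in> borel_measurable borel" and "\<And>x. 0 \<le> \<beta> x" "\<And>x. \<beta> x \<le> M"
  shows "\<bar>moment \<beta> x t\<bar> \<le> l\<^sup>2 * M * S t * indicator {0..l} x"
proof (cases "x \<in> {0..l}")
  case True
  have b: "\<bar>k y x * (\<beta> y * w y t)\<bar> \<le> l * (M * S t * indicator {0..l} y)" for y
    unfolding abs_mult[of "k y x"] by (rule mult_mono) (use abs_k_le abs_coeff_w_le assms l_pos in auto)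
  have i: "integrable lborel (\<lambda>y. k y x * (\<beta> y * w y t))"
    by (rule integrable_of_abs_bound[OF _ _ b]) auto
  have "\<bar>moment \<beta> x t\<bar> \<le> (\<integral>y. \<bar>k y x * (\<beta> y * w y t)\<bar> \<partial>lborel)"
    unfolding moment_def by (rule integral_abs_bound)
  also have "\<dots> \<le> (\<integral>y. l * (M * S t * indicator {0..l} y) \<partial>lborel)"
    by (rule integral_mono) (use i b in auto)
  finally show ?thesis using True l_pos by (simp add: power2_eq_square mult_ac)
qed (simp add: moment_eq_0)

lemma U_square_le: "(U x t)\<^sup>2 \<le> T * (\<integral>s. (W x s)\<^sup>2 \<partial>lborel)"
proof -
  \<comment> \<open>Intersecting with [0, T] caps the length of the interval by T for every
    t.\<close>
  have sq: "integrable lborel (\<lambda>s. (indicator ({0..t} \<inter> {0..T}) s :: real)\<^sup>2)"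
    by (simp add: power2_eq_square flip: indicator_inter_arith)
  have "U x t = (\<integral>s. indicator ({0..t} \<inter> {0..T}) s * W x s \<partial>lborel)"
    unfolding U_def by (rule Bochner_Integration.integral_cong) (auto simp: indicator_def W_support)
  also have "\<dots>\<^sup>2 \<le> (\<integral>s. (indicator ({0..t} \<inter> {0..T}) s)\<^sup>2 \<partial>lborel) * (\<integral>s. (W x s)\<^sup>2 \<partial>lborel)"
    by (rule Cauchy_Schwarz_integral) (use sq W_square_time in auto)
  also have "\<dots> \<le> T * (\<integral>s. (W x s)\<^sup>2 \<partial>lborel)"
  proof (rule mult_right_mono)
    have "(\<integral>s. (indicator ({0..t} \<inter> {0..T}) s)\<^sup>2 \<partial>lborel) \<le> (\<integral>s. (indicator {0..T} s :: real) \<partial>lborel)"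
      by (rule integral_mono[OF sq integrable_indicator_Icc]) (auto simp: indicator_def)
    also have "\<dots> = T" using T_pos by simp
    finally show "(\<integral>s. (indicator ({0..t} \<inter> {0..T}) s)\<^sup>2 \<partial>lborel) \<le> T" .
  qed simp
  finally show ?thesis .
qed

lemma U_eq_0: "x \<notin> {0..l} \<Longrightarrow> U x t = 0" using W_support by (simp add: U_def)

lemma abs_D_le: "\<bar>D t\<bar> \<le> (\<integral>s. \<bar>d s\<bar> \<partial>lborel)"
  unfolding D_def by (rule abs_integral_indicator_le[OF d_integrable]) simp

lemma integrable_pair_of_bound:
  fixes f :: "real \<Rightarrow> real \<Rightarrow> real"
  assumes "case_prod f \<in> borel_measurable (borel \<Otimes>\<^sub>M borel)" "integrable lborel a" "integrable lborel b"
    "\<And>x t. \<bar>f x t\<bar> \<le> a x * b t"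
  shows "integrable (lborel \<Otimes>\<^sub>M lborel) (\<lambda>(x, t). f x t)"
  by (rule integrable_of_abs_bound[OF _ integrable_pair_mult[OF assms(2,3)]]) (use assms(1,4) in auto)

lemma U_square_integrable:
  "integrable (lborel \<Otimes>\<^sub>M lborel) (\<lambda>(x, t). (indicator {0..T} t * U x t)\<^sup>2)"
proof (rule integrable_pair_of_bound)
  show "integrable lborel (\<lambda>x. T * (\<integral>s. (W x s)\<^sup>2 \<partial>lborel))"
    by (intro integrable_mult_right lborel_pair.integrable_fst) (use W_square in simp)
  show "integrable lborel (indicator {0..T} :: real \<Rightarrow> real)" by simp
  show "\<bar>(indicator {0..T} t * U x t)\<^sup>2\<bar> \<le> T * (\<integral>s. (W x s)\<^sup>2 \<partial>lborel) * indicator {0..T} t" for x t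
    using U_square_le[of x t] by (auto simp: indicator_def)
qed measurable

lemma w_square_integrable: "integrable (lborel \<Otimes>\<^sub>M lborel) (\<lambda>(x, t). (w x t)\<^sup>2)"
proof (rule integrable_pair_of_bound)
  show "integrable lborel (indicator {0..l} :: real \<Rightarrow> real)" by simp
  show "integrable lborel (\<lambda>t. l ^ 3 * N t)" using N_integrable by simp
  show "\<bar>(w x t)\<^sup>2\<bar> \<le> indicator {0..l} x * (l ^ 3 * N t)" for x t
    using power_mono[OF abs_w_le[of x t] abs_ge_zero, of 2] S_square[of t]
    by (auto simp: indicator_def split: if_splits)
qed measurable

lemma moment_square_integrable:
  assumes [measurable]: "\<beta> \<in> borel_measurable borel" and "\<And>x. 0 \<le> \<beta> x" "\<And>x. \<beta> x \<le> M"
  shows "integrable (lborel \<Otimes>\<^sub>M lborel) (\<lambda>(x, t). (moment \<beta> x t)\<^sup>2)"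
proof (rule integrable_pair_of_bound)
  show "integrable lborel (indicator {0..l} :: real \<Rightarrow> real)" by simp
  show "integrable lborel (\<lambda>t. (l\<^sup>2 * M)\<^sup>2 * (l ^ 3 * N t))" using N_integrable by simp
  show "\<bar>(moment \<beta> x t)\<^sup>2\<bar> \<le> indicator {0..l} x * ((l\<^sup>2 * M)\<^sup>2 * (l ^ 3 * N t))" for x t
    using power_mono[OF abs_moment_le[OF assms, of x t] abs_ge_zero, of 2]
    unfolding S_square[symmetric] by (auto simp: indicator_def power_mult_distrib split: if_splits)
qed measurable

lemma load_square_integrable:
  "integrable (lborel \<Otimes>\<^sub>M lborel) (\<lambda>(x, t). (indicator {0..l} x * indicator {0..T} t * (D t * (c + l - x)))\<^sup>2)"
proof (rule integrable_pair_of_bound)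
  let ?C = "((\<integral>s. \<bar>d s\<bar> \<partial>lborel) * (\<bar>c\<bar> + l))\<^sup>2"
  show "integrable lborel (\<lambda>x. ?C * indicator {0..l} x)" by simp
  show "integrable lborel (indicator {0..T} :: real \<Rightarrow> real)" by simp
  show "\<bar>(indicator {0..l} x * indicator {0..T} t * (D t * (c + l - x)))\<^sup>2\<bar> \<le> ?C * indicator {0..l} x * indicator {0..T} t" for x t
  proof (cases "x \<in> {0..l} \<and> t \<in> {0..T}")
    case True
    have "\<bar>D t\<bar> * \<bar>c + l - x\<bar> \<le> (\<integral>s. \<bar>d s\<bar> \<partial>lborel) * (\<bar>c\<bar> + l)"
      by (rule mult_mono) (use abs_D_le True in auto)
    then have "\<bar>D t * (c + l - x)\<bar>\<^sup>2 \<le> ?C" by (intro power_mono) (auto simp: abs_mult)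
    then show ?thesis using True by simp
  qed (auto simp: indicator_def)
qed measurable

lemma coeff_W_square_integrable:
  "integrable (lborel \<Otimes>\<^sub>M lborel) (\<lambda>(x, t). (\<kappa> x * W x t)\<^sup>2)"
proof (rule integrable_of_abs_bound)
  show "integrable (lborel \<Otimes>\<^sub>M lborel) (\<lambda>z. M\<^sup>2 * (case z of (x, t) \<Rightarrow> (W x t)\<^sup>2))" using W_square by simp
  have "(\<kappa> x)\<^sup>2 \<le> M\<^sup>2" for x using \<kappa>_bounds[of x] \<kappa>0_pos by (intro power_mono) auto
  then show "\<bar>case z of (x, t) \<Rightarrow> (\<kappa> x * W x t)\<^sup>2\<bar> \<le> M\<^sup>2 * (case z of (x, t) \<Rightarrow> (W x t)\<^sup>2)" for z
    by (cases z) (auto simp: power_mult_distrib intro: mult_right_mono)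
qed measurable

lemma coeff_U_square_integrable:
  "integrable (lborel \<Otimes>\<^sub>M lborel) (\<lambda>(x, t). (indicator {0..T} t * (r x * U x t))\<^sup>2)"
proof (rule integrable_of_abs_bound)
  show "integrable (lborel \<Otimes>\<^sub>M lborel) (\<lambda>z. M\<^sup>2 * (case z of (x, t) \<Rightarrow> (indicator {0..T} t * U x t)\<^sup>2))"
    using U_square_integrable by simp
  have "(r x)\<^sup>2 \<le> M\<^sup>2" for x using r_bounds[of x] r0_pos by (intro power_mono) auto
  then show "\<bar>case z of (x, t) \<Rightarrow> (indicator {0..T} t * (r x * U x t))\<^sup>2\<bar> \<le> M\<^sup>2 * (case z of (x, t) \<Rightarrow> (indicator {0..T} t * U x t)\<^sup>2)" for z
    by (cases z; cases "snd z \<in> {0..T}") (auto simp: power_mult_distrib intro: mult_right_mono)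
qed measurable

text \<open>In this form each term is square integrable on the whole plane. \<open>moment\<close>
  and \<open>W\<close> vanish outside the rectangle by themselves, whereas \<open>U\<close> stays
  constant in time after T and has to keep the time indicator.\<close>

lemma Q_split: "Q x t = indicator {0..l} x * indicator {0..T} t * (D t * (c + l - x)) - moment \<mu> x t
    - indicator {0..T} t * (r x * U x t) - \<kappa> x * W x t"
  by (cases "x \<in> {0..l}"; cases "t \<in> {0..T}")
     (auto simp: Q_def U_eq_0 W_support moment_eq_0)

lemma Q_square_integrable: "integrable (lborel \<Otimes>\<^sub>M lborel) (\<lambda>(x, t). (Q x t)\<^sup>2)"
proof -
  have "integrable (lborel \<Otimes>\<^sub>M lborel) (\<lambda>z. (indicator {0..l} (fst z) * indicator {0..T} (snd z) * (D (snd z) * (c + l - (fst z))) - moment \<mu> (fst z) (snd z)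
    - indicator {0..T} (snd z) * (r (fst z) * U (fst z) (snd z)) - \<kappa> (fst z) * W (fst z) (snd z))\<^sup>2)"
    by (intro integrable_diff_square)
      (use load_square_integrable moment_square_integrable[OF _ \<mu>_bounds] coeff_U_square_integrable coeff_W_square_integrable
        in \<open>auto simp: case_prod_unfold\<close>)
  then show ?thesis by (simp add: Q_split case_prod_unfold)
qed

lemma integrable_pair_of_square:
  fixes f :: "real \<Rightarrow> real \<Rightarrow> real"
  assumes f: "case_prod f \<in> borel_measurable (borel \<Otimes>\<^sub>M borel)"
    and sq: "integrable (lborel \<Otimes>\<^sub>M lborel) (\<lambda>(x, t). (f x t)\<^sup>2)"
    and supp: "\<And>x t. x \<notin> {0..l} \<or> t \<notin> {0..T} \<Longrightarrow> f x t = 0"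
  shows "integrable (lborel \<Otimes>\<^sub>M lborel) (\<lambda>(x, t). f x t)"
proof (rule integrable_of_abs_bound)
  have "integrable (lborel \<Otimes>\<^sub>M lborel) (\<lambda>(x, t). indicator {0..l} x * (indicator {0..T} t :: real))"
    by (rule integrable_pair_mult) auto
  then show "integrable (lborel \<Otimes>\<^sub>M lborel) (\<lambda>z. (case z of (x, t) \<Rightarrow> indicator {0..l} x * indicator {0..T} t)
     + (case z of (x, t) \<Rightarrow> (f x t)\<^sup>2))" using sq by simp
  fix z :: "real \<times> real"
  obtain x t where z: "z = (x, t)" by force
  have "\<bar>f x t\<bar> \<le> 1 + (f x t)\<^sup>2" using zero_le_power2[of "\<bar>f x t\<bar> - 1"] by (simp add: power2_diff)
  then show "\<bar>case z of (x, t) \<Rightarrow> f x t\<bar> \<le> (case z of (x, t) \<Rightarrow> indicator {0..l} x * indicator {0..T} t)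
     + (case z of (x, t) \<Rightarrow> (f x t)\<^sup>2)"
    using supp[of x t] unfolding z by (cases "x \<in> {0..l}"; cases "t \<in> {0..T}") auto
qed (use f in simp)

lemma Q_integrable: "integrable (lborel \<Otimes>\<^sub>M lborel) (\<lambda>(x, t). Q x t)"
  by (rule integrable_pair_of_square[OF Q_measurable Q_square_integrable Q_eq_0])

section \<open>The kinetic energy and its representation by the moment\<close>

definition E :: "real \<Rightarrow> real" where "E t = (\<integral>x. \<rho> x * (w x t)\<^sup>2 \<partial>lborel)"

lemma E_measurable [measurable]: "E \<in> borel_measurable borel" unfolding E_def by measurable

lemma E_nonneg: "0 \<le> E t" unfolding E_def by (rule integral_nonneg_AE) (simp add: \<rho>_bounds)

lemma coeff_w_mult_w_le:
  assumes "\<And>x. 0 \<le> \<beta> x" "\<And>x. \<beta> x \<le> M"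
  shows "\<bar>\<beta> x * w x t * w x t'\<bar> \<le> M * S t * S t' * indicator {0..l} x"
proof -
  have "\<bar>\<beta> x * w x t\<bar> * \<bar>w x t'\<bar> \<le> (M * S t * indicator {0..l} x) * (indicator {0..l} x * S t')"
    by (rule mult_mono[OF abs_coeff_w_le[OF assms] abs_w_le]) (use M_nonneg S_nonneg in auto)
  then show ?thesis by (auto simp: abs_mult indicator_def)
qed

lemma coeff_w_mult_w_integrable:
  assumes [measurable]: "\<beta> \<in> borel_measurable borel" and "\<And>x. 0 \<le> \<beta> x" "\<And>x. \<beta> x \<le> M"
  shows "integrable lborel (\<lambda>x. \<beta> x * w x t * w x t')"
  by (rule integrable_of_abs_bound[OF _ _ coeff_w_mult_w_le]) (use assms in auto)

lemma E_integrable: "integrable lborel E"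
proof (rule integrable_of_abs_bound)
  show "integrable lborel (\<lambda>t. M * l * (l ^ 3 * N t))" using N_integrable by simp
  fix t
  have "E t \<le> (\<integral>x. M * S t * S t * indicator {0..l} x \<partial>lborel)"
    unfolding E_def
  proof (rule integral_mono)
    show "integrable lborel (\<lambda>x. \<rho> x * (w x t)\<^sup>2)"
      using coeff_w_mult_w_integrable[of \<rho> t t, OF _ \<rho>_bounds] by (simp add: power2_eq_square mult.assoc)
    show "\<rho> x * (w x t)\<^sup>2 \<le> M * S t * S t * indicator {0..l} x" for x
      using coeff_w_mult_w_le[of \<rho> x t t, OF \<rho>_bounds] by (simp add: power2_eq_square mult.assoc)
  qed auto
  also have "\<dots> = M * l * (S t)\<^sup>2" using l_pos by (simp add: power2_eq_square)
  finally show "\<bar>E t\<bar> \<le> M * l * (l ^ 3 * N t)" using E_nonneg[of t] by (simp add: S_square)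
qed simp

lemma E_eq_0: "t \<notin> {0..T} \<Longrightarrow> E t = 0" by (simp add: E_def w_eq_0)

text \<open>The kernel moves from \<beta> w onto b. For b = \<open>W\<close> the inner integral is
  \<open>w\<close> again, which makes the pairing symmetric in two times; for b an indicator it is a
  test function of the weak form.\<close>

lemma moment_pairing:
  assumes [measurable]: "\<beta> \<in> borel_measurable borel" and \<beta>: "\<And>x. 0 \<le> \<beta> x" "\<And>x. \<beta> x \<le> M"
    and b: "integrable lborel b"
  shows "(\<integral>x. moment \<beta> x t * b x \<partial>lborel) = (\<integral>x. \<beta> x * w x t * (\<integral>s. k x s * b s \<partial>lborel) \<partial>lborel)"
  unfolding moment_def
  by (rule integral_kernel_adjoint[symmetric, OF coeff_w_integrable[OF assms(1-3)] b k_measurable abs_k_le])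

lemma moment_W_integrable:
  assumes [measurable]: "\<beta> \<in> borel_measurable borel" and \<beta>: "\<And>x. 0 \<le> \<beta> x" "\<And>x. \<beta> x \<le> M"
  shows "integrable lborel (\<lambda>x. moment \<beta> x t * W x t')"
proof (rule integrable_of_abs_bound)
  show "integrable lborel (\<lambda>x. (l\<^sup>2 * M * S t) * \<bar>W x t'\<bar>)" using W_integrable_space by simp
  show "\<bar>moment \<beta> x t * W x t'\<bar> \<le> (l\<^sup>2 * M * S t) * \<bar>W x t'\<bar>" for x
    using mult_right_mono[OF abs_moment_le[OF assms, of x t] abs_ge_zero[of "W x t'"]] W_support[of x t']
    by (cases "x \<in> {0..l}") (auto simp: abs_mult)
qed measurable

lemma E_diff:
  "E t - E t' = (\<integral>x. (moment \<rho> x t - moment \<rho> x t') * (W x t + W x t') \<partial>lborel)"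
proof -
  have pr: "(\<integral>x. moment \<rho> x a * W x b \<partial>lborel) = (\<integral>x. \<rho> x * w x a * w x b \<partial>lborel)" for a b
    using moment_pairing[OF _ \<rho>_bounds W_integrable_space] by (simp add: w_def)
  have i: "integrable lborel (\<lambda>x. moment \<rho> x a * W x b)" for a b
    by (rule moment_W_integrable[OF _ \<rho>_bounds]) simp
  have "(\<integral>x. (moment \<rho> x t - moment \<rho> x t') * (W x t + W x t') \<partial>lborel)
    = (\<integral>x. moment \<rho> x t * W x t + moment \<rho> x t * W x t' - moment \<rho> x t' * W x t - moment \<rho> x t' * W x t' \<partial>lborel)"
    by (simp add: algebra_simps)
  also have "\<dots> = (\<integral>x. \<rho> x * w x t * w x t \<partial>lborel) + (\<integral>x. \<rho> x * w x t * w x t' \<partial>lborel)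
     - (\<integral>x. \<rho> x * w x t' * w x t \<partial>lborel) - (\<integral>x. \<rho> x * w x t' * w x t' \<partial>lborel)"
    using i by (simp add: pr)
  also have "(\<integral>x. \<rho> x * w x t' * w x t \<partial>lborel) = (\<integral>x. \<rho> x * w x t * w x t' \<partial>lborel)"
    by (simp add: mult_ac)
  finally show ?thesis by (simp add: E_def power2_eq_square mult.assoc)
qed

end

section \<open>Time increments of the energy and their limit\<close>

lemma AE_lborel_translation:
  fixes a :: "'a::euclidean_space"
  assumes "AE x in lborel. R x"
  shows "AE x in lborel. R (x + a)"
proof -
  have "AE x in distr lborel borel ((+) a). R x" using assms by (subst lborel_distr_plus)
  then have "AE x in lborel. R (a + x)" by (rule AE_distrD[rotated]) simp
  then show ?thesis by (simp add: add.commute)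
qed

lemma translation_time_square_integrable:
  fixes f :: "real \<Rightarrow> real \<Rightarrow> real"
  assumes "integrable (lborel \<Otimes>\<^sub>M lborel) (\<lambda>(x, t). (f x t)\<^sup>2)"
  shows "integrable lborel (\<lambda>z. (f (fst z) (snd z - s))\<^sup>2)"
proof -
  have "integrable lborel (\<lambda>z. (f (fst z) (snd z))\<^sup>2)"
    using assms by (simp add: lborel_prod case_prod_unfold)
  from integrable_lborel_translation[OF this, of "(0, - s)"] show ?thesis by simp
qed

lemma translation_time_square_integral:
  fixes f :: "real \<Rightarrow> real \<Rightarrow> real"
  assumes [measurable]: "case_prod f \<in> borel_measurable (borel \<Otimes>\<^sub>M borel)"
  shows "(\<integral>z. (f (fst z) (snd z - s))\<^sup>2 \<partial>lborel) = (\<integral>z. (f (fst z) (snd z))\<^sup>2 \<partial>lborel)"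
proof -
  have "(\<lambda>z. (f (fst z) (snd z))\<^sup>2) \<in> borel_measurable (borel \<Otimes>\<^sub>M borel)" by measurable
  then have "(\<lambda>z. (f (fst z) (snd z))\<^sup>2) \<in> borel_measurable borel" by (simp add: borel_prod)
  from integral_lborel_translation[OF this, of "(0, - s)"] show ?thesis by simp
qed

locale beam_solution = beam +
  assumes motion: "AE t in lborel. t \<in> {0..T} \<longrightarrow> (AE x in lborel. x \<in> {0..l} \<longrightarrow> moment \<rho> x t = P x t)"
begin

text \<open>Both sides vanish for t < 0; this is how the zero initial velocity enters once t -
  \<delta> leaves [0, T] on the left. The range stops at T, since \<open>P\<close> stays constant
  afterwards while \<open>moment\<close> is cut off.\<close>

lemma motion_whole_line: "AE t in lborel. t \<le> T \<longrightarrow> (AE x in lborel. moment \<rho> x t = P x t)"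
  using motion
proof eventually_elim
  case (elim t)
  show ?case
  proof
    assume "t \<le> T"
    show "AE x in lborel. moment \<rho> x t = P x t"
    proof (cases "t \<ge> 0")
      case True
      with elim \<open>t \<le> T\<close> have "AE x in lborel. x \<in> {0..l} \<longrightarrow> moment \<rho> x t = P x t" by auto
      then show ?thesis
      proof eventually_elim
        case (elim x)
        then show ?case by (cases "x \<in> {0..l}") (auto simp: P_def Q_eq_0 moment_eq_0)
      qed
    qed (auto simp: P_def moment_eq_0)
  qed
qed

text \<open>The substitution of t - s for s turns the moving window [t - \<delta>, t] into the fixed
  one [0, \<delta>] and puts the dependence on t into a translate of \<open>Q\<close>.\<close>

lemma P_diff:
  assumes q: "integrable lborel (Q x)" and "\<delta> > 0"
  shows "P x t - P x (t - \<delta>) = (\<integral>s. indicator {0..\<delta>} s * Q x (t - s) \<partial>lborel)"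
proof -
  have [measurable]: "Q x \<in> borel_measurable borel" using q by auto
  have "P x t - P x (t - \<delta>) = (\<integral>s. indicator {0..t} s * Q x s - indicator {0..t - \<delta>} s * Q x s \<partial>lborel)"
    unfolding P_def by (rule Bochner_Integration.integral_diff[symmetric]) (auto intro!: integrable_indicator_times q)
  also have "\<dots> = (\<integral>s. indicator {t - \<delta>..t} s * Q x s \<partial>lborel)"
  proof (rule integral_cong_AE)
    show "AE s in lborel. indicator {0..t} s * Q x s - indicator {0..t - \<delta>} s * Q x s = indicator {t - \<delta>..t} s * Q x s"
      using AE_lborel_singleton[of "t - \<delta>"]
      by eventually_elim (use \<open>\<delta> > 0\<close> Q_eq_0[of x] in \<open>auto simp: indicator_def\<close>)
  qed auto
  also have "\<dots> = (\<integral>s. indicator {t - \<delta>..t} (t - s) * Q x (t - s) \<partial>lborel)"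
    using lborel_integral_real_affine[of "-1" "\<lambda>s. indicator {t - \<delta>..t} s * Q x s" t] by simp
  also have "\<dots> = (\<integral>s. indicator {0..\<delta>} s * Q x (t - s) \<partial>lborel)"
    by (rule Bochner_Integration.integral_cong) (auto simp: indicator_def)
  finally show ?thesis .
qed

lemma Q_integrable_time: "AE x in lborel. integrable lborel (Q x)"
  using lborel_pair.AE_integrable_fst[of Q] Q_integrable by (simp add: case_prod_unfold)

lemma E_increment:
  assumes "\<delta> > 0"
  shows "AE t in lborel. t \<le> T \<longrightarrow> E t - E (t - \<delta>) =
    (\<integral>x. (\<integral>s. indicator {0..\<delta>} s * Q x (t - s) \<partial>lborel) * (W x t + W x (t - \<delta>)) \<partial>lborel)"
  \<comment> \<open>Both t and t - \<delta> have to avoid the exceptional null set, hence its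
    translate.\<close>
  using motion_whole_line AE_lborel_translation[OF motion_whole_line, of "- \<delta>"]
proof eventually_elim
  case (elim t)
  show ?case
  proof
    assume "t \<le> T"
    then have ae: "AE x in lborel. moment \<rho> x t = P x t" "AE x in lborel. moment \<rho> x (t - \<delta>) = P x (t - \<delta>)"
      using elim assms by auto
    show "E t - E (t - \<delta>) =
      (\<integral>x. (\<integral>s. indicator {0..\<delta>} s * Q x (t - s) \<partial>lborel) * (W x t + W x (t - \<delta>)) \<partial>lborel)"
      unfolding E_diff
    proof (rule integral_cong_AE)
      show "AE x in lborel. (moment \<rho> x t - moment \<rho> x (t - \<delta>)) * (W x t + W x (t - \<delta>))
         = (\<integral>s. indicator {0..\<delta>} s * Q x (t - s) \<partial>lborel) * (W x t + W x (t - \<delta>))"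
        using ae Q_integrable_time by eventually_elim (simp add: P_diff[OF _ assms])
    qed measurable
  qed
qed

text \<open>Integrating E(t) - E(t - \<delta>) over t \<le> \<tau> leaves the integral of
  \<open>E\<close> over the last window of length \<delta>, an increment of \<open>J\<close>. Thus
  an identity for almost every t becomes a statement for every \<tau>.\<close>

definition J :: "real \<Rightarrow> real" where "J \<tau> = (\<integral>t. indicator {..\<tau>} t * E t \<partial>lborel)"

text \<open>Formally E' = 2 (Q, W), so that \<Phi> would equal \<open>E\<close>.\<close>

definition \<Phi> :: "real \<Rightarrow> real" where
  "\<Phi> \<tau> = 2 * (\<integral>z. indicator {..\<tau>} (snd z) * (Q (fst z) (snd z) * W (fst z) (snd z)) \<partial>lborel)"

lemma J_diff: "J \<tau> - J (\<tau> - \<delta>) = (\<integral>t. indicator {..\<tau>} t * (E t - E (t - \<delta>)) \<partial>lborel)"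
proof -
  have i: "integrable lborel (\<lambda>t. indicator {..\<tau>} t * E t)"
    by (rule integrable_indicator_times[OF E_integrable]) simp
  have "integrable lborel (\<lambda>t. E (t + (- \<delta>)))" by (rule integrable_lborel_translation[OF E_integrable])
  then have i': "integrable lborel (\<lambda>t. indicator {..\<tau>} t * E (t - \<delta>))"
    by (intro integrable_indicator_times) auto
  have "J (\<tau> - \<delta>) = (\<integral>t. indicator {..\<tau> - \<delta>} (t + (- \<delta>)) * E (t + (- \<delta>)) \<partial>lborel)"
    unfolding J_def by (rule integral_lborel_translation[symmetric]) measurable
  also have "\<dots> = (\<integral>t. indicator {..\<tau>} t * E (t - \<delta>) \<partial>lborel)"
    by (rule Bochner_Integration.integral_cong) (auto simp: indicator_def)
  finally show ?thesis using i i' by (simp add: J_def right_diff_distrib)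
qed

text \<open>A product of two square integrable functions of (s, z): the indicator of [0, \<delta>]
  is given to both factors, and by translation invariance every s in [0, \<delta>] contributes the
  same norm of \<open>Q\<close>.\<close>

lemma increment_integrable:
  assumes "\<delta> > 0"
  shows "integrable (lborel \<Otimes>\<^sub>M (lborel :: (real \<times> real) measure))
    (\<lambda>(s, z). indicator {0..\<delta>} s * (indicator {..\<tau>} (snd z) *
      (Q (fst z) (snd z - s) * (W (fst z) (snd z) + W (fst z) (snd z - \<delta>)))))"
proof -
  let ?M = "lborel \<Otimes>\<^sub>M (lborel :: (real \<times> real) measure)"
  have sets: "sets ?M = sets (borel \<Otimes>\<^sub>M (borel \<Otimes>\<^sub>M borel))"
    by (rule sets_pair_measure_cong) (simp_all only: sets_lborel borel_prod)
  let ?V = "\<lambda>z. W (fst z) (snd z) + W (fst z) (snd z - \<delta>)"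
  have Wz: "integrable lborel (\<lambda>z. (W (fst z) (snd z))\<^sup>2)"
    using W_square by (simp add: lborel_prod case_prod_unfold)
  have [measurable]: "(\<lambda>z. W (fst z) (snd z)) \<in> borel_measurable borel"
    "(\<lambda>z. W (fst z) (snd z - \<delta>)) \<in> borel_measurable borel"
    unfolding borel_prod[symmetric] by measurable
  have V: "integrable lborel (\<lambda>z. (?V z)\<^sup>2)"
    by (rule integrable_add_square) (use Wz translation_time_square_integrable[OF W_square] in auto)
  have "integrable ?M (\<lambda>z. (indicator {0..\<delta>} (fst z) * Q (fst (snd z)) (snd (snd z) - fst z))
        * (indicator {0..\<delta>} (fst z) * (indicator {..\<tau>} (snd (snd z)) * ?V (snd z))))"
  proof (rule integrable_mult_of_squares)
    show "(\<lambda>z. indicator {0..\<delta>} (fst z) * Q (fst (snd z)) (snd (snd z) - fst z)) \<in> borel_measurable ?M"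
      unfolding measurable_cong_sets[OF sets refl] by measurable
    show "(\<lambda>z. indicator {0..\<delta>} (fst z) * (indicator {..\<tau>} (snd (snd z)) * ?V (snd z))) \<in> borel_measurable ?M"
      unfolding measurable_cong_sets[OF sets refl] by measurable
    show "integrable ?M (\<lambda>z. (indicator {0..\<delta>} (fst z) * Q (fst (snd z)) (snd (snd z) - fst z))\<^sup>2)"
    proof (rule lborel_pair.Fubini_integrable)
      show "(\<lambda>z. (indicator {0..\<delta>} (fst z) * Q (fst (snd z)) (snd (snd z) - fst z))\<^sup>2) \<in> borel_measurable ?M"
        unfolding measurable_cong_sets[OF sets refl] by measurable
      have "(\<integral>y. norm ((indicator {0..\<delta>} (fst (x, y)) * Q (fst (snd (x, y))) (snd (snd (x, y)) - fst (x, y)))\<^sup>2) \<partial>lborel)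
          = (indicator {0..\<delta>} x) * (\<integral>z. (Q (fst z) (snd z))\<^sup>2 \<partial>lborel)" for x
        using translation_time_square_integral[OF Q_measurable, of x]
        by (cases "x \<in> {0..\<delta>}") (auto simp: power_mult_distrib)
      then show "integrable lborel (\<lambda>x. \<integral>y. norm ((indicator {0..\<delta>} (fst (x, y)) * Q (fst (snd (x, y))) (snd (snd (x, y)) - fst (x, y)))\<^sup>2) \<partial>lborel)"
        by simp
      show "AE x in lborel. integrable lborel (\<lambda>y. (indicator {0..\<delta>} (fst (x, y)) * Q (fst (snd (x, y))) (snd (snd (x, y)) - fst (x, y)))\<^sup>2)"
        using translation_time_square_integrable[OF Q_square_integrable]
        by (auto simp: power_mult_distrib intro!: AE_I2)
    qed
    show "integrable ?M (\<lambda>z. (indicator {0..\<delta>} (fst z) * (indicator {..\<tau>} (snd (snd z)) * ?V (snd z)))\<^sup>2)"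
    proof (rule Bochner_Integration.integrable_bound)
      show "integrable ?M (\<lambda>z. indicator {0..\<delta>} (fst z) * (?V (snd z))\<^sup>2)"
      proof (rule lborel_pair.Fubini_integrable)
        show "(\<lambda>z. indicator {0..\<delta>} (fst z) * (?V (snd z))\<^sup>2) \<in> borel_measurable ?M"
          unfolding measurable_cong_sets[OF sets refl] by measurable
      qed (use V in \<open>simp_all add: abs_mult\<close>)
      show "(\<lambda>z. (indicator {0..\<delta>} (fst z) * (indicator {..\<tau>} (snd (snd z)) * ?V (snd z)))\<^sup>2) \<in> borel_measurable ?M"
        unfolding measurable_cong_sets[OF sets refl] by measurable
    qed (auto simp: indicator_def intro!: AE_I2)
  qed
  then show ?thesis
    by (rule Bochner_Integration.integrable_cong[THEN iffD1, OF refl, rotated])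
       (auto simp: indicator_def split: prod.splits)
qed

text \<open>Fubini moves the shift s to the outside; for fixed s the inner integral is a correlation
  of translates of \<open>Q\<close> and \<open>W\<close> on the plane.\<close>

lemma J_increment:
  assumes "\<delta> > 0" "\<tau> \<le> T"
  shows "J \<tau> - J (\<tau> - \<delta>) = (\<integral>s. indicator {0..\<delta>} s * (\<integral>z. indicator {..\<tau>} (snd z) *
      (Q (fst z) (snd z - s) * (W (fst z) (snd z) + W (fst z) (snd z - \<delta>))) \<partial>lborel) \<partial>lborel)"
proof -
  let ?V = "\<lambda>z. W (fst z) (snd z) + W (fst z) (snd z - \<delta>)"
  let ?G = "\<lambda>s z. indicator {0..\<delta>} s * (indicator {..\<tau>} (snd z) * (Q (fst z) (snd z - s) * ?V z))"
  let ?R = "\<lambda>x t. indicator {..\<tau>} t * ((\<integral>s. indicator {0..\<delta>} s * Q x (t - s) \<partial>lborel) * (W x t + W x (t - \<delta>)))"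
  note G = increment_integrable[OF assms(1), of \<tau>]
  have sG: "(\<integral>s. ?G s z \<partial>lborel) = ?R (fst z) (snd z)" for z
  proof -
    have "(\<integral>s. ?G s z \<partial>lborel) = (\<integral>s. (indicator {..\<tau>} (snd z) * ?V z) * (indicator {0..\<delta>} s * Q (fst z) (snd z - s)) \<partial>lborel)"
      by (rule Bochner_Integration.integral_cong) auto
    also have "\<dots> = (indicator {..\<tau>} (snd z) * ?V z) * (\<integral>s. indicator {0..\<delta>} s * Q (fst z) (snd z - s) \<partial>lborel)"
      by (rule integral_mult_right_zero)
    finally show ?thesis by simp
  qed
  have R: "integrable (lborel \<Otimes>\<^sub>M lborel) (\<lambda>(x, t). ?R x t)"
    using lborel_pair.integrable_snd[OF G] unfolding sG lborel_prod case_prod_unfold .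
  have "J \<tau> - J (\<tau> - \<delta>) = (\<integral>t. indicator {..\<tau>} t * (E t - E (t - \<delta>)) \<partial>lborel)" by (rule J_diff)
  also have "\<dots> = (\<integral>t. (\<integral>x. ?R x t \<partial>lborel) \<partial>lborel)"
  proof (rule integral_cong_AE)
    show "AE t in lborel. indicator {..\<tau>} t * (E t - E (t - \<delta>)) = (\<integral>x. ?R x t \<partial>lborel)"
      using E_increment[OF assms(1)] by eventually_elim (use assms(2) in \<open>auto simp: indicator_def\<close>)
  qed measurable
  also have "\<dots> = (\<integral>z. ?R (fst z) (snd z) \<partial>lborel)"
    using lborel_pair.integral_snd[OF R] by (simp add: lborel_prod case_prod_unfold)
  also have "\<dots> = (\<integral>z. (\<integral>s. ?G s z \<partial>lborel) \<partial>lborel)" unfolding sG ..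
  also have "\<dots> = (\<integral>s. (\<integral>z. ?G s z \<partial>lborel) \<partial>lborel)"
    by (rule lborel_pair.Fubini_integral[OF G])
  finally show ?thesis by simp
qed

text \<open>Each s in [0, \<delta>] contributes a value within \<epsilon> of \<Phi> \<tau>, and
  integrating over s gives the factor \<delta>. The threshold serves all \<tau> at once.\<close>

lemma J_increment_approx:
  assumes "\<epsilon> > 0"
  obtains \<delta>0 where "\<delta>0 > 0"
    "\<And>\<delta> \<tau>. 0 < \<delta> \<Longrightarrow> \<delta> < \<delta>0 \<Longrightarrow> \<tau> \<le> T \<Longrightarrow> \<bar>J \<tau> - J (\<tau> - \<delta>) - \<delta> * \<Phi> \<tau>\<bar> \<le> \<delta> * \<epsilon>"
proof -
  let ?Q = "\<lambda>z. Q (fst z) (snd z)" and ?W = "\<lambda>z. W (fst z) (snd z)"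
  have [measurable]: "?Q \<in> borel_measurable borel" "?W \<in> borel_measurable borel"
    unfolding borel_prod[symmetric] by measurable
  have Q2: "integrable lborel (\<lambda>z. (?Q z)\<^sup>2)" and W2: "integrable lborel (\<lambda>z. (?W z)\<^sup>2)"
    using Q_square_integrable W_square by (simp_all add: lborel_prod case_prod_unfold)
  \<comment> \<open>One half for each of the two correlations, with \<open>W\<close> at t and at t -
    \<delta>.\<close>
  have "\<epsilon> / 2 > 0" using assms by simp
  from translation_correlation_uniform[OF _ _ Q2 W2 this] obtain \<delta>0 where \<delta>0: "\<delta>0 > 0"
    and corr: "\<And>a b \<phi>. norm a < \<delta>0 \<Longrightarrow> norm b < \<delta>0 \<Longrightarrow> \<phi> \<in> borel_measurable borel \<Longrightarrow> (\<And>z. \<bar>\<phi> z\<bar> \<le> 1) \<Longrightarrow>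
       \<bar>(\<integral>z. \<phi> z * (?Q (z + a) * ?W (z + b)) \<partial>lborel) - (\<integral>z. \<phi> z * (?Q z * ?W z) \<partial>lborel)\<bar> \<le> \<epsilon> / 2"
    by (auto simp: measurable_lborel1)
  show ?thesis
  proof (rule that[OF \<delta>0])
    fix \<delta> \<tau> assume \<delta>: "0 < \<delta>" "\<delta> < \<delta>0" and \<tau>: "\<tau> \<le> T"
    define \<phi> :: "real \<times> real \<Rightarrow> real" where "\<phi> z = indicator {..\<tau>} (snd z)" for z
    have [measurable]: "\<phi> \<in> borel_measurable borel"
      unfolding \<phi>_def borel_prod[symmetric] by measurable
    have \<phi>1: "\<bar>\<phi> z\<bar> \<le> 1" for z by (simp add: \<phi>_def)
    define I where "I s = (\<integral>z. \<phi> z * (Q (fst z) (snd z - s) * (W (fst z) (snd z) + W (fst z) (snd z - \<delta>))) \<partial>lborel)" for s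
    have I: "\<bar>I s - \<Phi> \<tau>\<bar> \<le> \<epsilon>" if s: "s \<in> {0..\<delta>}" for s
    proof -
      have i: "integrable lborel (\<lambda>z. \<phi> z * (Q (fst z) (snd z - s) * W (fst z) (snd z - a)))" for a
      proof -
        have [measurable]: "(\<lambda>z. Q (fst z) (snd z - s)) \<in> borel_measurable borel" "(\<lambda>z. W (fst z) (snd z - a)) \<in> borel_measurable borel"
          unfolding borel_prod[symmetric] by measurable
        have "integrable lborel (\<lambda>z. Q (fst z) (snd z - s) * W (fst z) (snd z - a))"
          by (rule integrable_mult_of_squares)
             (use translation_time_square_integrable[OF Q_square_integrable] translation_time_square_integrable[OF W_square] in auto)
        then show ?thesis
          by (rule Bochner_Integration.integrable_bound) (use \<phi>1 in \<open>auto simp: abs_mult mult_left_le_one_le\<close>)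
      qed
      have "I s = (\<integral>z. \<phi> z * (Q (fst z) (snd z - s) * W (fst z) (snd z - 0)) + \<phi> z * (Q (fst z) (snd z - s) * W (fst z) (snd z - \<delta>)) \<partial>lborel)"
        unfolding I_def by (simp add: distrib_left)
      also have "\<dots> = (\<integral>z. \<phi> z * (Q (fst z) (snd z - s) * W (fst z) (snd z - 0)) \<partial>lborel) + (\<integral>z. \<phi> z * (Q (fst z) (snd z - s) * W (fst z) (snd z - \<delta>)) \<partial>lborel)"
        by (rule Bochner_Integration.integral_add[OF i i])
      finally have Is: "I s = \<dots>" .
      have n: "norm (0 :: real, - s) < \<delta>0" "norm (0 :: real, - \<delta>) < \<delta>0" "norm (0 :: real, 0 :: real) < \<delta>0"
        using s \<delta> \<delta>0 by (auto simp: norm_Pair)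
      have Ph: "\<Phi> \<tau> = (\<integral>z. \<phi> z * (?Q z * ?W z) \<partial>lborel) + (\<integral>z. \<phi> z * (?Q z * ?W z) \<partial>lborel)"
        by (simp add: \<Phi>_def \<phi>_def)
      show ?thesis
        using corr[OF n(1) n(3) \<open>\<phi> \<in> borel_measurable borel\<close> \<phi>1]
          corr[OF n(1) n(2) \<open>\<phi> \<in> borel_measurable borel\<close> \<phi>1]
        unfolding Is Ph fst_add snd_add fst_conv snd_conv add_0_right diff_0_right minus_add_distrib diff_conv_add_uminus minus_zero
        by linarith
    qed
    have JI: "J \<tau> - J (\<tau> - \<delta>) = (\<integral>s. indicator {0..\<delta>} s * I s \<partial>lborel)"
      unfolding J_increment[OF \<delta>(1) \<tau>] I_def \<phi>_def ..
    have iI: "integrable lborel (\<lambda>s. indicator {0..\<delta>} s * I s)"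
      using lborel_pair.integrable_fst[OF increment_integrable[OF \<delta>(1), of \<tau>]] by (simp add: I_def \<phi>_def)
    have "\<bar>J \<tau> - J (\<tau> - \<delta>) - \<delta> * \<Phi> \<tau>\<bar> = \<bar>\<integral>s. indicator {0..\<delta>} s * I s - indicator {0..\<delta>} s * \<Phi> \<tau> \<partial>lborel\<bar>"
      unfolding JI using iI \<delta> by (subst Bochner_Integration.integral_diff) auto
    also have "\<dots> \<le> (\<integral>s. \<bar>indicator {0..\<delta>} s * I s - indicator {0..\<delta>} s * \<Phi> \<tau>\<bar> \<partial>lborel)"
      by (rule integral_abs_bound)
    also have "\<dots> \<le> (\<integral>s. indicator {0..\<delta>} s * \<epsilon> \<partial>lborel)"
    proof (rule integral_mono)
      show "\<bar>indicator {0..\<delta>} s * I s - indicator {0..\<delta>} s * \<Phi> \<tau>\<bar> \<le> indicator {0..\<delta>} s * \<epsilon>" for s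
        using I[of s] by (cases "s \<in> {0..\<delta>}") auto
    qed (use iI in auto)
    also have "\<dots> = \<delta> * \<epsilon>" using \<delta> by simp
    finally show "\<bar>J \<tau> - J (\<tau> - \<delta>) - \<delta> * \<Phi> \<tau>\<bar> \<le> \<delta> * \<epsilon>" .
  qed
qed

lemma J_mono: "\<sigma> \<le> \<tau> \<Longrightarrow> J \<sigma> \<le> J \<tau>"
  unfolding J_def
  by (rule integral_mono[OF integrable_indicator_times integrable_indicator_times])
     (auto simp: E_integrable E_nonneg indicator_def)

lemma \<Phi>_nonneg:
  assumes "\<tau> \<le> T"
  shows "0 \<le> \<Phi> \<tau>"
proof (rule ccontr)
  assume "\<not> 0 \<le> \<Phi> \<tau>"
  \<comment> \<open>With half of the gap as tolerance, J would drop by at least \<delta> |\<Phi>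
    \<tau>| / 2 over the last window, although it is nondecreasing.\<close>
  then have "- \<Phi> \<tau> / 2 > 0" by simp
  from J_increment_approx[OF this] obtain \<delta>0 where \<delta>0: "\<delta>0 > 0"
    "\<And>\<delta> \<tau>'. 0 < \<delta> \<Longrightarrow> \<delta> < \<delta>0 \<Longrightarrow> \<tau>' \<le> T \<Longrightarrow> \<bar>J \<tau>' - J (\<tau>' - \<delta>) - \<delta> * \<Phi> \<tau>'\<bar> \<le> \<delta> * (- \<Phi> \<tau> / 2)"
    by metis
  define \<delta> where "\<delta> = \<delta>0 / 2"
  have "\<delta> > 0" "\<delta> < \<delta>0" using \<delta>0 by (auto simp: \<delta>_def)
  from \<delta>0(2)[OF this assms] have "J \<tau> - J (\<tau> - \<delta>) \<le> \<delta> * \<Phi> \<tau> / 2" by simp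
  moreover have "\<delta> * \<Phi> \<tau> < 0" using \<open>\<delta> > 0\<close> \<open>\<not> 0 \<le> \<Phi> \<tau>\<close> by (simp add: mult_pos_neg)
  ultimately show False using J_mono[of "\<tau> - \<delta>" \<tau>] \<open>\<delta> > 0\<close> by linarith
qed

lemma J_0: "J 0 = 0"
proof -
  have "J 0 = (\<integral>t. 0 \<partial>(lborel :: real measure))"
    unfolding J_def
  proof (rule integral_cong_AE)
    show "AE t in lborel. indicator {..0} t * E t = 0"
      using AE_lborel_singleton[of 0] by eventually_elim (auto simp: indicator_def E_eq_0)
  qed auto
  then show ?thesis by simp
qed

lemma J_T: "J T = (\<integral>t. E t \<partial>lborel)"
  unfolding J_def by (rule Bochner_Integration.integral_cong) (auto simp: indicator_def E_eq_0)

text \<open>Summing the increments of \<open>J\<close> over a uniform partition, using \<open>\<delta> exp (\<tau> - \<delta>) \<le> exp \<tau> - exp (\<tau> - \<delta>)\<close>.\<close>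

lemma J_T_le:
  assumes \<Phi>: "\<And>\<tau>. \<tau> \<in> {0..T} \<Longrightarrow> \<Phi> \<tau> \<le> B * exp \<tau>" and B: "B \<ge> 0"
  shows "J T \<le> B * (exp T - 1)"
proof (rule field_le_epsilon)
  fix e :: real assume "e > 0"
  define K where "K = B * (exp T - 1)"
  have K: "K \<ge> 0" using B T_pos by (simp add: K_def)
  \<comment> \<open>A tolerance per unit of time: n steps of length T / n add up to e/2.\<close>
  have "e / (2 * T) > 0" using \<open>e > 0\<close> T_pos by simp
  from J_increment_approx[OF this] obtain \<delta>0 where \<delta>0: "\<delta>0 > 0"
    "\<And>\<delta> \<tau>. 0 < \<delta> \<Longrightarrow> \<delta> < \<delta>0 \<Longrightarrow> \<tau> \<le> T \<Longrightarrow> \<bar>J \<tau> - J (\<tau> - \<delta>) - \<delta> * \<Phi> \<tau>\<bar> \<le> \<delta> * (e / (2 * T))"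
    by metis
  \<comment> \<open>Each increment is bounded by \<Phi> at the right endpoint, which costs a factor
    exp \<delta> against the integral of B exp; a small \<delta> keeps this cost below e/2.\<close>
  have "((\<lambda>\<delta>. exp \<delta> * K) \<longlongrightarrow> exp 0 * K) (at_right 0)" by (intro tendsto_intros)
  then have "eventually (\<lambda>\<delta>. exp \<delta> * K < K + e / 2) (at_right 0)"
    using \<open>e > 0\<close> by (intro order_tendstoD(2)) auto
  then obtain \<delta>1 where \<delta>1: "\<delta>1 > 0" "\<And>\<delta>. 0 < \<delta> \<Longrightarrow> \<delta> < \<delta>1 \<Longrightarrow> exp \<delta> * K < K + e / 2"
    unfolding eventually_at_right_field by auto
  obtain n :: nat where n: "T / min \<delta>0 \<delta>1 < real n" using reals_Archimedean2 by blast
  have n0: "n > 0" using n T_pos \<delta>0 \<delta>1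
    by (metis divide_pos_pos gr0I less_asym min_less_iff_conj of_nat_0)
  define \<delta> where "\<delta> = T / real n"
  have \<delta>: "\<delta> > 0" "\<delta> < min \<delta>0 \<delta>1"
    using n n0 T_pos \<delta>0(1) \<delta>1(1) by (auto simp: \<delta>_def field_simps min_def split: if_splits)
  have step: "J (\<delta> * real i) \<le> exp \<delta> * (B * (exp (\<delta> * real i) - 1)) + real i * (\<delta> * (e / (2 * T)))" if "i \<le> n" for i
    using that
  proof (induction i)
    case 0
    then show ?case by (simp add: J_0)
  next
    case (Suc i)
    let ?\<tau> = "\<delta> * real (Suc i)"
    have "?\<tau> \<le> \<delta> * real n" using Suc.prems \<delta> by (intro mult_left_mono) auto
    then have "?\<tau> \<le> T" using n0 by (simp add: \<delta>_def)
    moreover have "0 \<le> ?\<tau>" using \<delta>(1) by simp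
    ultimately have \<tau>: "?\<tau> \<in> {0..T}" by simp
    have prev: "?\<tau> - \<delta> = \<delta> * real i" by (simp add: algebra_simps)
    have "J ?\<tau> - J (\<delta> * real i) \<le> \<delta> * \<Phi> ?\<tau> + \<delta> * (e / (2 * T))"
      using \<delta>0(2)[of \<delta> ?\<tau>] \<delta> \<tau> unfolding prev by auto
    also have "\<delta> * \<Phi> ?\<tau> \<le> \<delta> * (B * exp ?\<tau>)" using \<Phi>[OF \<tau>] \<delta> by (intro mult_left_mono) auto
    also have "\<delta> * (B * exp ?\<tau>) \<le> exp \<delta> * (B * (exp ?\<tau> - exp (\<delta> * real i)))"
    proof -
      have ex: "exp ?\<tau> = exp \<delta> * exp (\<delta> * real i)" by (simp add: exp_add[symmetric] algebra_simps)
      have "\<delta> * exp (\<delta> * real i) \<le> (exp \<delta> - 1) * exp (\<delta> * real i)"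
        by (rule mult_right_mono) (use exp_ge_add_one_self[of \<delta>] in linarith, simp)
      then have "(B * exp \<delta>) * (\<delta> * exp (\<delta> * real i)) \<le> (B * exp \<delta>) * ((exp \<delta> - 1) * exp (\<delta> * real i))"
        using B by (intro mult_left_mono) auto
      then show ?thesis unfolding ex by (simp add: algebra_simps)
    qed
    finally have "J ?\<tau> \<le> J (\<delta> * real i) + exp \<delta> * (B * (exp ?\<tau> - exp (\<delta> * real i))) + \<delta> * (e / (2 * T))" by simp
    also have "J (\<delta> * real i) \<le> exp \<delta> * (B * (exp (\<delta> * real i) - 1)) + real i * (\<delta> * (e / (2 * T)))"
      using Suc by simp
    finally show ?case by (simp add: algebra_simps add_divide_distrib)
  qed
  have dn: "\<delta> * real n = T" using n0 by (simp add: \<delta>_def)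
  have "J T \<le> exp \<delta> * K + real n * (\<delta> * (e / (2 * T)))" using step[of n] unfolding dn K_def by simp
  also have "real n * (\<delta> * (e / (2 * T))) = e / 2"
    using n0 T_pos by (simp add: \<delta>_def)
  also have "exp \<delta> * K + e / 2 \<le> K + e" using \<delta>1(2)[of \<delta>] \<delta> by auto
  finally show "J T \<le> B * (exp T - 1) + e" by (simp add: K_def)
qed

end

section \<open>The a priori estimate\<close>

text \<open>The weights are meant for \<epsilon> = r0: the boundary term uses up half of r0 U^2, and
  the interior term receives the same factor r0 / 2, so that Gronwall's inequality has rate 1 after
  division.\<close>

lemma Young_scaled:
  fixes a b \<epsilon> :: real
  assumes "\<epsilon> > 0"
  shows "2 * a * b \<le> \<epsilon> / 2 * b\<^sup>2 + 2 / \<epsilon> * a\<^sup>2"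
proof -
  have "0 \<le> (2 / \<epsilon>) * (a - \<epsilon> / 2 * b)\<^sup>2" using assms by simp
  also have "\<dots> = \<epsilon> / 2 * b\<^sup>2 + 2 / \<epsilon> * a\<^sup>2 - 2 * a * b"
    using assms by (simp add: power2_eq_square field_simps)
  finally show ?thesis by simp
qed

context beam
begin

definition y :: "real \<Rightarrow> real" where "y t = (\<integral>x. (U x t)\<^sup>2 \<partial>lborel)"

definition G :: real where "G = (\<integral>t. (d t)\<^sup>2 \<partial>lborel)"

text \<open>This is C_0^2 (1 + C_\<theta>^2) times the squared norm of g'. The factor 4 / r0^2 is
  the 2 / r0 of Young's inequality divided by the coefficient r0 / 2 of \<open>y\<close>.\<close>

definition A :: real where "A = 4 / r0\<^sup>2 * ((1 + c\<^sup>2) * (l + l ^ 3 / 3)) * (1 + T) * G"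

text \<open>\<open>y\<close> is constant after T, so the inner indicator provides the function
  integrable on the line that \<open>Gronwall_primitive\<close> expects.\<close>

definition Y :: "real \<Rightarrow> real" where "Y \<tau> = (\<integral>t. indicator {0..\<tau>} t * (indicator {0..T} t * y t) \<partial>lborel)"

definition Z :: "real \<Rightarrow> real" where
  "Z \<tau> = (\<integral>x. (\<integral>t. indicator {0..\<tau>} t * (W x t)\<^sup>2 \<partial>lborel) \<partial>lborel)"

lemma y_measurable [measurable]: "y \<in> borel_measurable borel" unfolding y_def by measurable

lemma G_nonneg: "0 \<le> G" by (simp add: G_def)

lemma A_nonneg: "0 \<le> A" using l_pos T_pos G_nonneg by (simp add: A_def)

lemma load_integral_le:
  "(\<integral>x. indicator {0..l} x * (c + l - x)\<^sup>2 \<partial>lborel) \<le> (1 + c\<^sup>2) * (l + l ^ 3 / 3)"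
proof -
  have "(\<integral>x. (c + l - x)\<^sup>2 * indicator {0..l} x \<partial>lborel) = (- ((c + l - l) ^ 3 / 3)) - (- ((c + l - 0) ^ 3 / 3))"
    by (rule integral_FTC_Icc_real) (use l_pos in \<open>auto intro!: derivative_eq_intros simp: power2_eq_square\<close>)
  also have "\<dots> = c\<^sup>2 * l + c * l\<^sup>2 + l ^ 3 / 3"
    by (simp add: power2_eq_square power3_eq_cube field_simps)
  also have "\<dots> \<le> (1 + c\<^sup>2) * (l + l ^ 3 / 3)"
  proof -
    \<comment> \<open>The gap between the two sides is l (1 - c l + c^2 l^2 / 3); completing the
      square makes its sign visible whatever the sign of c.\<close>
    have "0 \<le> l * ((1 - c * l / 2)\<^sup>2 + (c * l)\<^sup>2 / 12)" using l_pos by simp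
    also have "\<dots> = (1 + c\<^sup>2) * (l + l ^ 3 / 3) - (c\<^sup>2 * l + c * l\<^sup>2 + l ^ 3 / 3)"
      by (simp add: power2_eq_square power3_eq_cube field_simps)
    finally show ?thesis by simp
  qed
  finally show ?thesis by (simp add: mult.commute)
qed

lemma D_square_le: "(D t)\<^sup>2 \<le> T * G"
proof -
  have sq: "integrable lborel (\<lambda>s. (indicator ({0..t} \<inter> {0..T}) s :: real)\<^sup>2)"
    by (simp add: power2_eq_square flip: indicator_inter_arith)
  have "D t = (\<integral>s. indicator ({0..t} \<inter> {0..T}) s * d s \<partial>lborel)"
    unfolding D_def by (rule Bochner_Integration.integral_cong) (auto simp: indicator_def d_support)
  also have "\<dots>\<^sup>2 \<le> (\<integral>s. (indicator ({0..t} \<inter> {0..T}) s)\<^sup>2 \<partial>lborel) * (\<integral>s. (d s)\<^sup>2 \<partial>lborel)"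
    by (rule Cauchy_Schwarz_integral) (use sq d_square in auto)
  also have "\<dots> \<le> T * G"
    unfolding G_def
  proof (rule mult_right_mono)
    have "(\<integral>s. (indicator ({0..t} \<inter> {0..T}) s)\<^sup>2 \<partial>lborel) \<le> (\<integral>s. (indicator {0..T} s :: real) \<partial>lborel)"
      by (rule integral_mono[OF sq integrable_indicator_Icc]) (auto simp: indicator_def)
    also have "\<dots> = T" using T_pos by simp
    finally show "(\<integral>s. (indicator ({0..t} \<inter> {0..T}) s)\<^sup>2 \<partial>lborel) \<le> T" .
  qed simp
  finally show ?thesis .
qed

definition B :: "real \<Rightarrow> real" where "B x = sqrt (T * (\<integral>s. (W x s)\<^sup>2 \<partial>lborel))"

lemma abs_U_le: "\<bar>U x t\<bar> \<le> B x"
  using U_square_le[of x t] by (simp add: B_def real_le_rsqrt)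

lemma W_square_integral_integrable: "integrable lborel (\<lambda>x. \<integral>t. (W x t)\<^sup>2 \<partial>lborel)"
  by (rule lborel_pair.integrable_fst) (use W_square in simp)

lemma U_square_integrable_space: "integrable lborel (\<lambda>x. (U x t)\<^sup>2)"
  by (rule integrable_of_abs_bound[where g="\<lambda>x. T * (\<integral>s. (W x s)\<^sup>2 \<partial>lborel)"])
     (use W_square_integral_integrable U_square_le in auto)

lemma mult_U_integrable_time:
  assumes a: "integrable lborel a"
  shows "integrable lborel (\<lambda>t. a t * U x t)"
proof (rule integrable_of_abs_bound)
  have [measurable]: "a \<in> borel_measurable borel" using a by auto
  show "integrable lborel (\<lambda>t. B x * \<bar>a t\<bar>)" using a by simp
  show "\<bar>a t * U x t\<bar> \<le> B x * \<bar>a t\<bar>" for t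
    using mult_right_mono[OF abs_U_le[of x t] abs_ge_zero[of "a t"]] by (simp add: abs_mult mult.commute)
  show "(\<lambda>t. a t * U x t) \<in> borel_measurable lborel" by measurable
qed

lemma D_mult_integrable_time:
  assumes a: "integrable lborel a"
  shows "integrable lborel (\<lambda>t. D t * a t)"
proof (rule integrable_of_abs_bound)
  have [measurable]: "a \<in> borel_measurable borel" using a by auto
  show "integrable lborel (\<lambda>t. (\<integral>s. \<bar>d s\<bar> \<partial>lborel) * \<bar>a t\<bar>)" using a by simp
  show "\<bar>D t * a t\<bar> \<le> (\<integral>s. \<bar>d s\<bar> \<partial>lborel) * \<bar>a t\<bar>" for t
    using mult_right_mono[OF abs_D_le[of t] abs_ge_zero[of "a t"]] by (simp add: abs_mult)
  show "(\<lambda>t. D t * a t) \<in> borel_measurable lborel" by measurable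
qed

lemma U_square_integrable_time: "integrable lborel (\<lambda>t. indicator {0..\<tau>} t * (U x t)\<^sup>2)"
proof (rule integrable_of_abs_bound)
  show "integrable lborel (\<lambda>t. indicator {0..\<tau>} t * (T * (\<integral>s. (W x s)\<^sup>2 \<partial>lborel)))" by simp
  show "\<bar>indicator {0..\<tau>} t * (U x t)\<^sup>2\<bar> \<le> indicator {0..\<tau>} t * (T * (\<integral>s. (W x s)\<^sup>2 \<partial>lborel))" for t
    using U_square_le[of x t] by (simp add: indicator_def)
qed measurable

text \<open>At fixed x the coefficients are constants and W = U_t. So r U W integrates to r U^2 / 2,
  and the load term is integrated by parts to remove W from it, which keeps the whole dissipation
  \<kappa> W^2. There are no contributions from t = 0, as \<open>D\<close> and \<open>U\<close> are
  primitives from 0.\<close>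

lemma section_bound:
  assumes \<tau>: "\<tau> \<in> {0..T}"
  shows "2 * (\<integral>t. indicator {0..\<tau>} t * ((D t * (c + l - x) - r x * U x t - \<kappa> x * W x t) * W x t) \<partial>lborel)
    \<le> 2 / r0 * ((1 + T) * G) * (c + l - x)\<^sup>2 - r0 / 2 * (U x \<tau>)\<^sup>2
       + r0 / 2 * (\<integral>t. indicator {0..\<tau>} t * (U x t)\<^sup>2 \<partial>lborel)
       - 2 * \<kappa>0 * (\<integral>t. indicator {0..\<tau>} t * (W x t)\<^sup>2 \<partial>lborel)"
proof -
  let ?q = "c + l - x" and ?i = "indicator {0..\<tau>} :: real \<Rightarrow> real"
  note W = W_integrable_time[of x]
  have iDW: "integrable lborel (\<lambda>t. ?i t * (D t * W x t))"
    by (intro integrable_indicator_times D_mult_integrable_time W) simp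
  have iWU: "integrable lborel (\<lambda>t. ?i t * (W x t * U x t))"
    by (intro integrable_indicator_times mult_U_integrable_time W) simp
  have idU: "integrable lborel (\<lambda>t. ?i t * (d t * U x t))"
    by (intro integrable_indicator_times mult_U_integrable_time d_integrable) simp
  have iWW: "integrable lborel (\<lambda>t. ?i t * (W x t)\<^sup>2)"
    by (intro integrable_indicator_times W_square_time) simp
  have idd: "integrable lborel (\<lambda>t. ?i t * (d t)\<^sup>2)"
    by (intro integrable_indicator_times d_square) simp
  note iUU = U_square_integrable_time[of \<tau> x]
  have DU: "(\<integral>t. ?i t * (D t * W x t) \<partial>lborel) = D \<tau> * U x \<tau> - (\<integral>t. ?i t * (d t * U x t) \<partial>lborel)"
    using primitive_mult[OF d_integrable W, of \<tau>] by (simp add: D_def U_def)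
  have UU: "2 * (\<integral>t. ?i t * (W x t * U x t) \<partial>lborel) = (U x \<tau>)\<^sup>2"
    using primitive_mult[OF W W, of \<tau>] by (simp add: U_def power2_eq_square mult.commute)
  have "(\<integral>t. ?i t * ((D t * ?q - r x * U x t - \<kappa> x * W x t) * W x t) \<partial>lborel)
      = (\<integral>t. ?q * (?i t * (D t * W x t)) - r x * (?i t * (W x t * U x t)) - \<kappa> x * (?i t * (W x t)\<^sup>2) \<partial>lborel)"
    by (rule Bochner_Integration.integral_cong) (auto simp: algebra_simps power2_eq_square)
  also have "\<dots> = ?q * (\<integral>t. ?i t * (D t * W x t) \<partial>lborel) - r x * (\<integral>t. ?i t * (W x t * U x t) \<partial>lborel) - \<kappa> x * (\<integral>t. ?i t * (W x t)\<^sup>2 \<partial>lborel)"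
    using iDW iWU iWW by simp
  finally have eq: "2 * (\<integral>t. ?i t * ((D t * ?q - r x * U x t - \<kappa> x * W x t) * W x t) \<partial>lborel)
      = 2 * (?q * D \<tau>) * U x \<tau> - (\<integral>t. ?i t * (2 * (?q * d t) * U x t) \<partial>lborel)
        - r x * (U x \<tau>)\<^sup>2 - 2 * \<kappa> x * (\<integral>t. ?i t * (W x t)\<^sup>2 \<partial>lborel)"
  proof -
    assume *: "(\<integral>t. ?i t * ((D t * ?q - r x * U x t - \<kappa> x * W x t) * W x t) \<partial>lborel)
      = ?q * (\<integral>t. ?i t * (D t * W x t) \<partial>lborel) - r x * (\<integral>t. ?i t * (W x t * U x t) \<partial>lborel) - \<kappa> x * (\<integral>t. ?i t * (W x t)\<^sup>2 \<partial>lborel)"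
    have "(\<integral>t. ?i t * (2 * (?q * d t) * U x t) \<partial>lborel) = (\<integral>t. (2 * ?q) * (?i t * (d t * U x t)) \<partial>lborel)"
      by (rule Bochner_Integration.integral_cong) auto
    also have "\<dots> = (2 * ?q) * (\<integral>t. ?i t * (d t * U x t) \<partial>lborel)" by (rule integral_mult_right_zero)
    finally show ?thesis unfolding * DU UU[symmetric] by (simp only: algebra_simps)
  qed
  \<comment> \<open>Boundary term: it uses half of r0 U^2, and D^2 \<le> T G supplies the T in 1 +
    T.\<close>
  have 1: "2 * (?q * D \<tau>) * U x \<tau> \<le> r0 / 2 * (U x \<tau>)\<^sup>2 + 2 / r0 * ?q\<^sup>2 * (T * G)"
  proof -
    have "2 / r0 * (?q * D \<tau>)\<^sup>2 \<le> 2 / r0 * ?q\<^sup>2 * (T * G)"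
      using mult_left_mono[OF D_square_le[of \<tau>], of "2 / r0 * ?q\<^sup>2"] r0_pos by (simp add: power_mult_distrib)
    then show ?thesis using Young_scaled[OF r0_pos, of "?q * D \<tau>" "U x \<tau>"] by linarith
  qed
  \<comment> \<open>Interior term: it supplies the 1 in 1 + T, after the integral of d^2 is enlarged
    from [0, \<tau>] to G.\<close>
  have 2: "- (\<integral>t. ?i t * (2 * (?q * d t) * U x t) \<partial>lborel) \<le> r0 / 2 * (\<integral>t. ?i t * (U x t)\<^sup>2 \<partial>lborel) + 2 / r0 * ?q\<^sup>2 * G"
  proof -
    have iq: "integrable lborel (\<lambda>t. ?i t * (2 * (?q * d t) * U x t))"
      using integrable_mult_right[OF idU, of "2 * ?q"] by (simp add: mult_ac)
    have "- (\<integral>t. ?i t * (2 * (?q * d t) * U x t) \<partial>lborel) = (\<integral>t. - (?i t * (2 * (?q * d t) * U x t)) \<partial>lborel)"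
      by simp
    also have "\<dots> \<le> (\<integral>t. r0 / 2 * (?i t * (U x t)\<^sup>2) + 2 / r0 * ?q\<^sup>2 * (d t)\<^sup>2 \<partial>lborel)"
    proof (rule integral_mono)
      fix t
      have "0 \<le> 2 / r0 * ?q\<^sup>2 * (d t)\<^sup>2" using r0_pos by simp
      then show "- (?i t * (2 * (?q * d t) * U x t)) \<le> r0 / 2 * (?i t * (U x t)\<^sup>2) + 2 / r0 * ?q\<^sup>2 * (d t)\<^sup>2"
        using Young_scaled[OF r0_pos, of "- (?q * d t)" "U x t"]
        by (cases "t \<in> {0..\<tau>}") (simp_all add: power_mult_distrib)
    qed (use iq iUU d_square in auto)
    also have "\<dots> = r0 / 2 * (\<integral>t. ?i t * (U x t)\<^sup>2 \<partial>lborel) + 2 / r0 * ?q\<^sup>2 * G"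
      using iUU d_square by (simp add: G_def)
    finally show ?thesis .
  qed
  have 3: "r0 * (U x \<tau>)\<^sup>2 \<le> r x * (U x \<tau>)\<^sup>2" using r_bounds by (intro mult_right_mono) auto
  have 4: "\<kappa>0 * (\<integral>t. ?i t * (W x t)\<^sup>2 \<partial>lborel) \<le> \<kappa> x * (\<integral>t. ?i t * (W x t)\<^sup>2 \<partial>lborel)"
    using \<kappa>_bounds by (intro mult_right_mono integral_nonneg_AE) auto
  have 5: "2 / r0 * ((1 + T) * G) * ?q\<^sup>2 = 2 / r0 * ?q\<^sup>2 * G + 2 / r0 * ?q\<^sup>2 * (T * G)"
    by (simp add: algebra_simps add_divide_distrib)
  show ?thesis unfolding eq 5 using 1 2 3 4 by linarith
qed

text \<open>By \<open>moment_pairing\<close> this is the integral of \<mu> w^2 up to time \<tau>,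
  the dissipation by external damping, which may therefore be added to an upper bound.\<close>

lemma moment_W_nonneg:
  "0 \<le> (\<integral>z. indicator {..\<tau>} (snd z) * (moment \<mu> (fst z) (snd z) * W (fst z) (snd z)) \<partial>lborel)"
  and moment_W_integrable_pair:
  "integrable lborel (\<lambda>z. indicator {..\<tau>} (snd z) * (moment \<mu> (fst z) (snd z) * W (fst z) (snd z)))"
proof -
  have [measurable]: "(\<lambda>z. moment \<mu> (fst z) (snd z)) \<in> borel_measurable borel" "(\<lambda>z. W (fst z) (snd z)) \<in> borel_measurable borel"
    "(\<lambda>z. indicator {..\<tau>} (snd z) :: real) \<in> borel_measurable (borel :: (real \<times> real) measure)"
    unfolding borel_prod[symmetric] by measurable
  have "integrable lborel (\<lambda>z. moment \<mu> (fst z) (snd z) * W (fst z) (snd z))"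
    by (rule integrable_mult_of_squares)
       (use moment_square_integrable[OF _ \<mu>_bounds] W_square in \<open>auto simp: lborel_prod case_prod_unfold\<close>)
  then show i: "integrable lborel (\<lambda>z. indicator {..\<tau>} (snd z) * (moment \<mu> (fst z) (snd z) * W (fst z) (snd z)))"
    by (rule Bochner_Integration.integrable_bound) (auto simp: abs_mult mult_left_le_one_le)
  have "(\<integral>z. indicator {..\<tau>} (snd z) * (moment \<mu> (fst z) (snd z) * W (fst z) (snd z)) \<partial>lborel)
     = (\<integral>t. (\<integral>x. indicator {..\<tau>} t * (moment \<mu> x t * W x t) \<partial>lborel) \<partial>lborel)"
    using lborel_pair.integral_snd[of "\<lambda>x t. indicator {..\<tau>} t * (moment \<mu> x t * W x t)"] i
    by (simp add: lborel_prod case_prod_unfold)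
  also have "\<dots> = (\<integral>t. indicator {..\<tau>} t * (\<integral>x. \<mu> x * w x t * w x t \<partial>lborel) \<partial>lborel)"
    using moment_pairing[OF _ \<mu>_bounds W_integrable_space] by (simp add: w_def)
  also have "\<dots> \<ge> 0"
  proof -
    have "0 \<le> \<mu> x * w x t * w x t" for x t 
      unfolding mult.assoc by (rule mult_nonneg_nonneg[OF \<mu>_bounds(1)]) simp
    then have "0 \<le> (\<integral>x. \<mu> x * w x t * w x t \<partial>lborel)" for t by (simp add: integral_nonneg_AE)
    then show ?thesis by (simp add: integral_nonneg_AE)
  qed
  finally show "0 \<le> (\<integral>z. indicator {..\<tau>} (snd z) * (moment \<mu> (fst z) (snd z) * W (fst z) (snd z)) \<partial>lborel)" .
qed

lemma y_integrable: "integrable lborel (\<lambda>t. indicator {0..T} t * y t)"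
proof -
  have "integrable lborel (\<lambda>t. \<integral>x. (indicator {0..T} t * U x t)\<^sup>2 \<partial>lborel)"
    by (rule lborel_pair.integrable_snd) (use U_square_integrable in simp)
  moreover have "(indicator {0..T} t :: real)\<^sup>2 = indicator {0..T} t" for t by (simp add: indicator_def)
  ultimately show ?thesis by (simp add: power_mult_distrib y_def)
qed

lemma U_square_integral_swap:
  assumes "\<tau> \<in> {0..T}"
  shows "(\<integral>x. (\<integral>t. indicator {0..\<tau>} t * (U x t)\<^sup>2 \<partial>lborel) \<partial>lborel) = Y \<tau>"
    and "integrable lborel (\<lambda>x. \<integral>t. indicator {0..\<tau>} t * (U x t)\<^sup>2 \<partial>lborel)"
proof -
  have i: "integrable (lborel \<Otimes>\<^sub>M lborel) (\<lambda>(x, t). indicator {0..\<tau>} t * (U x t)\<^sup>2)"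
    by (rule Bochner_Integration.integrable_bound[OF U_square_integrable])
       (use assms in \<open>auto simp: indicator_def\<close>)
  show "integrable lborel (\<lambda>x. \<integral>t. indicator {0..\<tau>} t * (U x t)\<^sup>2 \<partial>lborel)"
    by (rule lborel_pair.integrable_fst[OF i])
  have "(\<integral>x. (\<integral>t. indicator {0..\<tau>} t * (U x t)\<^sup>2 \<partial>lborel) \<partial>lborel) = (\<integral>t. (\<integral>x. indicator {0..\<tau>} t * (U x t)\<^sup>2 \<partial>lborel) \<partial>lborel)"
    by (rule lborel_pair.Fubini_integral[OF i, symmetric])
  also have "\<dots> = (\<integral>t. indicator {0..\<tau>} t * y t \<partial>lborel)" by (simp add: y_def)
  also have "\<dots> = Y \<tau>" unfolding Y_def
    by (rule Bochner_Integration.integral_cong) (use assms in \<open>auto simp: indicator_def\<close>)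
  finally show "(\<integral>x. (\<integral>t. indicator {0..\<tau>} t * (U x t)\<^sup>2 \<partial>lborel) \<partial>lborel) = Y \<tau>" .
qed

lemma Z_section_integrable: "integrable lborel (\<lambda>x. \<integral>t. indicator {0..\<tau>} t * (W x t)\<^sup>2 \<partial>lborel)"
proof (rule lborel_pair.integrable_fst)
  show "integrable (lborel \<Otimes>\<^sub>M lborel) (\<lambda>(x, t). indicator {0..\<tau>} t * (W x t)\<^sup>2)"
    by (rule Bochner_Integration.integrable_bound[OF W_square]) (auto simp: indicator_def)
qed

lemma Z_nonneg: "0 \<le> Z \<tau>"
  unfolding Z_def by (intro integral_nonneg_AE AE_I2) auto

lemma Z_T: "Z T = (\<integral>z. (W (fst z) (snd z))\<^sup>2 \<partial>lborel)"
proof -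
  have "indicator {0..T} t * (W x t)\<^sup>2 = (W x t)\<^sup>2" for x t using W_support[of x t] by (auto simp: indicator_def)
  then have "Z T = (\<integral>x. (\<integral>t. (W x t)\<^sup>2 \<partial>lborel) \<partial>lborel)" unfolding Z_def by (simp only:)
  also have "\<dots> = (\<integral>z. (W (fst z) (snd z))\<^sup>2 \<partial>lborel)"
    using lborel_pair.integral_fst[of "\<lambda>x t. (W x t)\<^sup>2"] W_square by (simp add: lborel_prod case_prod_unfold)
  finally show ?thesis .
qed

end

section \<open>The energy estimate and its consequences\<close>

context beam_solution
begin

text \<open>All three terms on the left are non-negative; keeping one of them at a time gives the
  bounds for \<open>y\<close>, for \<open>Z\<close> and for \<Phi>.\<close>

lemma energy_estimate:
  assumes \<tau>: "\<tau> \<in> {0..T}"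
  shows "\<Phi> \<tau> + r0 / 2 * y \<tau> + 2 * \<kappa>0 * Z \<tau> \<le> r0 / 2 * (A + Y \<tau>)"
proof -
  let ?F = "\<lambda>x t. indicator {..\<tau>} t * ((Q x t + moment \<mu> x t) * W x t)"
  have [measurable]: "(\<lambda>z. moment \<mu> (fst z) (snd z)) \<in> borel_measurable borel" "(\<lambda>z. W (fst z) (snd z)) \<in> borel_measurable borel"
    "(\<lambda>z. Q (fst z) (snd z)) \<in> borel_measurable borel"
    "(\<lambda>z. indicator {..\<tau>} (snd z) :: real) \<in> borel_measurable (borel :: (real \<times> real) measure)"
    unfolding borel_prod[symmetric] by measurable
  have "integrable lborel (\<lambda>z. Q (fst z) (snd z) * W (fst z) (snd z))"
    by (rule integrable_mult_of_squares)
       (use Q_square_integrable W_square in \<open>auto simp: lborel_prod case_prod_unfold\<close>)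
  then have iQ: "integrable lborel (\<lambda>z. indicator {..\<tau>} (snd z) * (Q (fst z) (snd z) * W (fst z) (snd z)))"
    by (rule Bochner_Integration.integrable_bound) (auto simp: abs_mult mult_left_le_one_le)
  note iM = moment_W_integrable_pair[of \<tau>]
  have iF: "integrable (lborel \<Otimes>\<^sub>M lborel) (\<lambda>(x, t). ?F x t)"
    using Bochner_Integration.integrable_add[OF iQ iM]
    by (simp add: lborel_prod case_prod_unfold distrib_left distrib_right)
  \<comment> \<open>Adding the damping term cancels \<open>moment \<mu>\<close> inside
    \<open>Q\<close>. What remains does not couple different x, so \<open>section_bound\<close>
    applies after Fubini.\<close>
  have "\<Phi> \<tau> \<le> 2 * ((\<integral>z. indicator {..\<tau>} (snd z) * (Q (fst z) (snd z) * W (fst z) (snd z)) \<partial>lborel)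
     + (\<integral>z. indicator {..\<tau>} (snd z) * (moment \<mu> (fst z) (snd z) * W (fst z) (snd z)) \<partial>lborel))"
    using moment_W_nonneg[of \<tau>] by (simp add: \<Phi>_def)
  also have "\<dots> = 2 * (\<integral>z. ?F (fst z) (snd z) \<partial>lborel)"
    using Bochner_Integration.integral_add[OF iQ iM] by (simp add: distrib_left distrib_right)
  also have "(\<integral>z. ?F (fst z) (snd z) \<partial>lborel) = (\<integral>x. (\<integral>t. ?F x t \<partial>lborel) \<partial>lborel)"
    using lborel_pair.integral_fst[OF iF] by (simp add: lborel_prod case_prod_unfold)
  also have "2 * \<dots> = (\<integral>x. 2 * (\<integral>t. ?F x t \<partial>lborel) \<partial>lborel)" by simp
  also have "\<dots> \<le> (\<integral>x. 2 / r0 * ((1 + T) * G) * (indicator {0..l} x * (c + l - x)\<^sup>2) - r0 / 2 * (U x \<tau>)\<^sup>2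
       + r0 / 2 * (\<integral>t. indicator {0..\<tau>} t * (U x t)\<^sup>2 \<partial>lborel)
       - 2 * \<kappa>0 * (\<integral>t. indicator {0..\<tau>} t * (W x t)\<^sup>2 \<partial>lborel) \<partial>lborel)" (is "_ \<le> (\<integral>x. ?R x \<partial>lborel)")
  proof (rule integral_mono)
    show "integrable lborel (\<lambda>x. 2 * (\<integral>t. ?F x t \<partial>lborel))"
      using lborel_pair.integrable_fst[OF iF] by simp
    have "integrable lborel (\<lambda>x. indicator {0..l} x * (c + l - x)\<^sup>2)"
      using borel_integrable_compact[of "{0..l}" "\<lambda>x. (c + l - x)\<^sup>2"] by (simp add: continuous_intros indicator_scaleR_eq_if)
    then show "integrable lborel ?R"
      using U_square_integrable_space[of \<tau>] U_square_integral_swap(2)[OF \<tau>] Z_section_integrable[of \<tau>] by simp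
    fix x
    show "2 * (\<integral>t. ?F x t \<partial>lborel) \<le> ?R x"
    proof (cases "x \<in> {0..l}")
      case True
      have "(\<integral>t. ?F x t \<partial>lborel) = (\<integral>t. indicator {0..\<tau>} t * ((D t * (c + l - x) - r x * U x t - \<kappa> x * W x t) * W x t) \<partial>lborel)"
      proof (rule Bochner_Integration.integral_cong[OF refl])
        fix t
        show "?F x t = indicator {0..\<tau>} t * ((D t * (c + l - x) - r x * U x t - \<kappa> x * W x t) * W x t)"
          using True \<tau> W_support[of x t] by (cases "t \<in> {0..T}") (auto simp: Q_def indicator_def)
      qed
      then show ?thesis using section_bound[OF \<tau>, of x] True by simp
    qed (simp add: W_support U_eq_0)
  qed
  also have "\<dots> = 2 / r0 * ((1 + T) * G) * (\<integral>x. indicator {0..l} x * (c + l - x)\<^sup>2 \<partial>lborel) - r0 / 2 * y \<tau>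
       + r0 / 2 * Y \<tau> - 2 * \<kappa>0 * Z \<tau>"
  proof -
    have "integrable lborel (\<lambda>x. indicator {0..l} x * (c + l - x)\<^sup>2)"
      using borel_integrable_compact[of "{0..l}" "\<lambda>x. (c + l - x)\<^sup>2"] by (simp add: continuous_intros indicator_scaleR_eq_if)
    then show ?thesis
      using U_square_integrable_space[of \<tau>] U_square_integral_swap[OF \<tau>] Z_section_integrable[of \<tau>]
      by (simp add: y_def Z_def)
  qed
  also have "2 / r0 * ((1 + T) * G) * (\<integral>x. indicator {0..l} x * (c + l - x)\<^sup>2 \<partial>lborel)
      \<le> 2 / r0 * ((1 + T) * G) * ((1 + c\<^sup>2) * (l + l ^ 3 / 3))"
    using load_integral_le r0_pos T_pos G_nonneg by (intro mult_left_mono) auto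
  also have "\<dots> = r0 / 2 * A" using r0_pos by (simp add: A_def power2_eq_square field_simps)
  finally show ?thesis by (simp add: algebra_simps)
qed

lemma y_le_A_plus_Y:
  assumes "\<tau> \<in> {0..T}"
  shows "y \<tau> \<le> A + Y \<tau>"
proof -
  have "r0 / 2 * y \<tau> \<le> r0 / 2 * (A + Y \<tau>)"
    using energy_estimate[OF assms] \<Phi>_nonneg[of \<tau>] Z_nonneg[of \<tau>] \<kappa>0_pos assms
    by (smt (verit) atLeastAtMost_iff mult_nonneg_nonneg)
  then show ?thesis using r0_pos by simp
qed

lemma Y_le:
  assumes "\<tau> \<in> {0..T}"
  shows "Y \<tau> \<le> A * (exp \<tau> - 1)"
  unfolding Y_def
proof (rule Gronwall_primitive[OF y_integrable _ assms])
  fix t assume "t \<in> {0..T}"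
  then show "indicator {0..T} t * y t \<le> A + (\<integral>s. indicator {0..t} s * (indicator {0..T} s * y s) \<partial>lborel)"
    using y_le_A_plus_Y[of t] by (simp add: Y_def)
qed

lemma y_le:
  assumes "t \<in> {0..T}"
  shows "y t \<le> A * exp T"
proof -
  have "y t \<le> A * exp t" using y_le_A_plus_Y[OF assms] Y_le[OF assms] by (simp add: algebra_simps)
  also have "\<dots> \<le> A * exp T" using A_nonneg assms by (intro mult_left_mono) auto
  finally show ?thesis .
qed

lemma y_nonneg: "0 \<le> y t" by (simp add: y_def)

lemma Z_le: "2 * \<kappa>0 * Z T \<le> r0 / 2 * (A * exp T)"
proof -
  have T: "T \<in> {0..T}" using T_pos by simp
  have "2 * \<kappa>0 * Z T \<le> r0 / 2 * (A + Y T)"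
    using energy_estimate[OF T] \<Phi>_nonneg[of T] y_nonneg[of T] r0_pos by (smt (verit) mult_nonneg_nonneg divide_nonneg_nonneg)
  also have "\<dots> \<le> r0 / 2 * (A * exp T)"
    using Y_le[OF T] r0_pos by (intro mult_left_mono) (auto simp: algebra_simps)
  finally show ?thesis .
qed

text \<open>Here \<Phi> is bounded from above: A + Y(\<tau>) \<le> A exp \<tau> by Gronwall, and
  since J has \<Phi> as its limiting difference quotient, integration over [0, T] leaves exp T -
  1.\<close>

lemma E_integral_le: "(\<integral>t. E t \<partial>lborel) \<le> r0 / 2 * (A * (exp T - 1))"
proof -
  have "J T \<le> (r0 / 2 * A) * (exp T - 1)"
  proof (rule J_T_le)
    fix \<tau> assume \<tau>: "\<tau> \<in> {0..T}"
    have "\<Phi> \<tau> \<le> r0 / 2 * (A + Y \<tau>)"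
      using energy_estimate[OF \<tau>] y_nonneg[of \<tau>] Z_nonneg[of \<tau>] r0_pos \<kappa>0_pos
      by (smt (verit) mult_nonneg_nonneg divide_nonneg_nonneg)
    also have "\<dots> \<le> r0 / 2 * (A * exp \<tau>)"
      using Y_le[OF \<tau>] r0_pos by (intro mult_left_mono) (auto simp: algebra_simps)
    finally show "\<Phi> \<tau> \<le> r0 / 2 * A * exp \<tau>" by simp
  qed (use r0_pos A_nonneg in simp)
  then show ?thesis by (simp add: J_T)
qed

end

section \<open>From the weak formulation to the equation of motion\<close>

lemma AE_lborel_pair:
  fixes R :: "real \<times> real \<Rightarrow> bool"
  assumes "AE z in lborel. R z"
  shows "AE x in lborel. AE t in lborel. R (x, t)" and "AE t in lborel. AE x in lborel. R (x, t)"
proof -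
  have *: "AE z in lborel \<Otimes>\<^sub>M lborel. R z" using assms by (subst lborel_prod)
  show "AE x in lborel. AE t in lborel. R (x, t)" by (rule lborel_pair.AE_pair[OF *])
  have "AE z in distr (lborel \<Otimes>\<^sub>M lborel) (lborel \<Otimes>\<^sub>M lborel) (\<lambda>(x, y). (y, x)). R z"
    using * by (subst (asm) lborel_pair.distr_pair_swap)
  then have "AE z in lborel \<Otimes>\<^sub>M lborel. R (case z of (x, y) \<Rightarrow> (y, x))"
    by (rule AE_distrD[rotated]) measurable
  from lborel_pair.AE_pair[OF this] show "AE t in lborel. AE x in lborel. R (x, t)" by simp
qed

text \<open>Exchanging the quantifiers needs a measurable set, which an equation between jointly
  measurable functions provides.\<close>

lemma AE_swap_eq:
  fixes f h :: "real \<Rightarrow> real \<Rightarrow> real"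
  assumes [measurable]: "case_prod f \<in> borel_measurable (borel \<Otimes>\<^sub>M borel)" "case_prod h \<in> borel_measurable (borel \<Otimes>\<^sub>M borel)"
  shows "(AE x in lborel. AE t in lborel. f x t = h x t) \<longleftrightarrow> (AE t in lborel. AE x in lborel. f x t = h x t)"
  by (rule lborel_pair.AE_commute) measurable

text \<open>Extension by zero turns measurability and integrability over the rectangle into
  statements on the whole plane, where Fubini's theorem and translations apply.\<close>

definition cut :: "real \<Rightarrow> real \<Rightarrow> (real \<Rightarrow> real \<Rightarrow> real) \<Rightarrow> real \<Rightarrow> real \<Rightarrow> real" where
  "cut l T f x t = indicator {0..l} x * indicator {0..T} t * f x t"

lemma cut_eq: "x \<in> {0..l} \<Longrightarrow> t \<in> {0..T} \<Longrightarrow> cut l T f x t = f x t"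
  and cut_eq_0: "x \<notin> {0..l} \<or> t \<notin> {0..T} \<Longrightarrow> cut l T f x t = 0"
  by (auto simp: cut_def)

lemma cut_L2:
  assumes "L2_on ({0..l} \<times> {0..T}) (\<lambda>(x, t). f x t)"
  shows cut_measurable: "case_prod (cut l T f) \<in> borel_measurable (borel \<Otimes>\<^sub>M borel)"
    and cut_square_integrable: "integrable (lborel \<Otimes>\<^sub>M lborel) (\<lambda>(x, t). (cut l T f x t)\<^sup>2)"
    and cut_integral: "set_lebesgue_integral lborel ({0..l} \<times> {0..T}) (\<lambda>(x, t). (f x t)\<^sup>2)
      = (\<integral>t. (\<integral>x. (cut l T f x t)\<^sup>2 \<partial>lborel) \<partial>lborel)"
proof -
  have c: "indicator ({0..l} \<times> {0..T}) z *\<^sub>R (case z of (x, t) \<Rightarrow> f x t) = case_prod (cut l T f) z" for z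
    by (cases z) (auto simp: cut_def indicator_times)
  have c2: "indicator ({0..l} \<times> {0..T}) z *\<^sub>R (case z of (x, t) \<Rightarrow> f x t)\<^sup>2 = (case z of (x, t) \<Rightarrow> (cut l T f x t)\<^sup>2)" for z
    by (cases z) (auto simp: cut_def indicator_def)
  have c3: "indicator ({0..l} \<times> {0..T}) z *\<^sub>R (case z of (x, t) \<Rightarrow> (f x t)\<^sup>2) = (case z of (x, t) \<Rightarrow> (cut l T f x t)\<^sup>2)" for z
    by (cases z) (auto simp: cut_def indicator_def)
  show "case_prod (cut l T f) \<in> borel_measurable (borel \<Otimes>\<^sub>M borel)"
    using assms unfolding L2_on_def set_borel_measurable_def c borel_prod by simp
  show i: "integrable (lborel \<Otimes>\<^sub>M lborel) (\<lambda>(x, t). (cut l T f x t)\<^sup>2)"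
    using assms unfolding L2_on_def set_integrable_def c2 lborel_prod by simp
  have "set_lebesgue_integral lborel ({0..l} \<times> {0..T}) (\<lambda>(x, t). (f x t)\<^sup>2)
     = integral\<^sup>L (lborel \<Otimes>\<^sub>M lborel) (\<lambda>(x, t). (cut l T f x t)\<^sup>2)"
    unfolding set_lebesgue_integral_def c3 lborel_prod ..
  also have "\<dots> = (\<integral>t. (\<integral>x. (cut l T f x t)\<^sup>2 \<partial>lborel) \<partial>lborel)"
    by (rule lborel_pair.integral_snd[OF i, symmetric])
  finally show "set_lebesgue_integral lborel ({0..l} \<times> {0..T}) (\<lambda>(x, t). (f x t)\<^sup>2)
      = (\<integral>t. (\<integral>x. (cut l T f x t)\<^sup>2 \<partial>lborel) \<partial>lborel)" .
qed

locale weak_beam =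
  fixes l T h \<theta> \<rho>0 \<rho>1 \<mu>0 \<mu>1 r0 r1 \<kappa>0 \<kappa>1 :: real
    and \<rho>A \<mu>A rA \<kappa>A g g' :: "real \<Rightarrow> real"
    and u ut uxx uxxt :: "real \<Rightarrow> real \<Rightarrow> real"
  assumes pos: "l > 0" "T > 0"
    and coeff_set_measurable: "set_borel_measurable lborel {0..l} \<rho>A" "set_borel_measurable lborel {0..l} \<mu>A"
      "set_borel_measurable lborel {0..l} rA" "set_borel_measurable lborel {0..l} \<kappa>A"
    and lower_pos: "0 < \<rho>0" "0 \<le> \<mu>0" "0 < r0" "0 < \<kappa>0"
    and coeff_AE: "AE x in lborel. x \<in> {0<..<l} \<longrightarrow>
           \<rho>0 \<le> \<rho>A x \<and> \<rho>A x \<le> \<rho>1 \<and> \<mu>0 \<le> \<mu>A x \<and> \<mu>A x \<le> \<mu>1 \<and>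
           r0 \<le> rA x \<and> rA x \<le> r1 \<and> \<kappa>0 \<le> \<kappa>A x \<and> \<kappa>A x \<le> \<kappa>1"
    and g'_L2: "L2_on {0..T} g'"
    and g_eq: "\<forall>t\<in>{0..T}. g t = set_lebesgue_integral lborel {0..t} g'"
    and weak: "weak_solution l T h \<theta> \<rho>A \<mu>A rA \<kappa>A g u ut uxx uxxt"
begin

lemma L2_fields:
  "L2_on ({0..l} \<times> {0..T}) (\<lambda>(x, t). uxx x t)" "L2_on ({0..l} \<times> {0..T}) (\<lambda>(x, t). ut x t)"
  "L2_on ({0..l} \<times> {0..T}) (\<lambda>(x, t). uxxt x t)"
  using weak by (auto simp: weak_solution_def)

lemma cut_fields_measurable [measurable]:
  "case_prod (cut l T uxx) \<in> borel_measurable (borel \<Otimes>\<^sub>M borel)"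
  "case_prod (cut l T ut) \<in> borel_measurable (borel \<Otimes>\<^sub>M borel)"
  "case_prod (cut l T uxxt) \<in> borel_measurable (borel \<Otimes>\<^sub>M borel)"
  by (rule cut_measurable; rule L2_fields)+

text \<open>Discarding null sets of \<open>x\<close> and of \<open>t\<close> makes every section of \<open>u\<^sub>x\<^sub>x\<^sub>t\<close> square integrable;
  clipping makes the bounds on the coefficients hold everywhere.\<close>

definition V :: "real \<Rightarrow> real \<Rightarrow> real" where
  "V x t = (if integrable lborel (\<lambda>s. (cut l T uxxt x s)\<^sup>2) \<and> integrable lborel (\<lambda>a. (cut l T uxxt a t)\<^sup>2)
     then cut l T uxxt x t else 0)"

definition clip :: "real \<Rightarrow> real \<Rightarrow> (real \<Rightarrow> real) \<Rightarrow> real \<Rightarrow> real" where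
  "clip a b f x = max a (min b (indicator {0..l} x * f x))"

definition gT :: "real \<Rightarrow> real" where "gT t = indicator {0..T} t * g' t"

text \<open>A common upper bound for the four clipped coefficients, each of which is at most the
  larger of its two constants; the absolute values let the sum dominate every single
  constant.\<close>

definition K :: real where "K = \<rho>0 + \<bar>\<rho>1\<bar> + \<mu>0 + \<bar>\<mu>1\<bar> + r0 + \<bar>r1\<bar> + \<kappa>0 + \<bar>\<kappa>1\<bar>"

lemma clip_measurable:
  assumes "set_borel_measurable lborel {0..l} f"
  shows "clip a b f \<in> borel_measurable borel"
proof -
  have [measurable]: "(\<lambda>x. indicator {0..l} x * f x) \<in> borel_measurable borel"
    using assms by (simp add: set_borel_measurable_def)
  show ?thesis unfolding clip_def by measurable
qed

lemma V_measurable [measurable]: "case_prod V \<in> borel_measurable (borel \<Otimes>\<^sub>M borel)"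
  unfolding V_def by measurable

lemma V_AE: "AE x in lborel. AE t in lborel. V x t = cut l T uxxt x t"
proof -
  have i: "integrable (lborel \<Otimes>\<^sub>M lborel) (\<lambda>(x, t). (cut l T uxxt x t)\<^sup>2)"
    by (rule cut_square_integrable[OF L2_fields(3)])
  from lborel_pair.AE_integrable_fst[OF i] show ?thesis
  proof eventually_elim
    case (elim x)
    from lborel_pair.AE_integrable_snd[OF i] show ?case
      by eventually_elim (use elim in \<open>simp add: V_def\<close>)
  qed
qed

lemma V_AE': "AE t in lborel. AE x in lborel. V x t = cut l T uxxt x t"
  using V_AE by (subst AE_swap_eq[symmetric]) simp_all

sublocale beam l T "c_theta h \<theta>" r0 \<kappa>0 K "clip \<rho>0 \<rho>1 \<rho>A" "clip \<mu>0 \<mu>1 \<mu>A" "clip r0 r1 rA" "clip \<kappa>0 \<kappa>1 \<kappa>A"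
  gT V
proof
  show "clip \<rho>0 \<rho>1 \<rho>A \<in> borel_measurable borel" "clip \<mu>0 \<mu>1 \<mu>A \<in> borel_measurable borel"
    "clip r0 r1 rA \<in> borel_measurable borel" "clip \<kappa>0 \<kappa>1 \<kappa>A \<in> borel_measurable borel"
    by (rule clip_measurable; rule coeff_set_measurable)+
  show "gT \<in> borel_measurable borel"
    using g'_L2 unfolding gT_def by (simp add: L2_on_def set_borel_measurable_def)
  have "indicator {0..T} t *\<^sub>R (g' t)\<^sup>2 = (gT t)\<^sup>2" for t
    by (simp add: gT_def indicator_def)
  then show "integrable lborel (\<lambda>t. (gT t)\<^sup>2)"
    using g'_L2 by (simp add: L2_on_def set_integrable_def)
  show "case_prod V \<in> borel_measurable (borel \<Otimes>\<^sub>M borel)" by simp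
  have *: "\<bar>(V x t)\<^sup>2\<bar> \<le> (cut l T uxxt x t)\<^sup>2" for x t by (simp add: V_def)
  show "integrable (lborel \<Otimes>\<^sub>M lborel) (\<lambda>(x, t). (V x t)\<^sup>2)"
    by (rule Bochner_Integration.integrable_bound[OF cut_square_integrable[OF L2_fields(3)]]) (use * in auto)
  show "integrable lborel (\<lambda>t. (V x t)\<^sup>2)" for x
  proof (cases "integrable lborel (\<lambda>s. (cut l T uxxt x s)\<^sup>2)")
    case True
    show ?thesis by (rule integrable_of_abs_bound[OF _ True *]) measurable
  qed (simp add: V_def)
  show "integrable lborel (\<lambda>x. (V x t)\<^sup>2)" for t
  proof (cases "integrable lborel (\<lambda>a. (cut l T uxxt a t)\<^sup>2)")
    case True
    show ?thesis by (rule integrable_of_abs_bound[OF _ True *]) measurable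
  qed (simp add: V_def)
qed (use pos lower_pos in \<open>auto simp: clip_def K_def V_def cut_def gT_def\<close>)

lemma clip_AE:
  "AE x in lborel. x \<in> {0..l} \<longrightarrow> clip \<rho>0 \<rho>1 \<rho>A x = \<rho>A x \<and> clip \<mu>0 \<mu>1 \<mu>A x = \<mu>A x \<and>
     clip r0 r1 rA x = rA x \<and> clip \<kappa>0 \<kappa>1 \<kappa>A x = \<kappa>A x"
  \<comment> \<open>The bounds are given on the open interval, so the two endpoints are
    discarded.\<close>
  using coeff_AE AE_lborel_singleton[of 0] AE_lborel_singleton[of l]
  by eventually_elim (auto simp: clip_def)

lemma g_eq_D: "t \<in> {0..T} \<Longrightarrow> g t = D t"
proof -
  assume t: "t \<in> {0..T}"
  then have "g t = (\<integral>s. indicator {0..t} s *\<^sub>R g' s \<partial>lborel)" using g_eq by (simp add: set_lebesgue_integral_def)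
  also have "\<dots> = D t"
    unfolding D_def by (rule Bochner_Integration.integral_cong) (use t in \<open>auto simp: gT_def indicator_def\<close>)
  finally show ?thesis .
qed

lemma cut_U_measurable [measurable]: "case_prod (cut l T U) \<in> borel_measurable (borel \<Otimes>\<^sub>M borel)"
  unfolding cut_def by measurable

lemma set_integral_cut:
  assumes "x \<in> {0..l}" "t \<in> {0..T}"
  shows "set_lebesgue_integral lborel {0..t} (\<lambda>s. f x s) = (\<integral>s. indicator {0..t} s * cut l T f x s \<partial>lborel)"
  unfolding set_lebesgue_integral_def
  by (rule Bochner_Integration.integral_cong) (use assms in \<open>auto simp: cut_def indicator_def\<close>)

lemma uxx_eq_U: "AE x in lborel. AE t in lborel. cut l T uxx x t = cut l T U x t"
proof -
  have "AE z in lborel. z \<in> {0..l} \<times> {0..T} \<longrightarrow>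
        uxx (fst z) (snd z) = set_lebesgue_integral lborel {0..snd z} (\<lambda>s. uxxt (fst z) s)"
    using weak by (simp add: weak_solution_def)
  from AE_lborel_pair(1)[OF this] V_AE show ?thesis
  proof eventually_elim
    case (elim x)
    from elim(1) show ?case
    proof eventually_elim
      case (elim t)
      show ?case
      proof (cases "x \<in> {0..l} \<and> t \<in> {0..T}")
        case True
        then have "uxx x t = (\<integral>s. indicator {0..t} s * cut l T uxxt x s \<partial>lborel)"
          using elim set_integral_cut[of x t uxxt] by auto
        also have "\<dots> = U x t"
          unfolding U_def
        proof (rule integral_cong_AE)
          show "AE s in lborel. indicator {0..t} s * cut l T uxxt x s = indicator {0..t} s * V x s"
            using \<open>AE t in lborel. V x t = cut l T uxxt x t\<close> by eventually_elim simp
        qed measurable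
        finally show ?thesis using True by (simp add: cut_eq)
      qed (auto simp: cut_def)
    qed
  qed
qed

lemma uxx_eq_U': "AE t in lborel. AE x in lborel. cut l T uxx x t = cut l T U x t"
  using uxx_eq_U by (subst AE_swap_eq[symmetric]) simp_all

text \<open>The double integration in space commutes with the one in time; in terms of the solution,
  u(t) is the time primitive of \<open>w\<close>.\<close>

lemma kernel_U: "(\<integral>s. k x s * U s t \<partial>lborel) = (\<integral>\<tau>. indicator {0..t} \<tau> * w x \<tau> \<partial>lborel)"
proof -
  have W: "integrable (lborel \<Otimes>\<^sub>M lborel) (\<lambda>(s, \<tau>). V s \<tau>)"
    by (rule integrable_pair_of_square[OF W_measurable W_square W_support])
  have i: "integrable (lborel \<Otimes>\<^sub>M lborel) (\<lambda>(s, \<tau>). k x s * (indicator {0..t} \<tau> * V s \<tau>))"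
  proof (rule integrable_of_abs_bound)
    show "integrable (lborel \<Otimes>\<^sub>M lborel) (\<lambda>z. l * \<bar>case z of (s, \<tau>) \<Rightarrow> V s \<tau>\<bar>)" using W by simp
    fix z :: "real \<times> real"
    obtain s \<tau> where z: "z = (s, \<tau>)" by force
    have "\<bar>k x s\<bar> * \<bar>indicator {0..t} \<tau> * V s \<tau>\<bar> \<le> l * \<bar>V s \<tau>\<bar>"
      by (rule mult_mono) (use abs_k_le l_pos in \<open>auto simp: indicator_def\<close>)
    then show "\<bar>case z of (s, \<tau>) \<Rightarrow> k x s * (indicator {0..t} \<tau> * V s \<tau>)\<bar> \<le> l * \<bar>case z of (s, \<tau>) \<Rightarrow> V s \<tau>\<bar>"
      by (simp add: z abs_mult)
  qed measurable
  have "(\<integral>s. k x s * U s t \<partial>lborel) = (\<integral>s. (\<integral>\<tau>. k x s * (indicator {0..t} \<tau> * V s \<tau>) \<partial>lborel) \<partial>lborel)"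
    by (simp add: U_def)
  also have "\<dots> = (\<integral>\<tau>. (\<integral>s. k x s * (indicator {0..t} \<tau> * V s \<tau>) \<partial>lborel) \<partial>lborel)"
    by (rule lborel_pair.Fubini_integral[OF i, symmetric])
  also have "\<dots> = (\<integral>\<tau>. (\<integral>s. indicator {0..t} \<tau> * (k x s * V s \<tau>) \<partial>lborel) \<partial>lborel)"
    by (simp add: mult.left_commute)
  finally show ?thesis by (simp add: w_def)
qed

lemma kernel_cut:
  assumes "x \<in> {0..l}"
  shows "set_lebesgue_integral lborel {0..x} (\<lambda>s. (x - s) * f s) = (\<integral>s. k x s * f s \<partial>lborel)"
  unfolding set_lebesgue_integral_def
  by (rule Bochner_Integration.integral_cong) (use assms in \<open>auto simp: k_def indicator_def\<close>)

text \<open>The definition links u_t to u and u_xxt to u_xx, but not u_t to u_xxt. The link comes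
  from u(t) being in V: u is the double space integral of u_xx, so u_t and \<open>w\<close> have the
  same time primitive for almost every x, and hence agree.\<close>

lemma ut_eq_w: "AE x in lborel. AE t in lborel. cut l T ut x t = w x t"
proof -
  \<comment> \<open>The two primitives as jointly measurable functions on the plane: their equality
    is proved at fixed t, where \<open>inV\<close> speaks, and used at fixed x, where primitives in
    time are compared.\<close>
  define F where "F x t = indicator {0..l} x * indicator {0..T} t * (\<integral>s. indicator {0..t} s * cut l T ut x s \<partial>lborel)" for x t
  define H where "H x t = indicator {0..l} x * indicator {0..T} t * (\<integral>s. indicator {0..t} s * w x s \<partial>lborel)" for x t
  have [measurable]: "case_prod F \<in> borel_measurable (borel \<Otimes>\<^sub>M borel)" "case_prod H \<in> borel_measurable (borel \<Otimes>\<^sub>M borel)"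
    unfolding F_def H_def by measurable
  have "AE z in lborel. z \<in> {0..l} \<times> {0..T} \<longrightarrow>
        u (fst z) (snd z) = set_lebesgue_integral lborel {0..snd z} (\<lambda>s. ut (fst z) s)"
    and inV: "AE t in lborel. t \<in> {0..T} \<longrightarrow> inV l (\<lambda>x. u x t) (\<lambda>x. uxx x t)"
    using weak by (simp_all add: weak_solution_def)
  from AE_lborel_pair(2)[OF this(1)] inV uxx_eq_U' have "AE t in lborel. AE x in lborel. F x t = H x t"
  proof eventually_elim
    case (elim t)
    from elim(1) show ?case
    proof eventually_elim
      case (elim x)
      show ?case
      proof (cases "x \<in> {0..l} \<and> t \<in> {0..T}")
        case True
        then have "(\<integral>s. indicator {0..t} s * cut l T ut x s \<partial>lborel) = u x t"
          using elim set_integral_cut[of x t ut] by auto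
        also have "\<dots> = (\<integral>s. k x s * uxx s t \<partial>lborel)"
          using \<open>t \<in> {0..T} \<longrightarrow> inV l (\<lambda>x. u x t) (\<lambda>x. uxx x t)\<close> True kernel_cut[of x "\<lambda>s. uxx s t"]
          unfolding inV_def by auto
        also have "\<dots> = (\<integral>s. k x s * cut l T uxx s t \<partial>lborel)"
          by (rule Bochner_Integration.integral_cong) (use True in \<open>auto simp: k_def cut_def indicator_def\<close>)
        also have "\<dots> = (\<integral>s. k x s * U s t \<partial>lborel)"
        proof (rule integral_cong_AE)
          show "AE s in lborel. k x s * cut l T uxx s t = k x s * U s t"
            using \<open>AE x in lborel. cut l T uxx x t = cut l T U x t\<close>
            by eventually_elim (use True in \<open>auto simp: k_def cut_def indicator_def\<close>)
        qed measurable
        also have "\<dots> = (\<integral>\<tau>. indicator {0..t} \<tau> * w x \<tau> \<partial>lborel)" by (rule kernel_U)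
        finally show ?thesis by (simp add: F_def H_def)
      qed (auto simp: F_def H_def)
    qed
  qed
  then have "AE x in lborel. AE t in lborel. F x t = H x t" by (subst AE_swap_eq) simp_all
  moreover have "AE x in lborel. integrable lborel (cut l T ut x)"
    by (rule lborel_pair.AE_integrable_fst, rule integrable_pair_of_square)
       (use cut_square_integrable[OF L2_fields(2)] cut_eq_0 in auto)
  moreover have "AE x in lborel. integrable lborel (w x)"
    by (rule lborel_pair.AE_integrable_fst, rule integrable_pair_of_square)
       (use w_square_integrable w_eq_0 in auto)
  ultimately show ?thesis
  proof eventually_elim
    case (elim x)
    show ?case
    proof (cases "x \<in> {0..l}")
      case True
      let ?f = "\<lambda>t. cut l T ut x t - w x t"
      have f: "integrable lborel ?f" using elim by simp
      have "AE t in lborel. t \<in> {0..T} \<longrightarrow> (\<integral>s. indicator {0..t} s * ?f s \<partial>lborel) = 0"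
        using elim(1)
      proof eventually_elim
        case (elim t)
        have "integrable lborel (\<lambda>s. indicator {0..t} s * cut l T ut x s)" "integrable lborel (\<lambda>s. indicator {0..t} s * w x s)"
          using \<open>integrable lborel (cut l T ut x)\<close> \<open>integrable lborel (w x)\<close> by (auto intro!: integrable_indicator_times)
        then show ?case using elim True by (auto simp: F_def H_def right_diff_distrib)
      qed
      from AE_eq_0_if_primitive_eq_0_dense[OF f _ AE_dense_in_Icc[OF T_pos this]] T_pos
      have "AE t in lborel. t \<in> {0..T} \<longrightarrow> ?f t = 0" by simp
      then show ?thesis
      proof eventually_elim
        case (elim t)
        then show ?case by (cases "t \<in> {0..T}") (auto simp: cut_def w_eq_0)
      qed
    qed (simp add: cut_def w_eq_0)
  qed
qed

lemma ut_eq_w': "AE t in lborel. AE x in lborel. cut l T ut x t = w x t"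
  using ut_eq_w by (subst AE_swap_eq[symmetric]) simp_all

subsection \<open>Testing with indicator functions\<close>

text \<open>The test function v with v'' the indicator of [0, q], extended by zero outside
  [0, l].\<close>

definition kq :: "real \<Rightarrow> real \<Rightarrow> real" where "kq q x = (\<integral>s. k x s * indicator {0..q} s \<partial>lborel)"

lemma kq_measurable [measurable]: "kq q \<in> borel_measurable borel"
  unfolding kq_def by measurable

lemma inV_kq: "inV l (\<lambda>x. set_lebesgue_integral lborel {0..x} (\<lambda>s. (x - s) * indicator {0..q} s)) (indicator {0..q})"
proof -
  have "set_integrable lborel {0..l} (\<lambda>x. (indicator {0..q} x :: real)\<^sup>2)"
    unfolding set_integrable_def
    by (rule integrable_of_abs_bound[OF _ integrable_indicator_Icc[of 0 l]]) (auto simp: indicator_def)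
  moreover have "set_borel_measurable lborel {0..l} (indicator {0..q} :: real \<Rightarrow> real)"
    unfolding set_borel_measurable_def by measurable
  ultimately show ?thesis by (simp add: inV_def L2_on_def)
qed

text \<open>Only the fields restricted to the space-time rectangle are known to be measurable; hence the restrictions here.\<close>

lemma L2ip_ut:
  assumes "t \<in> {0..T}"
  shows "L2ip l (\<lambda>x. \<beta> x * ut x t) (\<lambda>x. set_lebesgue_integral lborel {0..x} (\<lambda>s. (x - s) * indicator {0..q} s))
    = (\<integral>x. (indicator {0..l} x * \<beta> x) * cut l T ut x t * kq q x \<partial>lborel)"
  unfolding L2ip_def set_lebesgue_integral_def[of lborel "{0..l}"]
proof (rule Bochner_Integration.integral_cong[OF refl])
  fix x
  show "indicator {0..l} x *\<^sub>R (\<beta> x * ut x t * set_lebesgue_integral lborel {0..x} (\<lambda>s. (x - s) * indicator {0..q} s))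
      = indicator {0..l} x * \<beta> x * cut l T ut x t * kq q x"
    using assms kernel_cut[of x "indicator {0..q}"] by (cases "x \<in> {0..l}") (auto simp: cut_def kq_def)
qed

lemma L2ip_stress:
  assumes "t \<in> {0..T}"
  shows "L2ip l (\<lambda>x. rA x * uxx x t + \<kappa>A x * uxxt x t) (indicator {0..q})
    = (\<integral>x. ((indicator {0..l} x * rA x) * cut l T uxx x t + (indicator {0..l} x * \<kappa>A x) * cut l T uxxt x t) * indicator {0..q} x \<partial>lborel)"
  unfolding L2ip_def set_lebesgue_integral_def
  by (rule Bochner_Integration.integral_cong) (use assms in \<open>auto simp: cut_def indicator_def\<close>)

text \<open>Transposing the kernel replaces the pairing with v by one with v'' =
  \<open>indicator {0..q}\<close>, which is the primitive of the moment in x evaluated at q.\<close>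

lemma moment_test:
  assumes \<beta>: "set_borel_measurable lborel {0..l} \<beta>"
    and \<beta>': "\<beta>' \<in> borel_measurable borel" "\<And>x. 0 \<le> \<beta>' x" "\<And>x. \<beta>' x \<le> K"
    and eq: "AE x in lborel. x \<in> {0..l} \<longrightarrow> \<beta>' x = \<beta> x"
  shows "AE t in lborel. (\<integral>x. (indicator {0..l} x * \<beta> x) * cut l T ut x t * kq q x \<partial>lborel)
     = (\<integral>x. moment \<beta>' x t * indicator {0..q} x \<partial>lborel)"
  using ut_eq_w'
proof eventually_elim
  case (elim t)
  have [measurable]: "(\<lambda>x. indicator {0..l} x * \<beta> x) \<in> borel_measurable borel"
    using \<beta> by (simp add: set_borel_measurable_def)
  note [measurable] = \<beta>'(1)
  have "(\<integral>x. (indicator {0..l} x * \<beta> x) * cut l T ut x t * kq q x \<partial>lborel) = (\<integral>x. \<beta>' x * w x t * kq q x \<partial>lborel)"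
  proof (rule integral_cong_AE)
    show "AE x in lborel. (indicator {0..l} x * \<beta> x) * cut l T ut x t * kq q x = \<beta>' x * w x t * kq q x"
      using eq elim
    proof eventually_elim
      case (elim x)
      then show ?case by (cases "x \<in> {0..l}") (auto simp: w_eq_0)
    qed
  qed measurable
  also have "\<dots> = (\<integral>x. moment \<beta>' x t * indicator {0..q} x \<partial>lborel)"
    unfolding kq_def by (rule moment_pairing[symmetric, OF \<beta>']) simp
  finally show ?case .
qed

lemma stress_test:
  "AE t in lborel. (\<integral>x. ((indicator {0..l} x * rA x) * cut l T uxx x t + (indicator {0..l} x * \<kappa>A x) * cut l T uxxt x t) * indicator {0..q} x \<partial>lborel)
     = (\<integral>x. indicator {0..T} t * (clip r0 r1 rA x * U x t + clip \<kappa>0 \<kappa>1 \<kappa>A x * V x t) * indicator {0..q} x \<partial>lborel)"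
  using uxx_eq_U' V_AE'
proof eventually_elim
  case (elim t)
  have [measurable]: "(\<lambda>x. indicator {0..l} x * rA x) \<in> borel_measurable borel" "(\<lambda>x. indicator {0..l} x * \<kappa>A x) \<in> borel_measurable borel"
    using coeff_set_measurable by (simp_all add: set_borel_measurable_def)
  show ?case
  proof (rule integral_cong_AE)
    show "AE x in lborel. ((indicator {0..l} x * rA x) * cut l T uxx x t + (indicator {0..l} x * \<kappa>A x) * cut l T uxxt x t) * indicator {0..q} x
       = indicator {0..T} t * (clip r0 r1 rA x * U x t + clip \<kappa>0 \<kappa>1 \<kappa>A x * V x t) * indicator {0..q} x"
      using elim clip_AE
    proof eventually_elim
      case (elim x)
      then show ?case
        using W_support[of x t] U_eq_0[of x t] cut_eq_0[of x l t T U]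
        by (cases "x \<in> {0..l}"; cases "t \<in> {0..T}") (auto simp: cut_def)
    qed
  qed measurable
qed

lemma U_integrable_space: "integrable lborel (\<lambda>x. U x t)"
proof (rule integrable_of_abs_bound)
  show "integrable lborel (\<lambda>x. indicator {0..l} x + (U x t)\<^sup>2)" using U_square_integrable_space by simp
  fix x
  have "\<bar>U x t\<bar> \<le> 1 + (U x t)\<^sup>2" using zero_le_power2[of "\<bar>U x t\<bar> - 1"] by (simp add: power2_diff)
  then show "\<bar>U x t\<bar> \<le> indicator {0..l} x + (U x t)\<^sup>2"
    using U_eq_0[of x t] by (cases "x \<in> {0..l}") auto
qed measurable

lemma coeff_mult_integrable:
  assumes f: "integrable lborel f" and [measurable]: "\<beta> \<in> borel_measurable borel" and \<beta>: "\<And>x. 0 \<le> \<beta> x" "\<And>x. \<beta> x \<le> K"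
  shows "integrable lborel (\<lambda>x. \<beta> x * f x)"
proof (rule integrable_of_abs_bound)
  have [measurable]: "f \<in> borel_measurable borel" using f by auto
  show "integrable lborel (\<lambda>x. K * \<bar>f x\<bar>)" using f by simp
  show "\<bar>\<beta> x * f x\<bar> \<le> K * \<bar>f x\<bar>" for x
    using \<beta>[of x] by (auto simp: abs_mult intro: mult_right_mono)
  show "(\<lambda>x. \<beta> x * f x) \<in> borel_measurable lborel" by measurable
qed

lemma moment_integrable:
  assumes [measurable]: "\<beta> \<in> borel_measurable borel" and \<beta>: "\<And>x. 0 \<le> \<beta> x" "\<And>x. \<beta> x \<le> K"
  shows "integrable lborel (\<lambda>x. moment \<beta> x t)"
  by (rule integrable_of_abs_bound[OF _ _ abs_moment_le[OF assms]]) auto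

text \<open>Pairing \<open>Q\<close> with v'' recovers the integrand of the weak form: over [0, q]
  the weight c + l - x integrates to c v'(l) + v(l).\<close>

lemma Q_test:
  assumes q: "q \<in> {0..l}" and t: "t \<in> {0..T}"
  shows "(\<integral>x. indicator {0..q} x * Q x t \<partial>lborel) =
     c_theta h \<theta> * D t * dV_end l (indicator {0..q}) +
     D t * set_lebesgue_integral lborel {0..l} (\<lambda>s. (l - s) * indicator {0..q} s)
     - (\<integral>x. moment (clip \<mu>0 \<mu>1 \<mu>A) x t * indicator {0..q} x \<partial>lborel)
     - (\<integral>x. indicator {0..T} t * (clip r0 r1 rA x * U x t + clip \<kappa>0 \<kappa>1 \<kappa>A x * V x t) * indicator {0..q} x \<partial>lborel)"
proof -
  let ?q = "indicator {0..q} :: real \<Rightarrow> real"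
  have i1: "integrable lborel (\<lambda>x. ?q x * (l - x))"
    using borel_integrable_compact[of "{0..q}" "\<lambda>x. l - x"] by (simp add: continuous_intros indicator_scaleR_eq_if)
  have i2: "integrable lborel (\<lambda>x. moment (clip \<mu>0 \<mu>1 \<mu>A) x t * ?q x)"
    using integrable_indicator_times[OF moment_integrable[OF _ \<mu>_bounds]] by (simp add: mult.commute)
  have "integrable lborel (\<lambda>x. clip r0 r1 rA x * U x t + clip \<kappa>0 \<kappa>1 \<kappa>A x * V x t)"
    by (intro Bochner_Integration.integrable_add coeff_mult_integrable U_integrable_space W_integrable_space)
       (use r_bounds \<kappa>_bounds r0_pos \<kappa>0_pos in \<open>auto intro: order.trans[OF less_imp_le]\<close>)
  from integrable_indicator_times[OF this, of "{0..q}"]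
  have i3: "integrable lborel (\<lambda>x. indicator {0..T} t * (clip r0 r1 rA x * U x t + clip \<kappa>0 \<kappa>1 \<kappa>A x * V x t) * ?q x)"
    using t by (simp add: mult.commute)
  have v1: "dV_end l ?q = (\<integral>x. ?q x \<partial>lborel)"
    unfolding dV_end_def set_lebesgue_integral_def
    by (rule Bochner_Integration.integral_cong) (use q in \<open>auto simp: indicator_def\<close>)
  have v2: "set_lebesgue_integral lborel {0..l} (\<lambda>s. (l - s) * ?q s) = (\<integral>x. ?q x * (l - x) \<partial>lborel)"
    unfolding set_lebesgue_integral_def
    by (rule Bochner_Integration.integral_cong) (use q in \<open>auto simp: indicator_def\<close>)
  have "(\<integral>x. ?q x * Q x t \<partial>lborel) = (\<integral>x. (c_theta h \<theta> * D t) * ?q x + D t * (?q x * (l - x))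
     - moment (clip \<mu>0 \<mu>1 \<mu>A) x t * ?q x
     - indicator {0..T} t * (clip r0 r1 rA x * U x t + clip \<kappa>0 \<kappa>1 \<kappa>A x * V x t) * ?q x \<partial>lborel)"
    by (rule Bochner_Integration.integral_cong[OF refl])
       (use q t in \<open>auto simp: Q_def indicator_def algebra_simps\<close>)
  also have "\<dots> = (c_theta h \<theta> * D t) * (\<integral>x. ?q x \<partial>lborel) + D t * (\<integral>x. ?q x * (l - x) \<partial>lborel)
     - (\<integral>x. moment (clip \<mu>0 \<mu>1 \<mu>A) x t * ?q x \<partial>lborel)
     - (\<integral>x. indicator {0..T} t * (clip r0 r1 rA x * U x t + clip \<kappa>0 \<kappa>1 \<kappa>A x * V x t) * ?q x \<partial>lborel)"
  proof -
    have i0: "integrable lborel (\<lambda>x. (c_theta h \<theta> * D t) * ?q x)" by simp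
    have i1': "integrable lborel (\<lambda>x. D t * (?q x * (l - x)))" using i1 by simp
    note i01 = Bochner_Integration.integrable_add[OF i0 i1']
    note i012 = Bochner_Integration.integrable_diff[OF i01 i2]
    show ?thesis
      unfolding Bochner_Integration.integral_diff[OF i012 i3] Bochner_Integration.integral_diff[OF i01 i2]
        Bochner_Integration.integral_add[OF i0 i1'] by simp
  qed
  finally show ?thesis unfolding v1 v2 .
qed

lemma P_test:
  "(\<integral>s. indicator {0..t} s * (\<integral>x. indicator {0..q} x * Q x s \<partial>lborel) \<partial>lborel) = (\<integral>x. indicator {0..q} x * P x t \<partial>lborel)"
proof -
  have i: "integrable (lborel \<Otimes>\<^sub>M lborel) (\<lambda>(x, s). indicator {0..q} x * (indicator {0..t} s * Q x s))"
  proof (rule Bochner_Integration.integrable_bound[OF Q_integrable])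
    show "(\<lambda>(x, s). indicator {0..q} x * (indicator {0..t} s * Q x s)) \<in> borel_measurable (lborel \<Otimes>\<^sub>M lborel)"
      by measurable
  qed (auto simp: indicator_def)
  have "(\<integral>s. indicator {0..t} s * (\<integral>x. indicator {0..q} x * Q x s \<partial>lborel) \<partial>lborel)
      = (\<integral>s. (\<integral>x. indicator {0..q} x * (indicator {0..t} s * Q x s) \<partial>lborel) \<partial>lborel)"
  proof (rule Bochner_Integration.integral_cong[OF refl])
    fix s
    have "(\<integral>x. indicator {0..q} x * (indicator {0..t} s * Q x s) \<partial>lborel) = (\<integral>x. indicator {0..t} s * (indicator {0..q} x * Q x s) \<partial>lborel)"
      by (rule Bochner_Integration.integral_cong) auto
    then show "indicator {0..t} s * (\<integral>x. indicator {0..q} x * Q x s \<partial>lborel) = (\<integral>x. indicator {0..q} x * (indicator {0..t} s * Q x s) \<partial>lborel)"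
      by simp
  qed
  also have "\<dots> = (\<integral>x. (\<integral>s. indicator {0..q} x * (indicator {0..t} s * Q x s) \<partial>lborel) \<partial>lborel)"
    by (rule lborel_pair.Fubini_integral[OF i])
  finally show ?thesis by (simp add: P_def)
qed

lemma P_integrable_space: "integrable lborel (\<lambda>x. P x t)"
  unfolding P_def
proof (rule lborel_pair.integrable_fst)
  show "integrable (lborel \<Otimes>\<^sub>M lborel) (\<lambda>(x, s). indicator {0..t} s * Q x s)"
  proof (rule Bochner_Integration.integrable_bound[OF Q_integrable])
    show "(\<lambda>(x, s). indicator {0..t} s * Q x s) \<in> borel_measurable (lborel \<Otimes>\<^sub>M lborel)"
      by measurable
  qed (auto simp: indicator_def)
qed

text \<open>The weak form for one fixed q: the x-primitive of the defect in the equation of motion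
  vanishes at q, outside a null set of times that depends on q.\<close>

lemma motion_test:
  assumes q: "q \<in> {0..l}"
  shows "AE t in lborel. t \<in> {0..T} \<longrightarrow> (\<integral>x. indicator {0..q} x * (moment (clip \<rho>0 \<rho>1 \<rho>A) x t - P x t) \<partial>lborel) = 0"
proof -
  let ?v = "\<lambda>x. set_lebesgue_integral lborel {0..x} (\<lambda>s. (x - s) * indicator {0..q} s)"
  let ?L = "\<lambda>\<beta> t. \<integral>x. (indicator {0..l} x * \<beta> x) * cut l T ut x t * kq q x \<partial>lborel"
  let ?S = "\<lambda>t. \<integral>x. ((indicator {0..l} x * rA x) * cut l T uxx x t + (indicator {0..l} x * \<kappa>A x) * cut l T uxxt x t) * indicator {0..q} x \<partial>lborel"
  let ?R = "\<lambda>s. c_theta h \<theta> * D s * dV_end l (indicator {0..q}) + D s * ?v l - ?L \<mu>A s - ?S s"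
  have [measurable]: "(\<lambda>x. indicator {0..l} x * rA x) \<in> borel_measurable borel" "(\<lambda>x. indicator {0..l} x * \<kappa>A x) \<in> borel_measurable borel"
     "(\<lambda>x. indicator {0..l} x * \<mu>A x) \<in> borel_measurable borel"
    using coeff_set_measurable by (simp_all add: set_borel_measurable_def)
  have L\<mu>: "AE t in lborel. ?L \<mu>A t = (\<integral>x. moment (clip \<mu>0 \<mu>1 \<mu>A) x t * indicator {0..q} x \<partial>lborel)"
    by (rule moment_test[OF coeff_set_measurable(2) _ \<mu>_bounds]) (use clip_AE in \<open>auto elim!: eventually_mono\<close>)
  have L\<rho>: "AE t in lborel. ?L \<rho>A t = (\<integral>x. moment (clip \<rho>0 \<rho>1 \<rho>A) x t * indicator {0..q} x \<partial>lborel)"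
    by (rule moment_test[OF coeff_set_measurable(1) _ \<rho>_bounds]) (use clip_AE in \<open>auto elim!: eventually_mono\<close>)
  have R: "AE s in lborel. s \<in> {0..T} \<longrightarrow> ?R s = (\<integral>x. indicator {0..q} x * Q x s \<partial>lborel)"
    using L\<mu> stress_test[of q] by eventually_elim (simp add: Q_test[OF q])
  have RP: "(\<integral>s. indicator {0..t} s * ?R s \<partial>lborel) = (\<integral>x. indicator {0..q} x * P x t \<partial>lborel)" if t: "t \<in> {0..T}" for t
  proof -
    have "(\<integral>s. indicator {0..t} s * ?R s \<partial>lborel) = (\<integral>s. indicator {0..t} s * (\<integral>x. indicator {0..q} x * Q x s \<partial>lborel) \<partial>lborel)"
    proof (rule integral_cong_AE)
      show "AE s in lborel. indicator {0..t} s * ?R s = indicator {0..t} s * (\<integral>x. indicator {0..q} x * Q x s \<partial>lborel)"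
        using R
      proof eventually_elim
        case (elim s)
        then show ?case using t by (cases "s \<in> {0..t}") auto
      qed
    qed measurable
    then show ?thesis by (simp only: P_test)
  qed
  have "AE t in lborel. t \<in> {0..T} \<longrightarrow>
           L2ip l (\<lambda>x. \<rho>A x * ut x t) ?v =
           set_lebesgue_integral lborel {0..t} (\<lambda>s.
              c_theta h \<theta> * g s * dV_end l (indicator {0..q}) + g s * ?v l
              - L2ip l (\<lambda>x. \<mu>A x * ut x s) ?v
              - L2ip l (\<lambda>x. rA x * uxx x s + \<kappa>A x * uxxt x s) (indicator {0..q}))"
    using weak inV_kq[of q] unfolding weak_solution_def by blast
  with L\<rho> show ?thesis
  proof eventually_elim
    case (elim t)
    show ?case
    proof
      assume t: "t \<in> {0..T}"
      have "(\<integral>x. moment (clip \<rho>0 \<rho>1 \<rho>A) x t * indicator {0..q} x \<partial>lborel) = L2ip l (\<lambda>x. \<rho>A x * ut x t) ?v"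
        using elim(1) L2ip_ut[OF t, of \<rho>A q] by simp
      also have "\<dots> = (\<integral>s. indicator {0..t} s * ?R s \<partial>lborel)"
      proof -
        have "L2ip l (\<lambda>x. \<rho>A x * ut x t) ?v = set_lebesgue_integral lborel {0..t} (\<lambda>s.
              c_theta h \<theta> * g s * dV_end l (indicator {0..q}) + g s * ?v l
              - L2ip l (\<lambda>x. \<mu>A x * ut x s) ?v
              - L2ip l (\<lambda>x. rA x * uxx x s + \<kappa>A x * uxxt x s) (indicator {0..q}))"
          using elim(2) t by blast
        also have "\<dots> = (\<integral>s. indicator {0..t} s * ?R s \<partial>lborel)"
          unfolding set_lebesgue_integral_def[of lborel "{0..t}"]
        proof (rule Bochner_Integration.integral_cong[OF refl])
          fix s
          show "indicator {0..t} s *\<^sub>R (c_theta h \<theta> * g s * dV_end l (indicator {0..q}) + g s * ?v l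
              - L2ip l (\<lambda>x. \<mu>A x * ut x s) ?v
              - L2ip l (\<lambda>x. rA x * uxx x s + \<kappa>A x * uxxt x s) (indicator {0..q})) = indicator {0..t} s * ?R s"
          proof (cases "s \<in> {0..t}")
            case True
            then have s: "s \<in> {0..T}" using t by auto
            show ?thesis unfolding g_eq_D[OF s] L2ip_ut[OF s] L2ip_stress[OF s] by simp
          qed simp
        qed
        finally show ?thesis .
      qed
      also have "\<dots> = (\<integral>x. indicator {0..q} x * P x t \<partial>lborel)" by (rule RP[OF t])
      finally have eq: "(\<integral>x. indicator {0..q} x * moment (clip \<rho>0 \<rho>1 \<rho>A) x t \<partial>lborel) = (\<integral>x. indicator {0..q} x * P x t \<partial>lborel)"
        by (simp add: mult.commute)
      have "integrable lborel (\<lambda>x. indicator {0..q} x * moment (clip \<rho>0 \<rho>1 \<rho>A) x t)"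
        "integrable lborel (\<lambda>x. indicator {0..q} x * P x t)"
        by (intro integrable_indicator_times moment_integrable[OF _ \<rho>_bounds] P_integrable_space; simp)+
      then show "(\<integral>x. indicator {0..q} x * (moment (clip \<rho>0 \<rho>1 \<rho>A) x t - P x t) \<partial>lborel) = 0"
        using eq by (simp add: right_diff_distrib)
    qed
  qed
qed

text \<open>A countable union of null sets is null, so almost every t serves all rational q at once.
  For such t the x-primitive of the defect vanishes on a dense set, and the defect vanishes almost
  everywhere.\<close>

sublocale beam_solution l T "c_theta h \<theta>" r0 \<kappa>0 K "clip \<rho>0 \<rho>1 \<rho>A" "clip \<mu>0 \<mu>1 \<mu>A" "clip r0 r1 rA" "clip \<kappa>0 \<kappa>1 \<kappa>A"
  gT V
proof
  have dense: "{0..l} \<subseteq> closure (\<rat> \<inter> {0..l})"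
  proof (rule dense_in_IccI[OF l_pos])
    fix a b assume "0 \<le> a" "a < b" "b \<le> l"
    then show "\<exists>t\<in>\<rat> \<inter> {0..l}. a < t \<and> t < b" using Rats_dense_in_real[OF \<open>a < b\<close>] by force
  qed
  have "countable (\<rat> \<inter> {0..l})" by (simp add: countable_rat countable_Int1)
  then have "AE t in lborel. \<forall>q\<in>\<rat> \<inter> {0..l}. t \<in> {0..T} \<longrightarrow>
     (\<integral>x. indicator {0..q} x * (moment (clip \<rho>0 \<rho>1 \<rho>A) x t - P x t) \<partial>lborel) = 0"
    using motion_test by (subst AE_ball_countable) auto
  then show "AE t in lborel. t \<in> {0..T} \<longrightarrow> (AE x in lborel. x \<in> {0..l} \<longrightarrow> moment (clip \<rho>0 \<rho>1 \<rho>A) x t = P x t)"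
  proof eventually_elim
    case (elim t)
    show ?case
    proof
      assume t: "t \<in> {0..T}"
      have i: "integrable lborel (\<lambda>x. moment (clip \<rho>0 \<rho>1 \<rho>A) x t - P x t)"
        by (intro Bochner_Integration.integrable_diff moment_integrable[OF _ \<rho>_bounds] P_integrable_space) simp
      have "AE x in lborel. x \<in> {0..l} \<longrightarrow> moment (clip \<rho>0 \<rho>1 \<rho>A) x t - P x t = 0"
        by (rule AE_eq_0_if_primitive_eq_0_dense[OF i _ dense]) (use elim t l_pos in auto)
      then show "AE x in lborel. x \<in> {0..l} \<longrightarrow> moment (clip \<rho>0 \<rho>1 \<rho>A) x t = P x t"
        by eventually_elim simp
    qed
  qed
qed

section \<open>Bounds for the norms of the original fields\<close>

lemma G_eq: "G = set_lebesgue_integral lborel {0..T} (\<lambda>t. (g' t)\<^sup>2)"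
  unfolding G_def set_lebesgue_integral_def
  by (rule Bochner_Integration.integral_cong) (auto simp: gT_def indicator_def)

lemma uxx_norm: "AE t in lborel. (\<integral>x. (cut l T uxx x t)\<^sup>2 \<partial>lborel) = indicator {0..T} t * y t"
  using uxx_eq_U'
proof eventually_elim
  case (elim t)
  have "(\<integral>x. (cut l T uxx x t)\<^sup>2 \<partial>lborel) = (\<integral>x. indicator {0..T} t * (U x t)\<^sup>2 \<partial>lborel)"
  proof (rule integral_cong_AE)
    show "AE x in lborel. (cut l T uxx x t)\<^sup>2 = indicator {0..T} t * (U x t)\<^sup>2"
      using elim
    proof eventually_elim
      case (elim x)
      then show ?case
        using U_eq_0[of x t] by (cases "x \<in> {0..l}"; cases "t \<in> {0..T}") (auto simp: cut_def)
    qed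
  qed measurable
  then show ?case by (simp add: y_def)
qed

lemma uxx_section_bound:
  "AE t in lborel. t \<in> {0..T} \<longrightarrow> set_lebesgue_integral lborel {0..l} (\<lambda>x. (uxx x t)\<^sup>2) \<le> A * exp T"
  using uxx_norm
proof eventually_elim
  case (elim t)
  show ?case
  proof
    assume t: "t \<in> {0..T}"
    have "set_lebesgue_integral lborel {0..l} (\<lambda>x. (uxx x t)\<^sup>2) = (\<integral>x. (cut l T uxx x t)\<^sup>2 \<partial>lborel)"
      unfolding set_lebesgue_integral_def
      by (rule Bochner_Integration.integral_cong) (use t in \<open>auto simp: cut_def indicator_def\<close>)
    then show "set_lebesgue_integral lborel {0..l} (\<lambda>x. (uxx x t)\<^sup>2) \<le> A * exp T"
      using elim y_le[OF t] t by simp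
  qed
qed

lemma uxx_bound:
  "set_lebesgue_integral lborel ({0..l} \<times> {0..T}) (\<lambda>(x, t). (uxx x t)\<^sup>2) \<le> A * (exp T - 1)"
proof -
  have "(\<integral>t. (\<integral>x. (cut l T uxx x t)\<^sup>2 \<partial>lborel) \<partial>lborel) = (\<integral>t. indicator {0..T} t * (indicator {0..T} t * y t) \<partial>lborel)"
  proof (rule integral_cong_AE)
    show "AE t in lborel. (\<integral>x. (cut l T uxx x t)\<^sup>2 \<partial>lborel) = indicator {0..T} t * (indicator {0..T} t * y t)"
      using uxx_norm by eventually_elim (auto simp: indicator_def)
  qed measurable
  then show ?thesis
    unfolding cut_integral[OF L2_fields(1)] using Y_le[of T] T_pos by (simp add: Y_def)
qed

text \<open>Almost everywhere u_t = w, and \<rho>0 w^2 \<le> \<rho> w^2 compares the norm with the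
  integral of \<open>E\<close>; this is the origin of r0 / (2 \<rho>0).\<close>

lemma ut_bound:
  "\<rho>0 * set_lebesgue_integral lborel ({0..l} \<times> {0..T}) (\<lambda>(x, t). (ut x t)\<^sup>2) \<le> r0 / 2 * (A * (exp T - 1))"
proof -
  have w2: "integrable lborel (\<lambda>x. (w x t)\<^sup>2)" for t
    using coeff_w_mult_w_integrable[of "\<lambda>_. K" t t] M_nonneg lower_pos
    by (cases "K = 0") (auto simp: power2_eq_square mult.assoc K_def)
  have "(\<integral>t. (\<integral>x. (cut l T ut x t)\<^sup>2 \<partial>lborel) \<partial>lborel) = (\<integral>t. (\<integral>x. (w x t)\<^sup>2 \<partial>lborel) \<partial>lborel)"
  proof (rule integral_cong_AE)
    show "AE t in lborel. (\<integral>x. (cut l T ut x t)\<^sup>2 \<partial>lborel) = (\<integral>x. (w x t)\<^sup>2 \<partial>lborel)"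
      using ut_eq_w'
    proof eventually_elim
      case (elim t)
      show ?case
      proof (rule integral_cong_AE)
        show "AE x in lborel. (cut l T ut x t)\<^sup>2 = (w x t)\<^sup>2" using elim by eventually_elim simp
      qed measurable
    qed
  qed measurable
  then have "\<rho>0 * set_lebesgue_integral lborel ({0..l} \<times> {0..T}) (\<lambda>(x, t). (ut x t)\<^sup>2) = (\<integral>t. \<rho>0 * (\<integral>x. (w x t)\<^sup>2 \<partial>lborel) \<partial>lborel)"
    unfolding cut_integral[OF L2_fields(2)] by simp
  also have "\<dots> \<le> (\<integral>t. E t \<partial>lborel)"
  proof (rule integral_mono)
    show "integrable lborel (\<lambda>t. \<rho>0 * (\<integral>x. (w x t)\<^sup>2 \<partial>lborel))"
      by (intro integrable_mult_right lborel_pair.integrable_snd) (use w_square_integrable in simp)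
    show "integrable lborel E" by (rule E_integrable)
    fix t
    have "\<rho>0 * (\<integral>x. (w x t)\<^sup>2 \<partial>lborel) = (\<integral>x. \<rho>0 * (w x t)\<^sup>2 \<partial>lborel)" by simp
    also have "\<dots> \<le> E t"
      unfolding E_def
    proof (rule integral_mono)
      show "integrable lborel (\<lambda>x. \<rho>0 * (w x t)\<^sup>2)" using w2 by simp
      show "integrable lborel (\<lambda>x. clip \<rho>0 \<rho>1 \<rho>A x * (w x t)\<^sup>2)"
        by (rule coeff_mult_integrable[OF w2 _ \<rho>_bounds]) simp
      show "\<rho>0 * (w x t)\<^sup>2 \<le> clip \<rho>0 \<rho>1 \<rho>A x * (w x t)\<^sup>2" for x
        by (rule mult_right_mono) (auto simp: clip_def)
    qed
    finally show "\<rho>0 * (\<integral>x. (w x t)\<^sup>2 \<partial>lborel) \<le> E t" .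
  qed
  also have "\<dots> \<le> r0 / 2 * (A * (exp T - 1))" by (rule E_integral_le)
  finally show ?thesis .
qed

text \<open>The norm is the dissipation term \<open>Z T\<close> of the energy estimate; dividing r0
  / 2 by 2 \<kappa>0 gives r0 / (4 \<kappa>0).\<close>

lemma uxxt_bound:
  "2 * \<kappa>0 * set_lebesgue_integral lborel ({0..l} \<times> {0..T}) (\<lambda>(x, t). (uxxt x t)\<^sup>2) \<le> r0 / 2 * (A * exp T)"
proof -
  have "set_lebesgue_integral lborel ({0..l} \<times> {0..T}) (\<lambda>(x, t). (uxxt x t)\<^sup>2) = (\<integral>t. (\<integral>x. (V x t)\<^sup>2 \<partial>lborel) \<partial>lborel)"
    unfolding cut_integral[OF L2_fields(3)]
  proof (rule integral_cong_AE)
    show "AE t in lborel. (\<integral>x. (cut l T uxxt x t)\<^sup>2 \<partial>lborel) = (\<integral>x. (V x t)\<^sup>2 \<partial>lborel)"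
      using V_AE'
    proof eventually_elim
      case (elim t)
      show ?case
      proof (rule integral_cong_AE)
        show "AE x in lborel. (cut l T uxxt x t)\<^sup>2 = (V x t)\<^sup>2" using elim by eventually_elim simp
      qed measurable
    qed
  qed measurable
  also have "\<dots> = Z T"
    unfolding Z_T using lborel_pair.integral_snd[of "\<lambda>x t. (V x t)\<^sup>2"] W_square
    by (simp add: lborel_prod case_prod_unfold)
  finally show ?thesis using Z_le by simp
qed

end

theorem theorem1:
  fixes l T h \<theta> \<rho>0 \<rho>1 \<mu>0 \<mu>1 r0 r1 \<kappa>0 \<kappa>1 :: real
    and \<rho>A \<mu> r \<kappa> g g' :: "real \<Rightarrow> real"
    and u ut uxx uxxt :: "real \<Rightarrow> real \<Rightarrow> real"
  assumes "l > 0" and "T > 0" and "h > 0"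
    and "set_borel_measurable lborel {0..l} \<rho>A" and "set_borel_measurable lborel {0..l} \<mu>"
    and "set_borel_measurable lborel {0..l} r" and "set_borel_measurable lborel {0..l} \<kappa>"
    and "0 < \<rho>0" and "0 \<le> \<mu>0" and "0 < r0" and "0 < \<kappa>0"
    and "AE x in lborel. x \<in> {0<..<l} \<longrightarrow>
           \<rho>0 \<le> \<rho>A x \<and> \<rho>A x \<le> \<rho>1 \<and> \<mu>0 \<le> \<mu> x \<and> \<mu> x \<le> \<mu>1 \<and>
           r0 \<le> r x \<and> r x \<le> r1 \<and> \<kappa>0 \<le> \<kappa> x \<and> \<kappa> x \<le> \<kappa>1"
    and "L2_on {0..T} g'"
    and "\<forall>t\<in>{0..T}. g t = set_lebesgue_integral lborel {0..t} g'"
    and "weak_solution l T h \<theta> \<rho>A \<mu> r \<kappa> g u ut uxx uxxt"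
  shows
    "let lhat = l + l^3 / 3;
         C0sq = 4 * lhat * (1 + T) / r0^2;
         C\<theta>sq = (2 * h * cos \<theta> / pi)^2;
         Cesq = exp T;
         C1sq = C0sq * (1 + C\<theta>sq) * Cesq;
         C2sq = C0sq * (1 + C\<theta>sq) * (1 + Cesq);
         G = set_lebesgue_integral lborel {0..T} (\<lambda>t. (g' t)^2)
     in (AE t in lborel. t \<in> {0..T} \<longrightarrow>
            set_lebesgue_integral lborel {0..l} (\<lambda>x. (uxx x t)^2) \<le> C1sq * G)
      \<and> set_lebesgue_integral lborel ({0..l} \<times> {0..T}) (\<lambda>(x,t). (uxx x t)^2) \<le> C2sq * G
      \<and> set_lebesgue_integral lborel ({0..l} \<times> {0..T}) (\<lambda>(x,t). (ut x t)^2)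
           \<le> r0 / (2 * \<rho>0) * C2sq * G
      \<and> set_lebesgue_integral lborel ({0..l} \<times> {0..T}) (\<lambda>(x,t). (uxxt x t)^2)
           \<le> r0 / (4 * \<kappa>0) * C2sq * G"
proof -
  interpret weak_beam l T h \<theta> \<rho>0 \<rho>1 \<mu>0 \<mu>1 r0 r1 \<kappa>0 \<kappa>1 \<rho>A \<mu> r \<kappa> g g' u ut uxx uxxt
    by standard (use assms in auto)
  \<comment> \<open>The common factor C_0^2 (1 + C_\<theta>^2) of both constants.\<close>
  define C where "C = 4 * (l + l^3 / 3) * (1 + T) / r0^2 * (1 + (2 * h * cos \<theta> / pi)^2)"
  have A_eq: "A = C * G"
  proof -
    have "A = 4 / r0\<^sup>2 * ((1 + (c_theta h \<theta>)\<^sup>2) * (l + l ^ 3 / 3)) * (1 + T) * G" by (rule A_def)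
    then show ?thesis unfolding c_theta_def[of h \<theta>] C_def by (simp add: mult_ac)
  qed
  have C1: "C * exp T * G = A * exp T" and C2: "C * (1 + exp T) * G = A * (1 + exp T)"
    by (simp_all add: A_eq)
  \<comment> \<open>The estimates come with exp T - 1 or exp T; both are relaxed to the common 1 +
    exp T of C_2^2.\<close>
  have mono: "A * (exp T - 1) \<le> A * (1 + exp T)" "A * exp T \<le> A * (1 + exp T)"
    using A_nonneg by (auto intro!: mult_left_mono)
  have b1: "AE t in lborel. t \<in> {0..T} \<longrightarrow> set_lebesgue_integral lborel {0..l} (\<lambda>x. (uxx x t)^2) \<le> C * exp T * G"
    unfolding C1 by (rule uxx_section_bound)
  have b2: "set_lebesgue_integral lborel ({0..l} \<times> {0..T}) (\<lambda>(x,t). (uxx x t)^2) \<le> C * (1 + exp T) * G"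
    unfolding C2 using uxx_bound mono by linarith
  have b3: "set_lebesgue_integral lborel ({0..l} \<times> {0..T}) (\<lambda>(x,t). (ut x t)^2) \<le> r0 / (2 * \<rho>0) * (C * (1 + exp T)) * G"
  proof -
    have "\<rho>0 * set_lebesgue_integral lborel ({0..l} \<times> {0..T}) (\<lambda>(x,t). (ut x t)^2) \<le> r0 / 2 * (A * (1 + exp T))"
      using ut_bound mult_left_mono[OF mono(1), of "r0 / 2"] r0_pos by linarith
    then have "set_lebesgue_integral lborel ({0..l} \<times> {0..T}) (\<lambda>(x,t). (ut x t)^2) \<le> r0 / 2 * (A * (1 + exp T)) / \<rho>0"
      using \<open>0 < \<rho>0\<close> by (simp add: pos_le_divide_eq mult.commute)
    then show ?thesis by (simp add: A_eq mult_ac)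
  qed
  have b4: "set_lebesgue_integral lborel ({0..l} \<times> {0..T}) (\<lambda>(x,t). (uxxt x t)^2) \<le> r0 / (4 * \<kappa>0) * (C * (1 + exp T)) * G"
  proof -
    have "(2 * \<kappa>0) * set_lebesgue_integral lborel ({0..l} \<times> {0..T}) (\<lambda>(x,t). (uxxt x t)^2) \<le> r0 / 2 * (A * (1 + exp T))"
      using uxxt_bound mult_left_mono[OF mono(2), of "r0 / 2"] r0_pos by linarith
    then have "set_lebesgue_integral lborel ({0..l} \<times> {0..T}) (\<lambda>(x,t). (uxxt x t)^2) \<le> r0 / 2 * (A * (1 + exp T)) / (2 * \<kappa>0)"
      using \<open>0 < \<kappa>0\<close> by (subst pos_le_divide_eq) (simp_all add: mult.commute)
    then show ?thesis by (simp add: A_eq mult_ac)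
  qed
  show ?thesis
    using b1 b2 b3 b4 unfolding Let_def G_eq C_def by blast
qed

end
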